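(* Let $\mathcal{F}$ be a class of $n$-variate Boolean functions closed under restrictions, and suppose that $M_k(\mathcal{F})\le b^k$ for some $b\ge1$ and $k>2$, and that $L_{1,i}(\mathcal{F})\le b^i$ for all $1\le i<k$. Then for every $\varepsilon>0$ there exists a $\Theta(\varepsilon^{2/k}/b^2)$-noticeable fractional pseudorandom generator for $\mathcal{F}$ with error $\varepsilon$ and seed length $O(\log\log n+\log k+\log(1/\varepsilon))$.
   Context: Boolean functions $f:\{-1,1\}^n\to\{-1,1\}$ are identified with their multilinear expansions $f(\mathbf{x})=\sum_{S\subseteq[n]}\hat f(S)\mathbf{x}^S$, $\mathbf{x}^S=\prod_{i\in S}x_i$, on $\mathbb{R}^n$. Closed under restrictions: fixing any subset of variables to values in $\{-1,1\}$ yields a function in the class. $L_{1,i}(f)=\sum_{|S|=i}|\hat f(S)|$, $L_{1,i}(\mathcal{F})=\max_{f\in\mathcal{F}}L_{1,i}(f)$; $M_k(f)=\max_{\mathbf{x}\in[-1,1]^n}|\sum_{|S|=k}\hat f(S)\mathbf{x}^S|$, $M_k(\mathcal{F})=\max_{f\in\mathcal{F}}M_k(f)$. A fractional PRG for $\mathcal{F}$ with error $\varepsilon$ is a random variable $\mathbf{X}\in[-1,1]^n$ with $|\mathbb{E}[f(\mathbf{X})]-f(\mathbf{0})|\le\varepsilon$ for all $f\in\mathcal{F}$; seed length $s$ means $\mathbf{X}=G(\mathbf{U}_s)$ for an explicit $G$ and uniform $\mathbf{U}_s\in\{-1,1\}^s$; $p$-noticeable means $\mathbb{E}[\mathbf{X}_i^2]\ge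 p$ for all $i$.
   Formalization: In the noticeability and seed-length bounds ε is replaced by min(1, ε), because for large ε the stated Θ(ε^{2/k}/b²) would exceed 1, the largest possible value of E[X_i²], and log(1/ε) would make the seed-length bound negative. *)

theory Defs
  imports "HOL-Probability.Probability"
begin

section \<open>Boolean functions and their multilinear expansions\<close>

text \<open>
  Coordinates are indexed by \<open>{..<n}\<close>. Points of the discrete cube are extensional, and so are the
  Boolean functions themselves, so that equality of Boolean functions is equality on the cube and
  there are only finitely many of them.
\<close>

definition cube :: "nat \<Rightarrow> (nat \<Rightarrow> real) set" where
  "cube n = {..<n} \<rightarrow>\<^sub>E {-1, 1}"

definition solid_cube :: "nat \<Rightarrow> (nat \<Rightarrow> real) set" where
  "solid_cube n = {x. \<forall>i<n. x i \<in> {-1..1}}"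

definition boolean_functions :: "nat \<Rightarrow> ((nat \<Rightarrow> real) \<Rightarrow> real) set" where
  "boolean_functions n = cube n \<rightarrow>\<^sub>E {-1, 1}"

definition fourier_coeff :: "nat \<Rightarrow> ((nat \<Rightarrow> real) \<Rightarrow> real) \<Rightarrow> nat set \<Rightarrow> real" where
  "fourier_coeff n f S = (\<Sum>x\<in>cube n. f x * (\<Prod>i\<in>S. x i)) / 2 ^ n"

definition multilinear :: "nat \<Rightarrow> ((nat \<Rightarrow> real) \<Rightarrow> real) \<Rightarrow> (nat \<Rightarrow> real) \<Rightarrow> real" where
  "multilinear n f x = (\<Sum>S\<in>Pow {..<n}. fourier_coeff n f S * (\<Prod>i\<in>S. x i))"

lemma multilinear_eq:
  assumes "x \<in> cube n"
  shows "multilinear n f x = f x"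
proof -
  have fin: "finite (cube n)"
    by (simp add: cube_def finite_PiE)
  have pm: "y i = -1 \<or> y i = 1" if "y \<in> cube n" "i < n" for y i
    using that by (auto simp: cube_def PiE_iff)
  have delta: "(\<Sum>S\<in>Pow {..<n}. (\<Prod>i\<in>S. y i) * (\<Prod>i\<in>S. x i)) = (if y = x then 2 ^ n else 0)"
    if y: "y \<in> cube n" for y
  proof -
    have "(\<Sum>S\<in>Pow {..<n}. (\<Prod>i\<in>S. y i) * (\<Prod>i\<in>S. x i)) = (\<Prod>i<n. y i * x i + 1)"
      by (subst prod_add) (auto simp: prod.distrib)
    also have "\<dots> = (if y = x then 2 ^ n else 0)"
    proof (cases "y = x")
      case True
      have "(\<Prod>i<n. x i * x i + 1) = (\<Prod>i<n. 2)"
        by (rule prod.cong) (use pm[OF assms] in fastforce)+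
      with True show ?thesis by simp
    next
      case False
      then obtain i where i: "i < n" "y i \<noteq> x i"
        using y assms unfolding cube_def by (meson PiE_ext lessThan_iff)
      then have "y i * x i + 1 = 0"
        using pm[OF y i(1)] pm[OF assms i(1)] by auto
      then show ?thesis
        using False i(1) by (auto intro!: prod_zero)
    qed
    finally show ?thesis .
  qed
  have "multilinear n f x =
      (\<Sum>S\<in>Pow {..<n}. \<Sum>y\<in>cube n. f y / 2 ^ n * ((\<Prod>i\<in>S. y i) * (\<Prod>i\<in>S. x i)))"
    by (simp add: multilinear_def fourier_coeff_def sum_divide_distrib sum_distrib_right
        mult.assoc)
  also have "\<dots> = (\<Sum>y\<in>cube n. f y / 2 ^ n * (\<Sum>S\<in>Pow {..<n}. (\<Prod>i\<in>S. y i) * (\<Prod>i\<in>S. x i)))"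
    by (subst sum.swap) (simp add: sum_distrib_left)
  also have "\<dots> = (\<Sum>y\<in>cube n. if y = x then f x else 0)"
    by (rule sum.cong) (auto simp: delta)
  also have "\<dots> = f x"
    using fin assms by simp
  finally show ?thesis .
qed

text \<open>
  A restriction is again regarded as a function of all \<open>n\<close> variables; it does not depend on those
  in \<open>J\<close>.
\<close>

definition restriction ::
    "nat \<Rightarrow> nat set \<Rightarrow> (nat \<Rightarrow> real) \<Rightarrow> ((nat \<Rightarrow> real) \<Rightarrow> real) \<Rightarrow> (nat \<Rightarrow> real) \<Rightarrow> real" where
  "restriction n J a f = (\<lambda>x\<in>cube n. f (\<lambda>i. if i \<in> J then a i else x i))"

definition closed_under_restrictions :: "nat \<Rightarrow> ((nat \<Rightarrow> real) \<Rightarrow> real) set \<Rightarrow> bool" where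
  "closed_under_restrictions n F \<longleftrightarrow>
     (\<forall>f\<in>F. \<forall>J\<subseteq>{..<n}. \<forall>a. (\<forall>i\<in>J. a i \<in> {-1, 1}) \<longrightarrow> restriction n J a f \<in> F)"


section \<open>Fourier level quantities\<close>

definition level :: "nat \<Rightarrow> nat \<Rightarrow> nat set set" where
  "level n k = {S. S \<subseteq> {..<n} \<and> card S = k}"

definition L1_level :: "nat \<Rightarrow> nat \<Rightarrow> ((nat \<Rightarrow> real) \<Rightarrow> real) \<Rightarrow> real" where
  "L1_level n i f = (\<Sum>S\<in>level n i. \<bar>fourier_coeff n f S\<bar>)"

definition M_level :: "nat \<Rightarrow> nat \<Rightarrow> ((nat \<Rightarrow> real) \<Rightarrow> real) \<Rightarrow> real" where
  "M_level n k f =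
     (SUP x\<in>solid_cube n. \<bar>\<Sum>S\<in>level n k. fourier_coeff n f S * (\<Prod>i\<in>S. x i)\<bar>)"

text \<open>The supremum in \<open>M_level\<close> is attained, by compactness.\<close>

definition L1_class :: "nat \<Rightarrow> nat \<Rightarrow> ((nat \<Rightarrow> real) \<Rightarrow> real) set \<Rightarrow> real" where
  "L1_class n i F = Max (L1_level n i ` F)"

definition M_class :: "nat \<Rightarrow> nat \<Rightarrow> ((nat \<Rightarrow> real) \<Rightarrow> real) set \<Rightarrow> real" where
  "M_class n k F = Max (M_level n k ` F)"


section \<open>Fractional pseudorandom generators\<close>

text \<open>A random variable in the solid cube is represented by its (discrete) distribution.\<close>

definition fractional_prg ::
    "nat \<Rightarrow> ((nat \<Rightarrow> real) \<Rightarrow> real) set \<Rightarrow> real \<Rightarrow> (nat \<Rightarrow> real) pmf \<Rightarrow> bool" where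
  "fractional_prg n F \<epsilon> X \<longleftrightarrow>
     set_pmf X \<subseteq> solid_cube n \<and>
     (\<forall>f\<in>F. \<bar>measure_pmf.expectation X (multilinear n f) - multilinear n f (\<lambda>_. 0)\<bar> \<le> \<epsilon>)"

definition noticeable :: "nat \<Rightarrow> real \<Rightarrow> (nat \<Rightarrow> real) pmf \<Rightarrow> bool" where
  "noticeable n p X \<longleftrightarrow> (\<forall>i<n. p \<le> measure_pmf.expectation X (\<lambda>x. (x i)\<^sup>2))"

definition uniform_bits :: "nat \<Rightarrow> (nat \<Rightarrow> real) pmf" where
  "uniform_bits s = pmf_of_set (cube s)"


section \<open>Explicitness\<close>

text \<open>
  A generator is explicit if one program computes it in polynomial time for all parameters. The
  machine model is a structured random access machine with registers \<open>R\<close> and a memory \<open>M\<close>, both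
  holding natural numbers. The only arithmetic is addition and truncated subtraction, so with unit
  costs (as counted below) polynomial time is the same as for Turing machines.
\<close>

datatype program =
    Set_Const nat nat
  | Add_Reg nat nat nat
  | Sub_Reg nat nat nat
  | Load nat nat
  | Store nat nat
  | Seq program program
  | If_Nonzero nat program program
  | While_Nonzero nat program

type_synonym state = "(nat \<Rightarrow> nat) \<times> (nat \<Rightarrow> nat)"

text \<open>\<open>runs P \<sigma> t \<tau>\<close>: started in \<open>\<sigma>\<close>, the program \<open>P\<close> halts in \<open>\<tau>\<close> after \<open>t\<close> steps.\<close>

inductive runs :: "program \<Rightarrow> state \<Rightarrow> nat \<Rightarrow> state \<Rightarrow> bool" where
  "runs (Set_Const r c) (R, M) 1 (R(r := c), M)"
| "runs (Add_Reg r p q) (R, M) 1 (R(r := R p + R q), M)"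
| "runs (Sub_Reg r p q) (R, M) 1 (R(r := R p - R q), M)"
| "runs (Load r p) (R, M) 1 (R(r := M (R p)), M)"
| "runs (Store r p) (R, M) 1 (R, M(R p := R r))"
| "runs P \<sigma> t \<sigma>' \<Longrightarrow> runs Q \<sigma>' t' \<tau> \<Longrightarrow> runs (Seq P Q) \<sigma> (t + t') \<tau>"
| "R r \<noteq> 0 \<Longrightarrow> runs P (R, M) t \<tau> \<Longrightarrow> runs (If_Nonzero r P Q) (R, M) (Suc t) \<tau>"
| "R r = 0 \<Longrightarrow> runs Q (R, M) t \<tau> \<Longrightarrow> runs (If_Nonzero r P Q) (R, M) (Suc t) \<tau>"
| "R r = 0 \<Longrightarrow> runs (While_Nonzero r P) (R, M) 1 (R, M)"
| "R r \<noteq> 0 \<Longrightarrow> runs P (R, M) t \<sigma> \<Longrightarrow> runs (While_Nonzero r P) \<sigma> t' \<tau> \<Longrightarrow>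
     runs (While_Nonzero r P) (R, M) (Suc (t + t')) \<tau>"

text \<open>
  A machine cannot read the real parameters \<open>b \<ge> 1\<close> and \<open>\<epsilon> > 0\<close>, so it is given the roundings
  \<open>\<lceil>b\<rceil>\<close> and \<open>\<lceil>1 / \<epsilon>\<rceil>\<close>. The registers hold these, the numbers \<open>n\<close> and \<open>k\<close>, the index \<open>i\<close> of the
  requested output coordinate and the seed length \<open>s\<close>; the memory holds the seed, \<open>-1\<close> being coded
  as \<open>0\<close>.
\<close>

definition initial_state ::
    "nat \<Rightarrow> nat \<Rightarrow> real \<Rightarrow> real \<Rightarrow> nat \<Rightarrow> nat \<Rightarrow> (nat \<Rightarrow> real) \<Rightarrow> state" where
  "initial_state n k b \<epsilon> i s u =
     ((\<lambda>r. if r < 6 then [n, k, nat \<lceil>b\<rceil>, nat \<lceil>1 / \<epsilon>\<rceil>, i, s] ! r else 0),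
      (\<lambda>j. if j < s \<and> u j = 1 then 1 else 0))"

text \<open>
  \<open>s n k b \<epsilon>\<close> is the seed length and \<open>G n k b \<epsilon>\<close> the map from seeds to points. Every coordinate of
  the output is a rational number, delivered as a difference of natural numbers over a positive
  denominator, within a number of steps polynomial in \<open>n\<close>, \<open>k\<close>, \<open>b\<close> and \<open>1 / \<epsilon>\<close>. As each of
  the \<open>n\<close> coordinates takes polynomial time, so does the whole output.
\<close>

definition explicit_generator ::
    "(nat \<Rightarrow> nat \<Rightarrow> real \<Rightarrow> real \<Rightarrow> nat) \<Rightarrow>
     (nat \<Rightarrow> nat \<Rightarrow> real \<Rightarrow> real \<Rightarrow> (nat \<Rightarrow> real) \<Rightarrow> nat \<Rightarrow> real) \<Rightarrow> bool" where
  "explicit_generator s G \<longleftrightarrow>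
     (\<exists>P a d. \<forall>n k b \<epsilon>. 2 < k \<longrightarrow> 1 \<le> b \<longrightarrow> 0 < \<epsilon> \<longrightarrow>
        (\<forall>u\<in>cube (s n k b \<epsilon>). \<forall>i<n. \<exists>t R M.
           runs P (initial_state n k b \<epsilon> i (s n k b \<epsilon>) u) t (R, M) \<and>
           t \<le> a * (n + k + nat \<lceil>b\<rceil> + nat \<lceil>1 / \<epsilon>\<rceil>) ^ d \<and>
           0 < R 2 \<and> G n k b \<epsilon> u i = (real (R 0) - real (R 1)) / real (R 2)))"

end

(* On a point y of the solid cube, f (t y) is expanded in t up to order k. The Lagrange remainder is
   controlled by M_k, because the k-th derivative of t \<mapsto> f (t y) is, up to the factor (1 - t)^k, an
   average of level-k forms of random restrictions of f. The terms of order 1 \<le> i < k are controlled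
   by L_{1,i} as soon as all moments E[Y^S] with 1 \<le> |S| < k are at most \<epsilon>. So X = t Y works for
   t of order \<epsilon>^(1/k) / b and any such Y with entries in [-1,1] whose second moments are bounded below.

   To get Y from O(log log n + log k + log (1/\<epsilon>)) random bits, take a prime p of size
   poly(k, log n, 1/\<epsilon>) and z1, z2, y nearly uniform modulo p. The index i is hashed to
   h_i = \<Sum> i_l z1^l, where the i_l are the binary digits of i; for fixed S these are distinct with high
   probability. Then v_i = y / (z2 - h_i) is almost |S|-wise independent modulo p, because the functions
   1 / (z - h_i) are linearly independent over F_p. Finally Y_i = w(v_i), where w is the autocorrelation
   of a balanced \<plusminus>1 function on Z/p: it is rational, of mean zero, and its Fourier coefficients
   are nonnegative with sum w(0) = 1, so no loss occurs when the product over S is expanded in characters. *)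

theory Submission
  imports Defs "HOL-Number_Theory.Cong"
begin

section \<open>Restrictions and Taylor expansion\<close>

text \<open>The seed budget shapes the generator. Random polynomials of degree k - 1 would give
  exact independence but cost about k log p bits. A reciprocal needs only z2 and y: a nontrivial
  combination of the 1 / (z2 - h_i) vanishes at no more than |S| points, and for every other z2 that
  is not a pole the factor y alone makes the character sum small. Using i itself in place of h_i
  would force p > n, hence log n bits; as the hash is a polynomial in z1 of degree about log n, two
  indices collide for about log n values of z1 at most, so p may be polynomial in k, log n and
  1/\<epsilon>. Moments of size \<epsilon>, rather than \<epsilon> / b^k, are enough because the
  scaling by t turns L_{1,j} \<le> b^j into a factor of at most 4^-j. A function w whose Fourier
  coefficients had absolute sum A > 1 could cost A^|S| in the moments, hence a number of seed bits
  linear in k. Since p and the three seed numbers are polynomially bounded, the machine can do its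
  arithmetic by counting.\<close>

lemma abs_mult_le_scaled: "\<bar>x\<bar> \<le> c \<Longrightarrow> 0 \<le> w \<Longrightarrow> \<bar>w * x\<bar> \<le> w * c" for x :: real
  by (simp add: abs_mult mult_left_mono)

lemma finite_cube: "finite (cube n)"
  by (simp add: cube_def finite_PiE)

lemma card_cube: "card (cube n) = 2 ^ n"
  by (simp add: cube_def card_PiE numeral_2_eq_2)

lemma sum_cube_prod: "(\<Sum>x\<in>cube n. \<Prod>i<n. g i (x i)) = (\<Prod>i<n. g i (-1) + g i 1)"
  for g :: "nat \<Rightarrow> real \<Rightarrow> real"
proof -
  have "(\<Prod>i<n. \<Sum>c\<in>{-1, 1}. g i c) = (\<Sum>x\<in>cube n. \<Prod>i<n. g i (x i))"
    unfolding cube_def by (rule prod_sum_PiE) auto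
  then show ?thesis by simp
qed

lemma prod_subset_if: "S \<subseteq> {..<n} \<Longrightarrow> (\<Prod>i\<in>S. h i) = (\<Prod>i<n. if i \<in> S then h i else 1)"
  for h :: "nat \<Rightarrow> real"
  by (metis Int_absorb1 finite_lessThan prod.inter_restrict)

lemma character_orthogonality:
  assumes "S \<subseteq> {..<n}" "T \<subseteq> {..<n}"
  shows "(\<Sum>x\<in>cube n. (\<Prod>i\<in>S. x i) * (\<Prod>i\<in>T. x i)) = (if S = T then 2 ^ n else 0)"
proof -
  let ?g = "\<lambda>i c::real. (if i \<in> S then c else 1) * (if i \<in> T then c else 1)"
  have "(\<Sum>x\<in>cube n. (\<Prod>i\<in>S. x i) * (\<Prod>i\<in>T. x i)) = (\<Sum>x\<in>cube n. \<Prod>i<n. ?g i (x i))"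
    by (simp only: prod_subset_if[OF assms(1)] prod_subset_if[OF assms(2)] prod.distrib)
  also have "\<dots> = (\<Prod>i<n. ?g i (-1) + ?g i 1)"
    by (rule sum_cube_prod)
  also have "\<dots> = (if S = T then 2 ^ n else 0)"
  proof (cases "S = T")
    case True
    have "(\<Prod>i<n. ?g i (-1) + ?g i 1) = (\<Prod>i<n. 2)"
      by (rule prod.cong) (use True in auto)
    with True show ?thesis by simp
  next
    case False
    then obtain i where "i < n" "i \<in> S \<longleftrightarrow> i \<notin> T" using assms by blast
    then have "?g i (-1) + ?g i 1 = 0" by auto
    with \<open>i < n\<close> have "(\<Prod>i<n. ?g i (-1) + ?g i 1) = 0" by (intro prod_zero) blast+
    with False show ?thesis by simp
  qed
  finally show ?thesis .
qed

text \<open>Identifies coefficients from any multilinear formula that is valid on the cube; this is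
  how the expansion of a restriction is found.\<close>

lemma fourier_coeff_unique:
  assumes g: "\<And>x. x \<in> cube n \<Longrightarrow> g x = (\<Sum>S\<in>Pow {..<n}. c S * (\<Prod>i\<in>S. x i))"
    and K: "K \<subseteq> {..<n}"
  shows "fourier_coeff n g K = c K"
proof -
  have "(\<Sum>x\<in>cube n. g x * (\<Prod>i\<in>K. x i)) =
      (\<Sum>S\<in>Pow {..<n}. c S * (\<Sum>x\<in>cube n. (\<Prod>i\<in>S. x i) * (\<Prod>i\<in>K. x i)))"
    by (simp add: g sum_distrib_right sum_distrib_left mult.assoc) (rule sum.swap)
  also have "\<dots> = (\<Sum>S\<in>Pow {..<n}. if S = K then c K * 2 ^ n else 0)"
    by (rule sum.cong) (auto simp: character_orthogonality K)
  also have "\<dots> = c K * 2 ^ n"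
    using K by (simp add: sum.delta)
  finally show ?thesis by (simp add: fourier_coeff_def)
qed

text \<open>Substituting \<open>a\<close> on \<open>J\<close> turns the monomial of \<open>S\<close>
  into a constant times the monomial of its free part \<open>S - J\<close>, so all \<open>S\<close>
  with the same free part are collected.\<close>

lemma fourier_coeff_restriction:
  assumes a: "\<forall>i\<in>J. a i \<in> {-1, 1}" and K: "K \<subseteq> {..<n}" and J: "J \<subseteq> {..<n}"
  shows "fourier_coeff n (restriction n J a f) K =
    (\<Sum>S | S \<subseteq> {..<n} \<and> S - J = K. fourier_coeff n f S * (\<Prod>i\<in>S \<inter> J. a i))"
proof (rule fourier_coeff_unique[OF _ K])
  fix x assume x: "x \<in> cube n"
  let ?y = "\<lambda>i. if i \<in> J then a i else x i"
  have y: "?y \<in> cube n" using x a J by (fastforce simp: cube_def PiE_iff extensional_def)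
  have split: "(\<Prod>i\<in>S. ?y i) = (\<Prod>i\<in>S \<inter> J. a i) * (\<Prod>i\<in>S - J. x i)" if "S \<subseteq> {..<n}" for S
  proof -
    have fin: "finite S" using that finite_subset by blast
    have "(\<Prod>i\<in>S. ?y i) = (\<Prod>i\<in>S \<inter> J. ?y i) * (\<Prod>i\<in>S - J. ?y i)"
      using prod.Int_Diff[OF fin] by blast
    then show ?thesis by (simp add: Int_def)
  qed
  have "restriction n J a f x = multilinear n f ?y"
    using x multilinear_eq[OF y] by (simp add: restriction_def)
  also have "\<dots> = (\<Sum>S\<in>Pow {..<n}. fourier_coeff n f S * (\<Prod>i\<in>S \<inter> J. a i) * (\<Prod>i\<in>S - J. x i))"
    unfolding multilinear_def by (rule sum.cong) (auto simp: split)
  also have "\<dots> = (\<Sum>T\<in>Pow {..<n}. \<Sum>S | S \<in> Pow {..<n} \<and> S - J = T.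
      fourier_coeff n f S * (\<Prod>i\<in>S \<inter> J. a i) * (\<Prod>i\<in>S - J. x i))"
    by (rule sum.group[symmetric]) auto
  also have "\<dots> = (\<Sum>T\<in>Pow {..<n}. (\<Sum>S | S \<subseteq> {..<n} \<and> S - J = T.
      fourier_coeff n f S * (\<Prod>i\<in>S \<inter> J. a i)) * (\<Prod>i\<in>T. x i))"
    by (rule sum.cong) (auto simp: sum_distrib_right intro!: sum.cong)
  finally show "restriction n J a f x = \<dots>" .
qed

text \<open>\<open>M_level\<close> is the supremum of the absolute value of this form over the solid
  cube.\<close>

definition hom_part :: "nat \<Rightarrow> nat \<Rightarrow> ((nat \<Rightarrow> real) \<Rightarrow> real) \<Rightarrow> (nat \<Rightarrow> real) \<Rightarrow> real" where
  "hom_part n k f x = (\<Sum>S\<in>level n k. fourier_coeff n f S * (\<Prod>i\<in>S. x i))"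

lemma finite_level: "finite (level n k)"
  by (rule finite_subset[of _ "Pow {..<n}"]) (auto simp: level_def)

lemma hom_part_restriction:
  assumes a: "\<forall>i\<in>J. a i \<in> {-1, 1}" and J: "J \<subseteq> {..<n}"
  shows "hom_part n k (restriction n J a f) z =
    (\<Sum>S | S \<subseteq> {..<n} \<and> card (S - J) = k.
      fourier_coeff n f S * (\<Prod>i\<in>S \<inter> J. a i) * (\<Prod>i\<in>S - J. z i))"
proof -
  have "hom_part n k (restriction n J a f) z =
    (\<Sum>K\<in>level n k. \<Sum>S | S \<in> {S. S \<subseteq> {..<n} \<and> card (S - J) = k} \<and> S - J = K.
      fourier_coeff n f S * (\<Prod>i\<in>S \<inter> J. a i) * (\<Prod>i\<in>S - J. z i))"
    unfolding hom_part_def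
    by (rule sum.cong[OF refl])
       (auto simp: level_def fourier_coeff_restriction[OF a _ J] sum_distrib_right intro!: sum.cong)
  also have "\<dots> = (\<Sum>S | S \<subseteq> {..<n} \<and> card (S - J) = k.
      fourier_coeff n f S * (\<Prod>i\<in>S \<inter> J. a i) * (\<Prod>i\<in>S - J. z i))"
    by (rule sum.group) (auto simp: finite_level level_def)
  finally show ?thesis .
qed

text \<open>The weights are the product distribution on the cube with mean \<open>y\<close>, so
  moments factor over the coordinates. With \<open>T = {}\<close> this says that the weights add up
  to 1.\<close>

lemma product_measure_moment:
  assumes "T \<subseteq> {..<n}"
  shows "(\<Sum>a\<in>cube n. (\<Prod>i<n. (1 + a i * y i) / 2) * (\<Prod>i\<in>T. a i)) = (\<Prod>i\<in>T. y i)"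
proof -
  let ?g = "\<lambda>i c::real. (1 + c * y i) / 2 * (if i \<in> T then c else 1)"
  have "(\<Sum>a\<in>cube n. (\<Prod>i<n. (1 + a i * y i) / 2) * (\<Prod>i\<in>T. a i)) = (\<Sum>a\<in>cube n. \<Prod>i<n. ?g i (a i))"
    by (simp only: prod_subset_if[OF assms] prod.distrib)
  also have "\<dots> = (\<Prod>i<n. ?g i (-1) + ?g i 1)"
    by (rule sum_cube_prod)
  also have "\<dots> = (\<Prod>i<n. if i \<in> T then y i else 1)"
    by (rule prod.cong) (auto simp: field_simps)
  finally show ?thesis by (simp add: prod_subset_if[OF assms])
qed

text \<open>Averaging over restrictions of the variables in \<open>J\<close> with bias \<open>y\<close> turns the fixed variables into \<open>y\<close>.\<close>

lemma random_restriction_bound: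
  assumes J: "J \<subseteq> {..<n}" and y: "y \<in> solid_cube n"
    and closed: "closed_under_restrictions n F" and f: "f \<in> F"
    and bound: "\<And>g. g \<in> F \<Longrightarrow> \<bar>hom_part n k g y\<bar> \<le> c"
  shows "\<bar>\<Sum>S | S \<subseteq> {..<n} \<and> card (S - J) = k. fourier_coeff n f S * (\<Prod>i\<in>S. y i)\<bar> \<le> c"
proof -
  let ?w = "\<lambda>a. \<Prod>i<n. (1 + a i * y i) / 2"
  let ?A = "{S. S \<subseteq> {..<n} \<and> card (S - J) = k}"
  have a: "\<forall>i\<in>J. a i \<in> {-1, 1}" if "a \<in> cube n" for a
    using that J by (auto simp: cube_def PiE_iff)
  have w: "0 \<le> ?w a" if "a \<in> cube n" for a
  proof (rule prod_nonneg)
    fix i assume "i \<in> {..<n}"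
    then have "a i = -1 \<or> a i = 1" "-1 \<le> y i" "y i \<le> 1"
      using that y by (auto simp: cube_def PiE_iff solid_cube_def)
    then show "0 \<le> (1 + a i * y i) / 2" by auto
  qed
  have eq: "(\<Sum>S\<in>?A. fourier_coeff n f S * (\<Prod>i\<in>S. y i)) =
      (\<Sum>a\<in>cube n. ?w a * hom_part n k (restriction n J a f) y)"
  proof -
    have split: "(\<Prod>i\<in>S. y i) = (\<Sum>a\<in>cube n. ?w a * ((\<Prod>i\<in>S \<inter> J. a i) * (\<Prod>i\<in>S - J. y i)))"
      if "S \<subseteq> {..<n}" for S
    proof -
      have fin: "finite S" using that finite_subset by blast
      have "(\<Prod>i\<in>S. y i) = (\<Prod>i\<in>S \<inter> J. y i) * (\<Prod>i\<in>S - J. y i)"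
        using prod.Int_Diff[OF fin] by blast
      also have "\<dots> = (\<Sum>a\<in>cube n. ?w a * (\<Prod>i\<in>S \<inter> J. a i)) * (\<Prod>i\<in>S - J. y i)"
        by (subst product_measure_moment) (use that in auto)
      finally show ?thesis by (simp add: sum_distrib_right mult.assoc)
    qed
    have "(\<Sum>S\<in>?A. fourier_coeff n f S * (\<Prod>i\<in>S. y i)) = (\<Sum>S\<in>?A. \<Sum>a\<in>cube n.
        ?w a * (fourier_coeff n f S * (\<Prod>i\<in>S \<inter> J. a i) * (\<Prod>i\<in>S - J. y i)))"
      by (rule sum.cong[OF refl], subst split)
         (auto simp: sum_distrib_left intro!: sum.cong)
    also have "\<dots> = (\<Sum>a\<in>cube n. \<Sum>S\<in>?A.
        ?w a * (fourier_coeff n f S * (\<Prod>i\<in>S \<inter> J. a i) * (\<Prod>i\<in>S - J. y i)))"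
      by (rule sum.swap)
    also have "\<dots> = (\<Sum>a\<in>cube n. ?w a * hom_part n k (restriction n J a f) y)"
      by (rule sum.cong[OF refl], subst hom_part_restriction[OF a J]) (auto simp: sum_distrib_left)
    finally show ?thesis .
  qed
  have "\<bar>\<Sum>a\<in>cube n. ?w a * hom_part n k (restriction n J a f) y\<bar> \<le> (\<Sum>a\<in>cube n. ?w a * c)"
  proof (rule order.trans[OF sum_abs sum_mono])
    fix x assume x: "x \<in> cube n"
    then have "restriction n J x f \<in> F"
      using closed f J a by (auto simp: closed_under_restrictions_def)
    then have "\<bar>hom_part n k (restriction n J x f) y\<bar> \<le> c" by (rule bound)
    then show "\<bar>?w x * hom_part n k (restriction n J x f) y\<bar> \<le> ?w x * c"
      using w[OF x] by (rule abs_mult_le_scaled)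
  qed
  also have "\<dots> = c"
    using product_measure_moment[of "{}" n y] by (simp flip: sum_distrib_right)
  finally show ?thesis using eq by simp
qed

section \<open>Taylor coefficients as averages over random restrictions\<close>

text \<open>Put each element of \<open>N\<close> into \<open>J\<close> independently with
  probability \<open>t\<close>: the number of elements of \<open>S\<close> left out is binomial, and
  the choices outside \<open>S\<close> have total weight 1. Apart from \<open>(1 - t) ^ k\<close>
  the right side is the \<open>k\<close>-th derivative of \<open>t ^ card S\<close> divided by
  \<open>k!\<close>, which is what links restrictions to Taylor coefficients.\<close>

lemma random_subset_level:
  fixes t :: real
  assumes N: "finite N" and S: "S \<subseteq> N"
  shows "(\<Sum>J | J \<subseteq> N \<and> card (S - J) = k. t ^ card J * (1 - t) ^ card (N - J)) =
    real (card S choose k) * (1 - t) ^ k * t ^ (card S - k)"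
proof -
  have finS: "finite S" using assms finite_subset by blast
  let ?g = "\<lambda>J. t ^ card J * (1 - t) ^ card (N - J)"
  let ?P = "{A. A \<subseteq> S \<and> card (S - A) = k}"
  have tot: "(\<Sum>B\<in>Pow A. t ^ card B * (1 - t) ^ card (A - B)) = 1" if "finite A" for A :: "'a set"
    using prod_add[OF that, of "\<lambda>_. t" "\<lambda>_. 1 - t"] by simp
  have "(\<Sum>J | J \<subseteq> N \<and> card (S - J) = k. ?g J) = (\<Sum>z\<in>(?P \<times> Pow (N - S)). ?g (fst z \<union> snd z))"
  proof (rule sum.reindex_bij_witness[of _ "\<lambda>z. fst z \<union> snd z" "\<lambda>J. (J \<inter> S, J - S)"])
    fix J assume J: "J \<in> {J. J \<subseteq> N \<and> card (S - J) = k}"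
    have "S - (J \<inter> S) = S - J" by blast
    with J show "(J \<inter> S, J - S) \<in> ?P \<times> Pow (N - S)" by auto
    show *: "fst (J \<inter> S, J - S) \<union> snd (J \<inter> S, J - S) = J" by auto
    show "?g (fst (J \<inter> S, J - S) \<union> snd (J \<inter> S, J - S)) = ?g J" by (simp only: *)
  next
    fix z assume z: "z \<in> ?P \<times> Pow (N - S)"
    then have "S - (fst z \<union> snd z) = S - fst z" by auto
    with z S show "fst z \<union> snd z \<in> {J. J \<subseteq> N \<and> card (S - J) = k}" by auto
    show "((fst z \<union> snd z) \<inter> S, fst z \<union> snd z - S) = z" using z by (cases z) auto
  qed
  also have "\<dots> = (\<Sum>A\<in>?P. \<Sum>B\<in>Pow (N - S). ?g (A \<union> B))"
    by (simp add: sum.cartesian_product case_prod_beta)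
  also have "\<dots> = (\<Sum>A\<in>?P. \<Sum>B\<in>Pow (N - S). t ^ (card S - k) * (1 - t) ^ k *
      (t ^ card B * (1 - t) ^ card (N - S - B)))"
  proof (intro sum.cong refl)
    fix A B assume A: "A \<in> ?P" and B: "B \<in> Pow (N - S)"
    have finA: "finite A" and finB: "finite B"
      using A B finS N by (auto intro: finite_subset)
    have cA: "card A + k = card S"
      using A finS by (auto simp: card_Diff_subset finA card_mono)
    have "card (A \<union> B) = card A + card B"
      using A B by (intro card_Un_disjoint finA finB) auto
    moreover have "card (N - (A \<union> B)) = card (S - A) + card (N - S - B)"
    proof -
      have "N - (A \<union> B) = (S - A) \<union> (N - S - B)" using A B S by auto
      then show ?thesis using N finS by (auto intro!: card_Un_disjoint)
    qed
    moreover have "card A = card S - k" using cA by simp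
    ultimately show "?g (A \<union> B) = t ^ (card S - k) * (1 - t) ^ k *
      (t ^ card B * (1 - t) ^ card (N - S - B))"
      using A by (simp add: power_add)
  qed
  also have "\<dots> = real (card ?P) * (t ^ (card S - k) * (1 - t) ^ k)"
    using tot[of "N - S"] N by (simp flip: sum_distrib_left)
  also have "card ?P = card {K. K \<subseteq> S \<and> card K = k}"
    by (rule bij_betw_same_card[of "\<lambda>A. S - A"], rule bij_betw_byWitness[of _ "\<lambda>A. S - A"])
       (auto simp: double_diff)
  also have "\<dots> = (card S choose k)"
    by (rule n_subsets[OF finS])
  finally show ?thesis by (simp add: mult_ac)
qed

text \<open>Inside the absolute value stands the \<open>k\<close>-th derivative of s \<mapsto> f (s
  y) at \<open>t\<close>, divided by \<open>k!\<close>. By \<open>random_subset_level\<close>, its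
  product with \<open>(1 - t) ^ k\<close> is the average of the sums in
  \<open>random_restriction_bound\<close> over a random \<open>J\<close> that contains each variable
  with probability \<open>t\<close>.\<close>

lemma taylor_coefficient_bound:
  assumes y: "y \<in> solid_cube n" and t: "0 \<le> t" "t \<le> 1"
    and closed: "closed_under_restrictions n F" and f: "f \<in> F"
    and bound: "\<And>g. g \<in> F \<Longrightarrow> \<bar>hom_part n k g y\<bar> \<le> c"
  shows "(1 - t) ^ k * \<bar>\<Sum>S\<in>Pow {..<n}. real (card S choose k) * t ^ (card S - k) *
    (fourier_coeff n f S * (\<Prod>i\<in>S. y i))\<bar> \<le> c"
proof -
  let ?h = "\<lambda>S. fourier_coeff n f S * (\<Prod>i\<in>S. y i)"
  let ?w = "\<lambda>J. t ^ card J * (1 - t) ^ card ({..<n} - J)"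
  have "(1 - t) ^ k * (\<Sum>S\<in>Pow {..<n}. real (card S choose k) * t ^ (card S - k) * ?h S) =
      (\<Sum>S\<in>Pow {..<n}. \<Sum>J | J \<in> Pow {..<n} \<and> card (S - J) = k. ?w J * ?h S)"
    unfolding sum_distrib_left
  proof (rule sum.cong[OF refl])
    fix S assume "S \<in> Pow {..<n}"
    then have "S \<subseteq> {..<n}" by simp
    from random_subset_level[OF finite_lessThan this, where k = k and t = t]
    show "(1 - t) ^ k * (real (card S choose k) * t ^ (card S - k) * ?h S) =
        (\<Sum>J | J \<in> Pow {..<n} \<and> card (S - J) = k. ?w J * ?h S)"
      by (simp flip: sum_distrib_right)
  qed
  also have "\<dots> = (\<Sum>J\<in>Pow {..<n}. \<Sum>S | S \<in> Pow {..<n} \<and> card (S - J) = k. ?w J * ?h S)"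
    by (rule sum.swap_restrict) auto
  finally have eq: "(1 - t) ^ k * (\<Sum>S\<in>Pow {..<n}. real (card S choose k) * t ^ (card S - k) * ?h S)
     = (\<Sum>J\<in>Pow {..<n}. ?w J * (\<Sum>S | S \<subseteq> {..<n} \<and> card (S - J) = k. ?h S))"
    by (simp add: sum_distrib_left)
  have "\<bar>\<Sum>J\<in>Pow {..<n}. ?w J * (\<Sum>S | S \<subseteq> {..<n} \<and> card (S - J) = k. ?h S)\<bar> \<le> (\<Sum>J\<in>Pow {..<n}. ?w J * c)"
  proof (rule order.trans[OF sum_abs sum_mono])
    fix J assume "J \<in> Pow {..<n}"
    then have "J \<subseteq> {..<n}" by simp
    from random_restriction_bound[OF this y closed f bound]
    have "\<bar>\<Sum>S | S \<subseteq> {..<n} \<and> card (S - J) = k. ?h S\<bar> \<le> c" .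
    moreover have "0 \<le> ?w J" using t by simp
    ultimately show "\<bar>?w J * (\<Sum>S | S \<subseteq> {..<n} \<and> card (S - J) = k. ?h S)\<bar> \<le> ?w J * c"
      by (rule abs_mult_le_scaled)
  qed
  also have "\<dots> = c"
    using prod_add[of "{..<n}" "\<lambda>_. t" "\<lambda>_. 1 - t"] by (simp flip: sum_distrib_right)
  finally have "\<bar>(1 - t) ^ k * (\<Sum>S\<in>Pow {..<n}. real (card S choose k) * t ^ (card S - k) * ?h S)\<bar> \<le> c"
    unfolding eq .
  then show ?thesis using t by (simp add: abs_mult)
qed

lemma multilinear_scale:
  "multilinear n f (\<lambda>i. t * y i) = (\<Sum>S\<in>Pow {..<n}. t ^ card S * (fourier_coeff n f S * (\<Prod>i\<in>S. y i)))"
  by (auto simp: multilinear_def prod.distrib intro!: sum.cong)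

lemma hom_part_scale: "hom_part n k f (\<lambda>i. t * y i) = t ^ k * hom_part n k f y"
  by (auto simp: hom_part_def prod.distrib level_def sum_distrib_left intro!: sum.cong)

text \<open>Lagrange's remainder is taken at an unknown \<open>s\<close> in (0, t], where
  \<open>taylor_coefficient_bound\<close> puts \<open>(1 - s) ^ k\<close> into the denominator;
  \<open>s \<le> t\<close> allows \<open>(1 - t) ^ k\<close> instead.\<close>

lemma taylor_remainder:
  assumes y: "y \<in> solid_cube n" and t: "0 < t" "t < 1"
    and closed: "closed_under_restrictions n F" and f: "f \<in> F"
    and bound: "\<And>g. g \<in> F \<Longrightarrow> \<bar>hom_part n k g y\<bar> \<le> c"
  shows "\<bar>multilinear n f (\<lambda>i. t * y i) - (\<Sum>j<k. hom_part n j f (\<lambda>i. t * y i))\<bar> \<le> c * (t / (1 - t)) ^ k"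
proof -
  let ?h = "\<lambda>S. fourier_coeff n f S * (\<Prod>i\<in>S. y i)"
  \<comment> \<open>The \<open>m\<close>-th derivative of s \<mapsto> f (s y). Where
    \<open>card S < m\<close> the truncated exponent does no harm, as the binomial coefficient is
    0.\<close>
  define D where "D m s = fact m * (\<Sum>S\<in>Pow {..<n}. real (card S choose m) * s ^ (card S - m) * ?h S)"
    for m s
  have deriv: "(D m has_real_derivative D (Suc m) s) (at s)" for m s
  proof -
    have *: "((\<lambda>s. real (j choose m) * s ^ (j - m)) has_real_derivative
        real (Suc m) * real (j choose Suc m) * s ^ (j - Suc m)) (at s)" for j
    proof -
      have "(j choose m) * (j - m) = Suc m * (j choose Suc m)"
      proof (cases "m \<le> j")
        case True
        then obtain d where "j = m + d" using le_Suc_ex by blast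
        then show ?thesis using Suc_times_binomial[of m j] by (simp add: algebra_simps)
      qed (simp add: binomial_eq_0)
      then have "real (j choose m) * real (j - m) = real (Suc m) * real (j choose Suc m)"
        by (metis of_nat_mult)
      then have "real (j choose m) * (real (j - m) * s ^ (j - m - 1)) =
          real (Suc m) * real (j choose Suc m) * s ^ (j - Suc m)"
        by (simp only: mult.assoc[symmetric]) (simp add: diff_Suc)
      moreover have "((\<lambda>s. s ^ (j - m)) has_real_derivative real (j - m) * s ^ (j - m - 1)) (at s)"
        by (auto intro!: derivative_eq_intros)
      ultimately show ?thesis
        using DERIV_cmult by metis
    qed
    show ?thesis unfolding D_def
      by (rule DERIV_cong, (rule DERIV_cmult DERIV_sum DERIV_cmult_right *)+)
         (simp add: sum_distrib_left mult_ac)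
  qed
  have D0: "D 0 s = multilinear n f (\<lambda>i. s * y i)" for s
    by (simp add: D_def multilinear_scale)
  have Dm: "D m 0 / fact m = hom_part n m f y" for m
  proof -
    have "D m 0 / fact m = (\<Sum>S\<in>Pow {..<n}. if card S = m then ?h S else 0)"
      unfolding D_def by (auto intro!: sum.cong simp: binomial_eq_0_iff)
    also have "\<dots> = hom_part n m f y"
      unfolding hom_part_def by (subst sum.inter_filter[symmetric]) (auto simp: level_def)
    finally show ?thesis .
  qed
  have "\<exists>s>0. s \<le> t \<and> D 0 t = (\<Sum>m<k. D m 0 / fact m * t ^ m) + D k s / fact k * t ^ k"
    by (rule Maclaurin2) (use t deriv in auto)
  then obtain s where s: "0 < s" "s \<le> t"
    "D 0 t = (\<Sum>m<k. D m 0 / fact m * t ^ m) + D k s / fact k * t ^ k" by blast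
  have "(\<Sum>j<k. hom_part n j f (\<lambda>i. t * y i)) = (\<Sum>m<k. D m 0 / fact m * t ^ m)"
    by (simp add: hom_part_scale Dm mult.commute)
  with s(3) have eq: "multilinear n f (\<lambda>i. t * y i) - (\<Sum>j<k. hom_part n j f (\<lambda>i. t * y i)) =
      D k s / fact k * t ^ k"
    by (simp add: D0)
  have "(1 - s) ^ k * \<bar>D k s / fact k\<bar> \<le> c"
    using taylor_coefficient_bound[OF y _ _ closed f bound, of s] s t by (simp add: D_def)
  moreover have "(1 - t) ^ k \<le> (1 - s) ^ k" using s t by (intro power_mono) auto
  then have "(1 - t) ^ k * \<bar>D k s / fact k\<bar> \<le> (1 - s) ^ k * \<bar>D k s / fact k\<bar>"
    by (rule mult_right_mono) simp
  ultimately have "(1 - t) ^ k * \<bar>D k s / fact k\<bar> \<le> c" by linarith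
  then have "\<bar>D k s / fact k\<bar> \<le> c / (1 - t) ^ k"
    using t by (simp add: pos_le_divide_eq mult.commute)
  then have "\<bar>D k s / fact k\<bar> * t ^ k \<le> c / (1 - t) ^ k * t ^ k"
    using t by (intro mult_right_mono) auto
  moreover have "\<bar>D k s / fact k * t ^ k\<bar> = \<bar>D k s / fact k\<bar> * t ^ k"
    using t by (simp add: abs_mult)
  ultimately show ?thesis using eq by (simp add: power_divide)
qed

section \<open>From small moments to a fractional generator\<close>

lemma geometric_quarter_le: "(\<Sum>j\<in>{1..<k}. (1 / 4) ^ j) \<le> (1 / 3 :: real)"
proof -
  have closed: "(\<Sum>j\<in>{1..<Suc m}. (1 / 4) ^ j) = (1 - (1 / 4) ^ m) / (3 :: real)" for m
  proof (induction m)
    case (Suc m)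
    have "(\<Sum>j\<in>{1..<Suc (Suc m)}. (1 / 4) ^ j) = (\<Sum>j\<in>{1..<Suc m}. (1 / 4) ^ j) + (1 / 4 :: real) ^ Suc m"
      by simp
    then show ?case unfolding Suc by (simp add: diff_divide_distrib)
  qed simp
  have "(\<Sum>j\<in>{1..<k}. (1 / 4) ^ j) \<le> (\<Sum>j\<in>{1..<Suc k}. (1 / 4 :: real) ^ j)"
    by (rule sum_mono2) auto
  also have "\<dots> = (1 - (1 / 4) ^ k) / 3" by (rule closed)
  also have "\<dots> \<le> 1 / 3" by simp
  finally show ?thesis .
qed

text \<open>\<open>SUP\<close> and \<open>Max\<close> are upper bounds only on bounded and on finite
  sets: the coefficient sum \<open>L1_level\<close> bounds the form on the solid cube, and there are
  finitely many Boolean functions.\<close>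

lemma hom_part_le_M_class:
  assumes F: "F \<subseteq> boolean_functions n" and g: "g \<in> F" and y: "y \<in> solid_cube n"
  shows "\<bar>hom_part n k g y\<bar> \<le> M_class n k F"
proof -
  have fin: "finite F"
    by (rule finite_subset[OF F]) (simp add: boolean_functions_def finite_PiE finite_cube)
  have "\<bar>hom_part n k g x\<bar> \<le> L1_level n k g" if x: "x \<in> solid_cube n" for x
    unfolding hom_part_def L1_level_def
  proof (rule order.trans[OF sum_abs sum_mono])
    fix S assume "S \<in> level n k"
    then have "\<bar>\<Prod>i\<in>S. x i\<bar> \<le> 1"
      unfolding abs_prod by (intro prod_le_1) (use x in \<open>auto simp: level_def solid_cube_def abs_le_iff subset_iff\<close>)
    then show "\<bar>fourier_coeff n g S * (\<Prod>i\<in>S. x i)\<bar> \<le> \<bar>fourier_coeff n g S\<bar>"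
      by (simp add: abs_mult mult_left_le)
  qed
  then have "bdd_above ((\<lambda>x. \<bar>hom_part n k g x\<bar>) ` solid_cube n)" by (intro bdd_aboveI2)
  then have "\<bar>hom_part n k g y\<bar> \<le> (SUP x\<in>solid_cube n. \<bar>hom_part n k g x\<bar>)"
    by (rule cSUP_upper[OF y])
  also have "\<dots> = M_level n k g" by (simp add: M_level_def hom_part_def)
  also have "\<dots> \<le> M_class n k F"
    unfolding M_class_def using fin g by (intro Max_ge) auto
  finally show ?thesis .
qed

lemma L1_level_le_L1_class:
  assumes "F \<subseteq> boolean_functions n" "g \<in> F"
  shows "L1_level n i g \<le> L1_class n i F"
proof -
  have "finite F"
    by (rule finite_subset[OF assms(1)]) (simp add: boolean_functions_def finite_PiE finite_cube)
  with assms(2) show ?thesis unfolding L1_class_def by (intro Max_ge) auto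
qed

text \<open>\<open>A\<close> is the seed space. Error budget: as \<open>t \<le> 1 / 4\<close>, the
  Taylor remainder is at most \<open>(b * (4 / 3 * t)) ^ k = (4 * (t * b)) ^ k / 3 ^ k \<le> e /
  3\<close>; level \<open>j\<close> contributes at most
  \<open>(t * b) ^ j * e \<le> e / 4 ^ j\<close>, over all \<open>j \<ge> 1\<close> at most
  \<open>e / 3\<close>; level 0 is the value at the origin and cancels.\<close>

lemma fractional_prg_scaled:
  fixes Y :: "'a \<Rightarrow> nat \<Rightarrow> real"
  assumes F: "F \<subseteq> boolean_functions n" "closed_under_restrictions n F"
    and M: "M_class n k F \<le> b ^ k" and L1: "\<And>i. 1 \<le> i \<Longrightarrow> i < k \<Longrightarrow> L1_class n i F \<le> b ^ i"
    and A: "finite A" "A \<noteq> {}" and Y: "\<And>a i. a \<in> A \<Longrightarrow> i < n \<Longrightarrow> \<bar>Y a i\<bar> \<le> 1"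
    and moment: "\<And>S. S \<subseteq> {..<n} \<Longrightarrow> S \<noteq> {} \<Longrightarrow> card S < k \<Longrightarrow>
      \<bar>\<Sum>a\<in>A. \<Prod>i\<in>S. Y a i\<bar> \<le> e * real (card A)"
    and t: "0 < t" "4 * (t * b) \<le> 1" "(4 * (t * b)) ^ k \<le> e" and b: "1 \<le> b" and k: "0 < k"
  shows "fractional_prg n F e (map_pmf (\<lambda>a i. t * Y a i) (pmf_of_set A))"
proof -
  have e0: "0 < e" using t b by (meson less_le_trans mult_pos_pos zero_less_numeral zero_less_one zero_less_power)
  have t1: "t \<le> 1 / 4"
    using mult_left_mono[OF b, of t] t(1,2) by linarith
  have cA: "real (card A) > 0" using A by (simp add: card_gt_0_iff)
  have tb: "0 \<le> t * b" "t * b \<le> 1 / 4" using t(1,2) b by simp_all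
  have ec: "0 \<le> e * real (card A)" using e0 by simp
  have solid: "Y a \<in> solid_cube n" if "a \<in> A" for a
    using Y that by (force simp: solid_cube_def abs_le_iff)
  have "\<bar>measure_pmf.expectation (map_pmf (\<lambda>a i. t * Y a i) (pmf_of_set A)) (multilinear n f) -
      multilinear n f (\<lambda>_. 0)\<bar> \<le> e" if f: "f \<in> F" for f
  proof -
    let ?g = "\<lambda>a. multilinear n f (\<lambda>i. t * Y a i)"
    let ?h = "\<lambda>j a. hom_part n j f (\<lambda>i. t * Y a i)"
    have E: "measure_pmf.expectation (map_pmf (\<lambda>a i. t * Y a i) (pmf_of_set A)) (multilinear n f) =
        (\<Sum>a\<in>A. ?g a) / real (card A)"
      using A by (simp add: integral_pmf_of_set)
    have f0: "multilinear n f (\<lambda>_. 0) = fourier_coeff n f {}"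
    proof -
      have "multilinear n f (\<lambda>_. 0) = (\<Sum>S\<in>Pow {..<n}. if S = {} then fourier_coeff n f {} else 0)"
        unfolding multilinear_def
      proof (rule sum.cong[OF refl])
        fix S assume "S \<in> Pow {..<n}"
        then have "finite S" by (auto intro: finite_subset)
        then show "fourier_coeff n f S * (\<Prod>i\<in>S. 0) = (if S = {} then fourier_coeff n f {} else 0)"
          by (auto simp: card_gt_0_iff)
      qed
      then show ?thesis by (simp add: sum.delta)
    qed
    have rem: "\<bar>?g a - (\<Sum>j<k. ?h j a)\<bar> \<le> e / 3" if a: "a \<in> A" for a
    proof -
      have "\<bar>hom_part n k g (Y a)\<bar> \<le> b ^ k" if "g \<in> F" for g
        using hom_part_le_M_class[OF F(1) that solid[OF a], of k] M by linarith
      then have "\<bar>?g a - (\<Sum>j<k. ?h j a)\<bar> \<le> b ^ k * (t / (1 - t)) ^ k"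
        using t(1) t1 by (intro taylor_remainder[OF solid[OF a] _ _ F(2) f]) auto
      also have "\<dots> \<le> b ^ k * (4 / 3 * t) ^ k"
      proof -
        have "t / (1 - t) \<le> 4 / 3 * t" using t(1) t1 by (simp add: field_simps)
        moreover have "0 \<le> t / (1 - t)" using t(1) t1 by simp
        ultimately show ?thesis using b by (intro mult_left_mono power_mono) auto
      qed
      also have "\<dots> = (4 * (t * b)) ^ k * (1 / 3) ^ k"
        by (simp add: power_mult_distrib power_divide mult_ac)
      also have "\<dots> \<le> e * (1 / 3) ^ 1"
        by (intro mult_mono[OF t(3)] power_decreasing) (use k e0 in simp_all)
      finally show ?thesis by simp
    qed
    have low: "\<bar>\<Sum>a\<in>A. ?h j a\<bar> \<le> (1 / 4) ^ j * (e * real (card A))" if j: "1 \<le> j" "j < k" for j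
    proof -
      have "(\<Sum>a\<in>A. ?h j a) = (\<Sum>S\<in>level n j. t ^ j * fourier_coeff n f S * (\<Sum>a\<in>A. \<Prod>i\<in>S. Y a i))"
      proof -
        have "(\<Sum>a\<in>A. ?h j a) = (\<Sum>a\<in>A. \<Sum>S\<in>level n j. t ^ j * fourier_coeff n f S * (\<Prod>i\<in>S. Y a i))"
          unfolding hom_part_scale unfolding hom_part_def sum_distrib_left mult.assoc ..
        also have "\<dots> = (\<Sum>S\<in>level n j. \<Sum>a\<in>A. t ^ j * fourier_coeff n f S * (\<Prod>i\<in>S. Y a i))"
          by (rule sum.swap)
        finally show ?thesis unfolding sum_distrib_left .
      qed
      also have "\<bar>\<dots>\<bar> \<le> (\<Sum>S\<in>level n j. t ^ j * \<bar>fourier_coeff n f S\<bar> * (e * real (card A)))"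
      proof (rule order.trans[OF sum_abs sum_mono])
        fix S assume "S \<in> level n j"
        then have S: "S \<subseteq> {..<n}" "card S = j" by (auto simp: level_def)
        then have "S \<noteq> {}" using j by auto
        with moment S j have "\<bar>\<Sum>a\<in>A. \<Prod>i\<in>S. Y a i\<bar> \<le> e * real (card A)" by simp
        then show "\<bar>t ^ j * fourier_coeff n f S * (\<Sum>a\<in>A. \<Prod>i\<in>S. Y a i)\<bar> \<le>
            t ^ j * \<bar>fourier_coeff n f S\<bar> * (e * real (card A))"
          using t(1) by (simp add: abs_mult mult_left_mono)
      qed
      also have "\<dots> = t ^ j * L1_level n j f * (e * real (card A))"
        unfolding L1_level_def sum_distrib_left sum_distrib_right ..
      also have "\<dots> \<le> t ^ j * b ^ j * (e * real (card A))"
        by (intro mult_right_mono mult_left_mono order.trans[OF L1_level_le_L1_class[OF F(1) f] L1[OF j]] ec)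
           (use t(1) in simp)
      also have "\<dots> = (t * b) ^ j * (e * real (card A))" by (simp add: power_mult_distrib)
      also have "\<dots> \<le> (1 / 4) ^ j * (e * real (card A))"
        by (rule mult_right_mono[OF power_mono[OF tb(2,1)] ec])
      finally show ?thesis .
    qed
    have h0: "?h 0 a = fourier_coeff n f {}" for a
    proof -
      have "level n 0 = {{}}" by (auto simp: level_def dest: finite_subset)
      then show ?thesis by (simp add: hom_part_def)
    qed
    have "{..<k} = insert 0 {1..<k}" using k by auto
    then have split: "(\<Sum>j<k. \<Sum>a\<in>A. ?h j a) = real (card A) * fourier_coeff n f {} + (\<Sum>j\<in>{1..<k}. \<Sum>a\<in>A. ?h j a)"
      by (simp add: h0)
    let ?R = "\<Sum>a\<in>A. ?g a - (\<Sum>j<k. ?h j a)" and ?L = "\<Sum>j\<in>{1..<k}. \<Sum>a\<in>A. ?h j a"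
    have eq: "(\<Sum>a\<in>A. ?g a) - real (card A) * fourier_coeff n f {} = ?R + ?L"
      using split sum.swap[of "\<lambda>a j. ?h j a" "{..<k}" A] by (simp only: sum_subtractf)
    have "\<bar>?R\<bar> \<le> (\<Sum>a\<in>A. e / 3)"
      by (rule order.trans[OF sum_abs sum_mono]) (rule rem)
    then have R: "\<bar>?R\<bar> \<le> 1 / 3 * (e * real (card A))" by (simp add: mult.commute)
    have "\<bar>?L\<bar> \<le> (\<Sum>j\<in>{1..<k}. (1 / 4) ^ j * (e * real (card A)))"
      by (rule order.trans[OF sum_abs sum_mono]) (rule low, auto)
    also have "\<dots> = (\<Sum>j\<in>{1..<k}. (1 / 4) ^ j) * (e * real (card A))"
      by (rule sum_distrib_right[symmetric])
    also have "\<dots> \<le> 1 / 3 * (e * real (card A))"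
      by (rule mult_right_mono[OF geometric_quarter_le]) (use e0 cA in simp)
    finally have L: "\<bar>?L\<bar> \<le> 1 / 3 * (e * real (card A))" .
    have "0 < e * real (card A)" using e0 cA by simp
    then have "\<bar>(\<Sum>a\<in>A. ?g a) - real (card A) * fourier_coeff n f {}\<bar> \<le> e * real (card A)"
      unfolding eq using R L by linarith
    moreover have "(\<Sum>a\<in>A. ?g a) / real (card A) - fourier_coeff n f {} =
        ((\<Sum>a\<in>A. ?g a) - real (card A) * fourier_coeff n f {}) / real (card A)"
      using cA by (simp add: diff_divide_distrib)
    ultimately show ?thesis unfolding E f0 using cA by (simp add: abs_divide pos_divide_le_eq)
  qed
  moreover have "set_pmf (map_pmf (\<lambda>a i. t * Y a i) (pmf_of_set A)) \<subseteq> solid_cube n"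
  proof -
    have "(\<lambda>i. t * Y a i) \<in> solid_cube n" if "a \<in> A" for a
    proof -
      have "\<bar>t * Y a i\<bar> \<le> 1" if "i < n" for i
        using mult_mono[of "\<bar>t\<bar>" 1 "\<bar>Y a i\<bar>" 1] Y[OF \<open>a \<in> A\<close> that] t(1) t1 by (simp add: abs_mult)
      then show ?thesis by (force simp: solid_cube_def abs_le_iff)
    qed
    then show ?thesis using A by auto
  qed
  ultimately show ?thesis by (simp add: fractional_prg_def)
qed

section \<open>Primes and roots modulo a prime\<close>

text \<open>The reciprocals below form Leibniz's harmonic triangle, whose entries are integer combinations
  of the unit fractions \<open>1, 1/2, \<dots>, 1/N\<close>.\<close>

lemma leibniz_triangle:
  assumes "c \<le> r"
  shows "1 / (real (Suc (Suc r)) * real (Suc r choose Suc c)) =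
    1 / (real (Suc r) * real (r choose c)) - 1 / (real (Suc (Suc r)) * real (Suc r choose c))"
proof -
  define K where "K = real (r choose c)"
  have K: "K > 0" using assms by (simp add: K_def)
  obtain d where d: "r = c + d" using assms le_Suc_ex by blast
  have *: "real (Suc c) * real (Suc r choose Suc c) = real (Suc r) * K"
    unfolding K_def by (metis Suc_times_binomial of_nat_mult)
  have "Suc d * (Suc r choose c) = Suc r * (r choose c)"
    using binomial_absorb_comp[of "Suc r" c] d by (simp add: Suc_diff_le)
  then have **: "real (Suc d) * real (Suc r choose c) = real (Suc r) * K"
    unfolding K_def by (metis of_nat_mult)
  have 1: "real (Suc r choose Suc c) = real (Suc r) * K / real (Suc c)"
    using * by (simp add: field_simps)
  have 2: "real (Suc r choose c) = real (Suc r) * K / real (Suc d)"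
    using ** by (simp add: field_simps)
  have "real (Suc c) / (real (Suc (Suc r)) * (real (Suc r) * K)) =
      1 / (real (Suc r) * K) - real (Suc d) / (real (Suc (Suc r)) * (real (Suc r) * K))"
  proof -
    define x where "x = real (Suc r)"
    have "x > 0" "real (Suc (Suc r)) = x + 1" "real (Suc c) = x + 1 - real (Suc d)"
      using d by (auto simp: x_def)
    moreover from this K have "1 / (x * K) = (x + 1) / ((x + 1) * (x * K))" by simp
    ultimately show ?thesis by (simp only: x_def[symmetric] diff_divide_distrib)
  qed
  then show ?thesis
    unfolding 1 2 K_def[symmetric] by (simp add: field_simps)
qed

text \<open>Multiplied by the lcm, the border of Leibniz's triangle becomes integral, and its
  recurrence carries integrality inward by induction on \<open>c\<close>.\<close>

lemma binomial_times_Suc_dvd_Lcm: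
  assumes "c \<le> r" "r < N"
  shows "Suc r * (r choose c) dvd Lcm {1..N}"
proof -
  let ?L = "Lcm {1..N}"
  have "real ?L / (real (Suc r) * real (r choose c)) \<in> \<int>"
    using assms
  proof (induction c arbitrary: r)
    case 0
    then have "Suc r dvd ?L" by (intro dvd_Lcm) auto
    then obtain q where "?L = Suc r * q" by blast
    then have "real ?L / (real (Suc r) * real (r choose 0)) = real q"
      by (simp only: of_nat_mult) (simp del: of_nat_Suc)
    then show ?case by (metis Ints_of_nat)
  next
    case (Suc c)
    then obtain r' where r': "r = Suc r'" by (cases r) auto
    with Suc have "c \<le> r'" by simp
    from leibniz_triangle[OF this]
    have "real ?L / (real (Suc r) * real (r choose Suc c)) =
        real ?L / (real (Suc r') * real (r' choose c)) - real ?L / (real (Suc r) * real (r choose c))"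
      unfolding r' by (metis (no_types, opaque_lifting) mult.right_neutral right_diff_distrib times_divide_eq_right)
    moreover have "real ?L / (real (Suc r') * real (r' choose c)) \<in> \<int>"
      "real ?L / (real (Suc r) * real (r choose c)) \<in> \<int>"
      using Suc r' by (auto intro!: Suc.IH simp del: of_nat_Suc)
    ultimately show ?case by simp
  qed
  then obtain z where "real ?L / (real (Suc r) * real (r choose c)) = of_int z"
    by (auto elim: Ints_cases)
  moreover have pos: "real (Suc r) * real (r choose c) > 0"
    using assms by (simp del: of_nat_Suc)
  ultimately have "real ?L = of_int z * (real (Suc r) * real (r choose c))"
    by (simp add: field_simps)
  then have "int ?L = z * int (Suc r * (r choose c))"
    by (metis of_int_eq_iff of_int_mult of_int_of_nat_eq of_nat_mult)
  then show ?thesis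
    by (metis dvd_triv_right int_dvd_int_iff)
qed

text \<open>Nair's bound: each of the \<open>r + 1\<close> entries of row \<open>r\<close> of
  Pascal's triangle is at most the lcm over \<open>r + 1\<close>, and the row adds up to
  \<open>2 ^ r\<close>.\<close>

lemma Lcm_ge_power: "2 ^ r \<le> Lcm {1..Suc r}"
proof -
  have "Lcm {1..Suc r} \<noteq> (0::nat)" by (auto simp: Lcm_0_iff)
  then have "Suc r * (r choose c) \<le> Lcm {1..Suc r}" if "c \<le> r" for c
    using binomial_times_Suc_dvd_Lcm[OF that, of "Suc r"] by (meson dvd_imp_le gr0I lessI)
  then have "(\<Sum>c\<le>r. Suc r * (r choose c)) \<le> (\<Sum>c\<le>r. Lcm {1..Suc r})"
    by (intro sum_mono) auto
  then have "Suc r * 2 ^ r \<le> Suc r * Lcm {1..Suc r}"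
    by (simp only: sum_distrib_left[symmetric] choose_row_sum) simp
  then show ?thesis using mult_le_cancel1 by blast
qed

text \<open>The multiplicity of \<open>p\<close> in an lcm is the maximum of the multiplicities. The
  exponent is positive so that the empty lcm, 1, is excluded.\<close>

lemma prime_power_dvd_Lcm:
  assumes "prime (p::nat)" "finite A" "0 \<notin> A" "p ^ Suc e dvd Lcm A"
  shows "\<exists>a\<in>A. p ^ Suc e dvd a"
  using assms(2-4)
proof (induction A)
  case empty
  with assms(1) show ?case by (simp add: prime_gt_1_nat)
next
  case (insert a A)
  have nz: "a \<noteq> 0" "Lcm A \<noteq> 0" using insert by (auto simp: Lcm_0_iff)
  have "Suc e \<le> multiplicity p (lcm a (Lcm A))"
    using insert.prems nz assms(1) by (subst power_dvd_iff_le_multiplicity[symmetric]) (auto simp: lcm_eq_0_iff)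
  then have "Suc e \<le> multiplicity p a \<or> Suc e \<le> multiplicity p (Lcm A)"
    using nz assms(1) by (simp add: multiplicity_lcm max_def split: if_splits)
  then show ?case using insert by (meson insertCI insert_iff multiplicity_dvd')
qed

text \<open>Every prime power that divides the lcm divides a single number up to \<open>N\<close>,
  so each prime contributes a factor of at most \<open>N\<close>. Together with
  \<open>Lcm_ge_power\<close> this is a Chebyshev-type lower bound on the number of primes.\<close>

lemma Lcm_le_power_card_primes: "Lcm {1..N} \<le> N ^ card {p. prime p \<and> p \<le> (N::nat)}"
proof -
  define L where "L = Lcm {1..N}"
  let ?P = "{p. prime p \<and> p \<le> N}"
  have L: "L > 0" unfolding L_def by (rule gr0I) (auto simp: Lcm_0_iff)
  have le: "p ^ multiplicity p L \<le> N" "p \<le> N" if p: "p \<in> prime_factors L" for p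
  proof -
    have "prime p" using p by auto
    have "multiplicity p L > 0" using p by (simp add: prime_factors_multiplicity)
    then obtain e where e: "multiplicity p L = Suc e" using gr0_conv_Suc by blast
    have "p ^ Suc e dvd L" by (metis e multiplicity_dvd)
    from prime_power_dvd_Lcm[OF \<open>prime p\<close> _ _ this[unfolded L_def]]
    obtain a where a: "a \<in> {1..N}" "p ^ Suc e dvd a" by auto
    then have "p ^ Suc e \<le> a" by (intro dvd_imp_le) auto
    moreover have "p \<le> p ^ Suc e" using prime_gt_0_nat[OF \<open>prime p\<close>] by simp
    moreover have "a \<le> N" using a by simp
    ultimately show "p ^ multiplicity p L \<le> N" "p \<le> N" unfolding e by linarith+
  qed
  have "L = (\<Prod>p\<in>prime_factors L. p ^ multiplicity p L)"
    by (rule prime_factorization_nat[OF L])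
  also have "\<dots> \<le> (\<Prod>p\<in>prime_factors L. N)"
    by (rule prod_mono) (use le(1) in simp)
  also have "\<dots> = N ^ card (prime_factors L)" by simp
  also have "\<dots> \<le> N ^ card ?P"
  proof (cases "N = 0")
    case False
    have "finite ?P" by (rule finite_subset[of _ "{..N}"]) auto
    moreover have "prime_factors L \<subseteq> ?P" using le(2) by auto
    ultimately have "card (prime_factors L) \<le> card ?P" by (rule card_mono)
    with False show ?thesis by (intro power_increasing) auto
  next
    case True
    then have "card ?P = 0" using not_prime_0 by (metis (mono_tags, lifting) Collect_empty_eq card.empty le_zero_eq)
    then show ?thesis using True by (simp only: L_def) simp
  qed
  finally show ?thesis unfolding L_def .
qed

text \<open>A weak form of Bertrand's postulate. Were the interval free of primes, at most
  \<open>2 ^ l\<close> primes would lie below \<open>N = 2 ^ (2 * l + 4)\<close>, and the two lcm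
  bounds would give \<open>2 ^ (N - 1) \<le> N ^ (2 ^ l)\<close>. The wide interval only doubles the
  bit length of the modulus, which the seed length can afford.\<close>

lemma prime_in_interval: "\<exists>p::nat. prime p \<and> 2 ^ l \<le> p \<and> p \<le> 2 ^ (2 * l + 4)"
proof (rule ccontr)
  assume no: "\<not> ?thesis"
  define u where "u = 2 * l + 4"
  define N :: nat where "N = 2 ^ u"
  have "{p. prime p \<and> p \<le> N} \<subseteq> {1..2 ^ l}"
  proof
    fix p assume "p \<in> {p. prime p \<and> p \<le> N}"
    then have "prime p" "p \<le> 2 ^ (2 * l + 4)" by (auto simp: u_def N_def)
    with no have "p < 2 ^ l" by (meson not_le)
    with prime_ge_1_nat[OF \<open>prime p\<close>] show "p \<in> {1..2 ^ l}" by simp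
  qed
  then have c: "card {p. prime p \<and> p \<le> N} \<le> 2 ^ l"
    by (metis card_atLeastAtMost card_mono diff_Suc_1 finite_atLeastAtMost)
  have "N \<ge> 1" by (simp add: N_def)
  then obtain r where r: "N = Suc r" by (cases N) auto
  have "2 ^ r \<le> N ^ card {p. prime p \<and> p \<le> N}"
    using Lcm_ge_power[of r] Lcm_le_power_card_primes[of N] r by simp
  also have "\<dots> \<le> N ^ 2 ^ l"
    using \<open>N \<ge> 1\<close> c by (intro power_increasing) auto
  also have "\<dots> = 2 ^ (u * 2 ^ l)"
    by (simp add: N_def power_mult)
  finally have "r \<le> u * 2 ^ l" by simp
  \<comment> \<open>With \<open>L = 2 ^ l\<close> this follows from
    \<open>(2 * l + 4) * L + 1 < 16 * (L * L) = N\<close>.\<close>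
  moreover have "u * 2 ^ l < r"
  proof -
    define L :: nat where "L = 2 ^ l"
    have "l < L" by (simp add: L_def)
    then have "u \<le> 2 * L + 2" by (simp add: u_def)
    then have "u * L + 1 \<le> (2 * L + 2) * L + 1" by (metis add_le_mono1 mult_le_mono1)
    also have "\<dots> \<le> 5 * (L * L)"
    proof -
      have "1 \<le> L" by (simp add: L_def)
      then have "1 \<le> L * L" "L \<le> L * L" by auto
      moreover have "(2 * L + 2) * L + 1 = 2 * (L * L) + 2 * L + 1" by (simp add: algebra_simps)
      ultimately show ?thesis by linarith
    qed
    also have "\<dots> < 16 * (L * L)" by (simp add: L_def)
    also have "\<dots> = N"
    proof -
      have "u = l + l + 4" by (simp add: u_def)
      then show ?thesis unfolding N_def L_def by (simp only: power_add) simp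
    qed
    finally have "u * L + 1 < Suc r" by (simp only: r)
    then show ?thesis unfolding L_def by linarith
  qed
  ultimately show False by simp
qed

section \<open>Roots of polynomials modulo a prime\<close>

text \<open>Lagrange's theorem over Z/p, phrased for integer polynomials: one coefficient prime to
  \<open>p\<close> witnesses that the polynomial is nonzero modulo \<open>p\<close>. The induction
  divides off a root; the degree over the integers may exceed that modulo \<open>p\<close>, which
  only weakens the bound.\<close>

lemma card_roots_mod_prime:
  fixes f :: "int poly" and p :: nat
  assumes p: "prime p" and c: "\<not> int p dvd coeff f j"
  shows "card {z. z < p \<and> int p dvd poly f (int z)} \<le> degree f"
  using c
proof (induction "degree f" arbitrary: f j)
  case 0
  then have "f = [:coeff f 0:]" by (simp add: degree_eq_zeroE[of f] poly_eqI coeff_eq_0 coeff_pCons split: nat.split)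
  moreover have "j = 0" using 0 by (metis coeff_eq_0 dvd_0_right gr0I)
  ultimately have "\<not> int p dvd poly f x" for x
    using 0 by (metis add.right_neutral mult_zero_right poly_0 poly_pCons)
  then show ?case by simp
next
  case (Suc d)
  let ?R = "\<lambda>f. {z. z < p \<and> int p dvd poly f (int z)}"
  show ?case
  proof (cases "?R f = {}")
    case False
    then obtain r where r: "r < p" "int p dvd poly f (int r)" by auto
    define g where "g = synthetic_div f (int r)"
    \<comment> \<open>The remainder \<open>poly f (int r)\<close> is 0 only modulo \<open>p\<close>,
      so it has to be carried along.\<close>
    have fg: "f = [:- int r, 1:] * g + [:poly f (int r):]"
      unfolding g_def by (rule synthetic_div_correct'[symmetric])
    have deg: "degree g = d" using Suc by (simp add: g_def degree_synthetic_div)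
    have "\<exists>j. \<not> int p dvd coeff g j"
    proof (rule ccontr)
      assume "\<not> ?thesis"
      then have all: "int p dvd coeff g j" for j by blast
      have "int p dvd coeff ([:- int r, 1:] * g + [:poly f (int r):]) j"
        using all r(2) by (auto simp: coeff_pCons split: nat.split intro!: dvd_add dvd_diff)
      then show False using Suc.prems fg by metis
    qed
    then obtain j' where "\<not> int p dvd coeff g j'" by blast
    from Suc.hyps(1)[OF _ this] deg have IH: "card (?R g) \<le> d" by simp
    have "?R f \<subseteq> insert r (?R g)"
    proof
      fix z assume z: "z \<in> ?R f"
      have "poly f (int z) = (int z - int r) * poly g (int z) + poly f (int r)"
        using arg_cong[OF fg, of "\<lambda>f. poly f (int z)"] by (simp add: algebra_simps)
      then have "int p dvd (int z - int r) * poly g (int z)"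
        using z r by (metis (no_types, lifting) add_diff_cancel_right' dvd_diff mem_Collect_eq)
      then have "int p dvd int z - int r \<or> int p dvd poly g (int z)"
        using p by (simp add: prime_dvd_mult_iff)
      moreover have "z = r" if "int p dvd int z - int r"
      proof -
        have "[int z = int r] (mod int p)" using that by (simp add: cong_iff_dvd_diff)
        then show ?thesis using z r by (simp add: cong_int_iff cong_less_modulus_unique_nat)
      qed
      ultimately show "z \<in> insert r (?R g)" using z by auto
    qed
    then have "card (?R f) \<le> card (insert r (?R g))" by (intro card_mono) auto
    also have "\<dots> \<le> Suc (card (?R g))" by (simp add: card_insert_if)
    finally show ?thesis using IH Suc by simp
  qed (metis card.empty le0)
qed

section \<open>Hashing and reciprocals modulo a prime\<close>

text \<open>The range \<open>l < i\<close> covers every binary digit of \<open>i\<close>, since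
  \<open>i < 2 ^ i\<close>; thus the hash is independent of \<open>n\<close> and a program needs no
  word length.\<close>

definition hash :: "nat \<Rightarrow> nat \<Rightarrow> nat \<Rightarrow> nat" where
  "hash p z i = (\<Sum>l<i. if odd (i div 2 ^ l) then z ^ l else 0) mod p"

text \<open>Exhaustive search written as a sum, in the shape of the loop that computes it: for prime
  \<open>p\<close> one \<open>w\<close> qualifies if \<open>d\<close> is invertible, and otherwise
  the value is 0.\<close>

definition inv_mod :: "nat \<Rightarrow> nat \<Rightarrow> nat" where
  "inv_mod p d = (\<Sum>w<p. if w * d mod p = 1 then w else 0)"

lemma
  assumes p: "prime p" and d: "\<not> p dvd d"
  shows inv_mod_mult: "inv_mod p d * d mod p = 1"
    and inv_mod_less': "inv_mod p d < p"
proof -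
  have cop: "coprime d p" using p d by (metis coprime_commute prime_imp_coprime)
  then obtain x where x: "[d * x = 1] (mod p)" using cong_solve_coprime_nat by auto
  define w where "w = x mod p"
  have p1: "1 < p" using p by (rule prime_gt_1_nat)
  have w: "w < p" "w * d mod p = 1"
    using x p1 by (simp_all add: w_def cong_def mult.commute[of _ d] mod_mult_right_eq)
  have "w' = w" if "w' < p" "w' * d mod p = 1" for w'
  proof -
    have "[w' * d = w * d] (mod p)" using that w by (simp add: cong_def)
    then have "[w' = w] (mod p)" using cop by (simp add: cong_mult_rcancel_nat)
    then show ?thesis using that(1) w(1) by (rule cong_less_modulus_unique_nat)
  qed
  then have eq: "v * d mod p = 1 \<longleftrightarrow> v = w" if "v < p" for v
    using that w(2) by blast
  have "inv_mod p d = (\<Sum>v<p. if v = w then w else 0)"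
    unfolding inv_mod_def by (intro sum.cong refl if_cong eq) auto
  also have "\<dots> = w" using w by (simp add: sum.delta)
  finally show "inv_mod p d * d mod p = 1" "inv_mod p d < p" using w by simp_all
qed

lemma inv_mod_dvd:
  assumes "p dvd d"
  shows "inv_mod p d = 0"
proof -
  have "w * d mod p = 0" for w using assms by auto
  then show ?thesis by (simp add: inv_mod_def)
qed

lemma inv_mod_less: "prime p \<Longrightarrow> inv_mod p d < p"
  by (cases "p dvd d") (simp_all add: inv_mod_dvd inv_mod_less' prime_gt_0_nat)

text \<open>A residue has at most \<open>q div p + 1\<close> representatives below \<open>q\<close>,
  and \<open>p * (q div p + 1) \<le> 2 * q\<close>. So replacing a uniform residue by a uniform
  \<open>z < q\<close> at most doubles the probability of a bad set.\<close>

lemma card_mod_mem_le: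
  assumes A: "A \<subseteq> {..<p}" and p: "0 < p" "p \<le> q"
  shows "p * card {z. z < q \<and> z mod p \<in> A} \<le> 2 * q * card A"
proof -
  have fA: "finite A" using A finite_subset by blast
  have "{z. z < q \<and> z mod p \<in> A} \<subseteq> (\<lambda>(r, t). r + p * t) ` (A \<times> {..q div p})"
  proof
    fix z assume z: "z \<in> {z. z < q \<and> z mod p \<in> A}"
    then have "(z mod p, z div p) \<in> A \<times> {..q div p}" by (auto intro: div_le_mono)
    then show "z \<in> (\<lambda>(r, t). r + p * t) ` (A \<times> {..q div p})"
      by (rule rev_image_eqI) simp
  qed
  then have "card {z. z < q \<and> z mod p \<in> A} \<le> card ((\<lambda>(r, t). r + p * t) ` (A \<times> {..q div p}))"
    using fA by (intro card_mono) auto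
  also have "\<dots> \<le> card (A \<times> {..q div p})" using fA by (intro card_image_le) auto
  also have "\<dots> = card A * Suc (q div p)" by (simp add: card_cartesian_product)
  finally have "p * card {z. z < q \<and> z mod p \<in> A} \<le> card A * (p + p * (q div p))"
    by (metis (no_types, lifting) mult.left_commute mult_Suc_right mult_le_mono2)
  also have "p + p * (q div p) \<le> 2 * q"
    using p by (metis add_mono mult_2 times_div_less_eq_dividend)
  finally show ?thesis by (simp add: mult.commute)
qed

text \<open>Brings the hashes of all indices below \<open>2 ^ W\<close> to a common range of
  exponents, so that they can be compared as polynomials in \<open>z\<close>.\<close>

lemma hash_cong:
  assumes "i < 2 ^ W"
  shows "[int (hash p z i) = (\<Sum>l<W. of_bool (odd (i div 2 ^ l)) * int z ^ l)] (mod int p)"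
proof -
  let ?f = "\<lambda>l. if odd (i div 2 ^ l) then z ^ l else 0"
  have z: "?f l = 0" if "i \<le> l \<or> W \<le> l" for l
  proof -
    have "i < 2 ^ l"
    proof (cases "i \<le> l")
      case True
      then show ?thesis using less_exp[of l] by linarith
    next
      case False
      then have "(2::nat) ^ W \<le> 2 ^ l" using that by (intro power_increasing) auto
      then show ?thesis using assms by linarith
    qed
    then show ?thesis by simp
  qed
  have "(\<Sum>l<i. ?f l) = (\<Sum>l<i + W. ?f l)"
    by (rule sum.mono_neutral_left) (use z in auto)
  also have "\<dots> = (\<Sum>l<W. ?f l)"
    by (rule sum.mono_neutral_right) (use z in auto)
  finally have "(\<Sum>l<i. ?f l) = (\<Sum>l<W. ?f l)" .
  then have "int (hash p z i) = (\<Sum>l<W. of_bool (odd (i div 2 ^ l)) * int z ^ l) mod int p"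
    unfolding hash_def by (auto simp: zmod_int of_bool_def intro!: arg_cong[where f = "\<lambda>x. x mod int p"] sum.cong)
  then show ?thesis by (simp add: cong_def)
qed

text \<open>The difference of the two hashes is a polynomial in \<open>z\<close> with coefficients
  in {-1, 0, 1}; at a digit where \<open>i\<close> and \<open>j\<close> differ the coefficient is 1
  or -1, hence nonzero modulo \<open>p\<close>.\<close>

lemma card_hash_collisions:
  assumes p: "prime p" and ij: "i < 2 ^ W" "j < 2 ^ W" "i \<noteq> j"
  shows "card {z. z < p \<and> hash p z i = hash p z j} \<le> W"
proof -
  define c :: "nat \<Rightarrow> int" where "c l = of_bool (odd (i div 2 ^ l)) - of_bool (odd (j div 2 ^ l))" for l
  define f where "f = (\<Sum>l<W. monom (c l) l)"
  have "\<exists>l. bit i l \<noteq> bit j l" using ij(3) bit_eqI by blast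
  then obtain l where l: "bit i l \<noteq> bit j l" by blast
  have "l < W"
  proof (rule ccontr)
    assume "\<not> l < W"
    then have "(2::nat) ^ W \<le> 2 ^ l" by (intro power_increasing) auto
    with ij have "i div 2 ^ l = 0" "j div 2 ^ l = 0" by (meson div_less order_less_le_trans)+
    with l show False by (simp add: bit_iff_odd)
  qed
  then have "coeff f l = c l" by (simp add: f_def coeff_sum sum.delta')
  moreover have "c l = 1 \<or> c l = - 1" using l by (auto simp: c_def bit_iff_odd)
  moreover have "\<not> int p dvd 1" using prime_gt_1_nat[OF p] by simp
  ultimately have "\<not> int p dvd coeff f l" by auto
  from card_roots_mod_prime[OF p this]
  have "card {z. z < p \<and> int p dvd poly f (int z)} \<le> degree f" .
  moreover have "degree f \<le> W"
    unfolding f_def by (rule degree_sum_le) (auto intro: order.trans[OF degree_monom_le])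
  moreover have "card {z. z < p \<and> hash p z i = hash p z j} \<le> card {z. z < p \<and> int p dvd poly f (int z)}"
  proof (rule card_mono)
    show "{z. z < p \<and> hash p z i = hash p z j} \<subseteq> {z. z < p \<and> int p dvd poly f (int z)}"
    proof safe
      fix z assume eq: "hash p z i = hash p z j"
      have "[(\<Sum>l<W. of_bool (odd (i div 2 ^ l)) * int z ^ l) =
          (\<Sum>l<W. of_bool (odd (j div 2 ^ l)) * int z ^ l)] (mod int p)"
        by (rule cong_trans[OF cong_sym[OF hash_cong[OF ij(1), of p z, unfolded eq]] hash_cong[OF ij(2)]])
      then have "int p dvd (\<Sum>l<W. of_bool (odd (i div 2 ^ l)) * int z ^ l) -
          (\<Sum>l<W. of_bool (odd (j div 2 ^ l)) * int z ^ l)"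
        by (simp add: cong_iff_dvd_diff)
      also have "\<dots> = poly f (int z)"
        by (simp add: f_def poly_sum poly_monom c_def left_diff_distrib sum_subtractf)
      finally show "int p dvd poly f (int z)" .
    qed
  qed auto
  ultimately show ?thesis by linarith
qed

text \<open>The functions \<open>z \<mapsto> 1 / (z - \<eta> i)\<close> with distinct poles are linearly independent: clearing
  denominators gives a polynomial that does not vanish at the poles.\<close>

lemma card_cauchy_roots:
  fixes \<eta> a :: "'a \<Rightarrow> nat"
  assumes p: "prime p" and S: "finite S" "S \<noteq> {}" and inj: "inj_on \<eta> S"
    and \<eta>: "\<And>i. i \<in> S \<Longrightarrow> \<eta> i < p" and a: "\<And>i. i \<in> S \<Longrightarrow> \<not> p dvd a i"
  shows "card {z. z < p \<and> z \<notin> \<eta> ` S \<and>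
    p dvd (\<Sum>i\<in>S. a i * inv_mod p ((z + (p - \<eta> i)) mod p))} \<le> card S"
proof -
  let ?P = "int p"
  define f :: "int poly" where "f = (\<Sum>i\<in>S. smult (int (a i)) (\<Prod>j\<in>S - {i}. [:- int (\<eta> j), 1:]))"
  have polyf: "poly f x = (\<Sum>i\<in>S. int (a i) * (\<Prod>j\<in>S - {i}. x - int (\<eta> j)))" for x
    by (simp add: f_def poly_sum poly_prod)
  have pp: "prime ?P" using p by simp
  obtain i0 where i0: "i0 \<in> S" using S by blast
  have dist: "\<not> ?P dvd int (\<eta> i) - int (\<eta> j)" if "i \<in> S" "j \<in> S" "i \<noteq> j" for i j
  proof
    assume "?P dvd int (\<eta> i) - int (\<eta> j)"
    then have "[\<eta> i = \<eta> j] (mod p)" by (simp add: cong_iff_dvd_diff flip: cong_int_iff)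
    then have "\<eta> i = \<eta> j" using \<eta>[OF that(1)] \<eta>[OF that(2)] by (rule cong_less_modulus_unique_nat)
    with inj that show False by (auto dest: inj_onD)
  qed
  have "\<exists>l. \<not> ?P dvd coeff f l"
  proof (rule ccontr)
    assume "\<not> ?thesis"
    then have "?P dvd poly f (int (\<eta> i0))"
      unfolding poly_altdef by (intro dvd_sum dvd_mult2) auto
    also have "poly f (int (\<eta> i0)) = int (a i0) * (\<Prod>j\<in>S - {i0}. int (\<eta> i0) - int (\<eta> j))"
      unfolding polyf
      by (subst sum.remove[OF S(1) i0]) (use S i0 in \<open>auto intro!: sum.neutral\<close>)
    finally have "?P dvd int (a i0) \<or> (\<exists>j\<in>S - {i0}. ?P dvd int (\<eta> i0) - int (\<eta> j))"
      using pp S by (simp add: prime_dvd_mult_iff prime_dvd_prod_iff)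
    then show False using a[OF i0] dist i0 by auto
  qed
  then obtain l where "\<not> ?P dvd coeff f l" by blast
  from card_roots_mod_prime[OF p this]
  have "card {z. z < p \<and> ?P dvd poly f (int z)} \<le> degree f" .
  also have "degree f \<le> card S"
    unfolding f_def
  proof (rule degree_sum_le[OF S(1)])
    fix i assume "i \<in> S"
    have "degree (\<Prod>j\<in>S - {i}. [:- int (\<eta> j), 1:]) \<le> (\<Sum>j\<in>S - {i}. degree [:- int (\<eta> j), 1:])"
      using degree_prod_sum_le[of "S - {i}" "\<lambda>j. [:- int (\<eta> j), 1:]"] S by (simp add: o_def)
    also have "\<dots> \<le> card S" using S by (simp add: card_mono)
    finally show "degree (smult (int (a i)) (\<Prod>j\<in>S - {i}. [:- int (\<eta> j), 1:])) \<le> card S"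
      using degree_smult_le order.trans by blast
  qed
  finally have *: "card {z. z < p \<and> ?P dvd poly f (int z)} \<le> card S" .
  have "{z. z < p \<and> z \<notin> \<eta> ` S \<and> p dvd (\<Sum>i\<in>S. a i * inv_mod p ((z + (p - \<eta> i)) mod p))}
      \<subseteq> {z. z < p \<and> ?P dvd poly f (int z)}"
  proof safe
    fix z assume z: "z < p" "z \<notin> \<eta> ` S"
      and dvd: "p dvd (\<Sum>i\<in>S. a i * inv_mod p ((z + (p - \<eta> i)) mod p))"
    define g where "g i = inv_mod p ((z + (p - \<eta> i)) mod p)" for i
    have g: "[int (g i) * (int z - int (\<eta> i)) = 1] (mod ?P)" if i: "i \<in> S" for i
    proof -
      \<comment> \<open>The summand \<open>p\<close> only avoids truncated subtraction; modulo
        \<open>p\<close> this is the difference.\<close>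
      have d: "int (z + (p - \<eta> i)) = int z - int (\<eta> i) + ?P" using \<eta>[OF i] by simp
      then have d': "[int ((z + (p - \<eta> i)) mod p) = int z - int (\<eta> i)] (mod ?P)"
        unfolding zmod_int d cong_def by simp
      have "\<not> p dvd (z + (p - \<eta> i)) mod p"
      proof
        assume "p dvd (z + (p - \<eta> i)) mod p"
        then have "?P dvd int ((z + (p - \<eta> i)) mod p)" by simp
        then have "?P dvd int z - int (\<eta> i)" using cong_dvd_iff[OF d'] by blast
        then have "[z = \<eta> i] (mod p)" by (simp add: cong_iff_dvd_diff flip: cong_int_iff)
        then have "z = \<eta> i" using z(1) \<eta>[OF i] by (rule cong_less_modulus_unique_nat)
        then show False using z i by blast
      qed
      from inv_mod_mult[OF p this] have "[g i * ((z + (p - \<eta> i)) mod p) = 1] (mod p)"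
        using prime_gt_1_nat[OF p] by (simp add: g_def cong_def)
      then have "[int (g i) * int ((z + (p - \<eta> i)) mod p) = 1] (mod ?P)"
        by (metis cong_int_iff of_nat_1 of_nat_mult)
      then show ?thesis by (rule cong_trans[OF cong_sym[OF cong_scalar_left[OF d']]])
    qed
    have "[(\<Sum>i\<in>S. int (a i) * int (g i)) * (\<Prod>j\<in>S. int z - int (\<eta> j)) = poly f (int z)] (mod ?P)"
      unfolding polyf sum_distrib_right
    proof (rule cong_sum)
      fix i assume i: "i \<in> S"
      have "int (a i) * int (g i) * (\<Prod>j\<in>S. int z - int (\<eta> j)) =
        int (a i) * (int (g i) * (int z - int (\<eta> i))) * (\<Prod>j\<in>S - {i}. int z - int (\<eta> j))"
        by (subst prod.remove[OF S(1) i]) simp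
      also have "[\<dots> = int (a i) * 1 * (\<Prod>j\<in>S - {i}. int z - int (\<eta> j))] (mod ?P)"
        by (intro cong_mult cong_refl g i)
      finally show "[int (a i) * int (g i) * (\<Prod>j\<in>S. int z - int (\<eta> j)) =
        int (a i) * (\<Prod>j\<in>S - {i}. int z - int (\<eta> j))] (mod ?P)" by simp
    qed
    moreover have "?P dvd (\<Sum>i\<in>S. int (a i) * int (g i))"
    proof -
      have "?P dvd int (\<Sum>i\<in>S. a i * g i)" using dvd unfolding g_def int_dvd_int_iff .
      then show ?thesis by simp
    qed
    ultimately show "?P dvd poly f (int z)" by (metis cong_dvd_iff dvd_mult2)
  qed
  then have "card {z. z < p \<and> z \<notin> \<eta> ` S \<and>
      p dvd (\<Sum>i\<in>S. a i * inv_mod p ((z + (p - \<eta> i)) mod p))} \<le> card {z. z < p \<and> ?P dvd poly f (int z)}"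
    by (intro card_mono) auto
  with * show ?thesis by linarith
qed

section \<open>Additive characters and almost independence\<close>

definition chr :: "nat \<Rightarrow> nat \<Rightarrow> complex" where
  "chr p c = cis (2 * pi * real c / real p)"

lemma chr_0 [simp]: "chr p 0 = 1" and norm_chr [simp]: "norm (chr p c) = 1"
  by (simp_all add: chr_def)

lemma chr_add: "chr p (a + b) = chr p a * chr p b"
  by (simp add: chr_def cis_mult ring_distribs add_divide_distrib)

lemma chr_mult: "chr p (a * b) = chr p a ^ b"
  by (induction b) (simp_all add: chr_add)

lemma chr_sum: "chr p (\<Sum>i\<in>S. f i) = (\<Prod>i\<in>S. chr p (f i))"
  by (induction S rule: infinite_finite_induct) (simp_all add: chr_add)

lemma chr_self: "0 < p \<Longrightarrow> chr p p = 1"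
  by (simp add: chr_def)

lemma chr_mod: "0 < p \<Longrightarrow> chr p (c mod p) = chr p c"
proof -
  assume p: "0 < p"
  have "chr p c = chr p (p * (c div p) + c mod p)" by simp
  also have "\<dots> = chr p (c mod p)"
    unfolding chr_add chr_mult using chr_self[OF p] by simp
  finally show ?thesis by simp
qed

lemma chr_eq_1_iff:
  assumes p: "0 < p"
  shows "chr p c = 1 \<longleftrightarrow> p dvd c"
proof
  assume "chr p c = 1"
  then have "chr p (c mod p) = chr p 0" using chr_mod[OF p] by simp
  moreover have "inj_on (chr p) {..<p}"
    using Complex.bij_betw_roots_unity[OF p] by (simp add: chr_def[abs_def] bij_betw_def)
  moreover have "c mod p \<in> {..<p}" "0 \<in> {..<p}" using p by auto
  ultimately have "c mod p = 0" by (metis inj_onD)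
  then show "p dvd c" by auto
next
  assume "p dvd c"
  then show "chr p c = 1" using chr_self[OF p] by (auto simp: chr_mult)
qed

lemma sum_chr:
  assumes p: "0 < p"
  shows "(\<Sum>y<p. chr p (c * y)) = (if p dvd c then of_nat p else 0)"
proof (cases "p dvd c")
  case True
  then have "chr p c = 1" using chr_eq_1_iff[OF p] by blast
  with True show ?thesis by (simp add: chr_mult)
next
  case False
  then have "chr p c \<noteq> 1" using chr_eq_1_iff[OF p] by blast
  moreover have "chr p c ^ p = 1"
    using chr_self[OF p] by (metis chr_mult mult.commute power_one)
  ultimately show ?thesis using False by (simp add: chr_mult sum_gp_strict)
qed

text \<open>Complete periods cancel, which leaves fewer than \<open>p\<close> terms of modulus 1.
  Incomplete sums arise because the range \<open>q\<close> of a seed number is a power of 2.\<close>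

lemma norm_sum_chr_le:
  assumes p: "0 < p" and c: "\<not> p dvd c"
  shows "norm (\<Sum>y<q. chr p (c * y)) \<le> real p"
proof -
  have ne: "chr p c \<noteq> 1" using chr_eq_1_iff[OF p] c by blast
  have "chr p c ^ q = chr p c ^ (q mod p)"
    by (metis chr_mod chr_mult mod_mult_right_eq p)
  then have "(\<Sum>y<q. chr p (c * y)) = (\<Sum>y<q mod p. chr p (c * y))"
    using ne by (simp add: chr_mult sum_gp_strict)
  also have "norm \<dots> \<le> real (q mod p)"
    using sum_norm_le[of "{..<q mod p}" "\<lambda>y. chr p (c * y)" "\<lambda>_. 1"] by simp
  also have "\<dots> \<le> real p" using p by simp
  finally show ?thesis .
qed

section \<open>A balanced function and its autocorrelation\<close>

text \<open>For odd \<open>p\<close> the value 0 at the last residue makes the mean exactly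
  zero.\<close>

definition halves :: "nat \<Rightarrow> nat \<Rightarrow> int" where
  "halves p u = (if u < p div 2 then 1 else if u < 2 * (p div 2) then - 1 else 0)"

definition autocorr :: "nat \<Rightarrow> nat \<Rightarrow> int" where
  "autocorr p v = (\<Sum>u<p. halves p u * halves p ((u + v) mod p))"

text \<open>For odd \<open>p\<close> the denominator is the autocorrelation at 0, the number of
  residues where \<open>halves\<close> is nonzero; so \<open>wave p 0 = 1\<close> if also
  \<open>p > 1\<close>.\<close>

definition wave :: "nat \<Rightarrow> nat \<Rightarrow> real" where
  "wave p v = real_of_int (autocorr p v) / real (2 * (p div 2))"

lemma halves_cases: "halves p u = 1 \<or> halves p u = - 1 \<or> halves p u = 0"
  by (auto simp: halves_def)

lemma
  assumes "odd p"
  shows sum_halves: "(\<Sum>u<p. halves p u) = 0"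
    and autocorr_0: "autocorr p 0 = 2 * int (p div 2)"
proof -
  define h where "h = p div 2"
  have p: "{..<p} = {..<h} \<union> {h..<2 * h} \<union> {2 * h}"
    using assms by (auto simp: h_def elim!: oddE)
  have split: "(\<Sum>u<p. f u) = (\<Sum>u<h. f u) + (\<Sum>u\<in>{h..<2 * h}. f u) + f (2 * h)" for f :: "nat \<Rightarrow> int"
  proof -
    have "sum f ({..<h} \<union> {h..<2 * h}) = (\<Sum>u<h. f u) + (\<Sum>u\<in>{h..<2 * h}. f u)"
      by (rule sum.union_disjoint) auto
    then show ?thesis unfolding p by (subst sum.union_disjoint) auto
  qed
  show "(\<Sum>u<p. halves p u) = 0"
    unfolding split by (simp add: halves_def flip: h_def)
  have "autocorr p 0 = (\<Sum>u<p. halves p u * halves p u)"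
    unfolding autocorr_def by (rule sum.cong) auto
  also have "\<dots> = 2 * int h"
    unfolding split by (simp add: halves_def flip: h_def)
  finally show "autocorr p 0 = 2 * int (p div 2)" by (simp add: h_def)
qed

text \<open>As the autocorrelation of a function with mean zero, \<open>wave\<close> has nonnegative Fourier
  coefficients, none at frequency \<open>0\<close>; they add up to \<open>wave p 0 = 1\<close>.\<close>

lemma wave_expansion:
  assumes p: "odd p" "1 < p"
  obtains w where "\<And>a. (0::real) \<le> w a" "(\<Sum>a\<in>{1..<p}. w a) = 1"
    "\<And>v. complex_of_real (wave p v) = (\<Sum>a\<in>{1..<p}. of_real (w a) * chr p (a * v))"
proof -
  have p0: "0 < p" using p by simp
  define h where "h = p div 2"
  have h: "h > 0" using p by (auto simp: h_def elim!: oddE)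
  define \<psi> where "\<psi> u = complex_of_int (halves p u)" for u
  define H where "H a = (\<Sum>u<p. \<psi> u * cnj (chr p (a * u)))" for a
  \<comment> \<open>Wiener-Khinchin: the Fourier coefficients of an autocorrelation are squared
    moduli of those of the function. The factor \<open>2 * h\<close> is the normalisation of
    \<open>wave\<close>.\<close>
  define w where "w a = (norm (H a))\<^sup>2 / (real p * real (2 * h))" for a
  have w0: "w a \<ge> 0" for a by (simp add: w_def)
  \<comment> \<open>\<open>chr\<close> takes natural numbers, so \<open>-c\<close> is represented by
    \<open>(p - 1) * c\<close>.\<close>
  have cnj_chr: "cnj (chr p c) = chr p ((p - 1) * c)" for c
  proof -
    have "chr p c * chr p ((p - 1) * c) = chr p (p * c)"
      using p by (simp add: diff_mult_distrib flip: chr_add)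
    also have "\<dots> = 1" using chr_self[OF p0] by (simp add: chr_mult)
    finally have "cnj (chr p c) * (chr p c * chr p ((p - 1) * c)) = cnj (chr p c)" by simp
    moreover have "cnj (chr p c) * chr p c = 1"
      by (simp add: chr_def cis_cnj cis_mult)
    ultimately show ?thesis by (metis mult.assoc mult_1)
  qed
  have orth: "(\<Sum>a<p. chr p (a * c) * cnj (chr p (a * c'))) = (if c' = c mod p then of_nat p else 0)"
    if "c' < p" for c c'
  proof -
    have "(\<Sum>a<p. chr p (a * c) * cnj (chr p (a * c'))) = (\<Sum>a<p. chr p ((c + (p - 1) * c') * a))"
      unfolding cnj_chr by (simp add: algebra_simps flip: chr_add)
    also have "\<dots> = (if p dvd c + (p - 1) * c' then of_nat p else 0)"
      by (rule sum_chr[OF p0])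
    also have "p dvd c + (p - 1) * c' \<longleftrightarrow> c' = c mod p"
    proof -
      have "int (c + (p - 1) * c') = int c - int c' + int p * int c'"
        using p by (cases p) (simp_all add: algebra_simps)
      then have "p dvd c + (p - 1) * c' \<longleftrightarrow> int p dvd int c - int c'"
        by (metis dvd_add_left_iff dvd_triv_left int_dvd_int_iff)
      also have "\<dots> \<longleftrightarrow> [c = c'] (mod p)" by (simp add: cong_iff_dvd_diff flip: cong_int_iff)
      also have "\<dots> \<longleftrightarrow> c' = c mod p" using that by (auto simp: cong_def)
      finally show ?thesis .
    qed
    finally show ?thesis .
  qed
  have H0: "H 0 = 0"
    using arg_cong[OF sum_halves[OF p(1)], of complex_of_int] by (simp add: H_def \<psi>_def)
  have norm_H: "complex_of_real ((norm (H a))\<^sup>2) * chr p (a * v) =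
      (\<Sum>u<p. \<Sum>u'<p. \<psi> u * \<psi> u' * (chr p (a * (u + v)) * cnj (chr p (a * u'))))" for a v
  proof -
    have cnjH: "cnj (H a) = (\<Sum>u<p. \<psi> u * chr p (a * u))"
      by (simp add: H_def \<psi>_def)
    have "complex_of_real ((norm (H a))\<^sup>2) * chr p (a * v) = cnj (H a) * H a * chr p (a * v)"
      by (simp only: complex_norm_square mult.commute[of "cnj (H a)"])
    also have "\<dots> = (\<Sum>u<p. \<Sum>u'<p. \<psi> u * chr p (a * u) * (\<psi> u' * cnj (chr p (a * u')))) * chr p (a * v)"
      unfolding cnjH unfolding H_def by (simp add: sum_product)
    also have "\<dots> = (\<Sum>u<p. \<Sum>u'<p. \<psi> u * \<psi> u' * (chr p (a * (u + v)) * cnj (chr p (a * u'))))"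
      unfolding sum_distrib_right by (intro sum.cong refl) (simp add: distrib_left chr_add mult_ac)
    finally show ?thesis .
  qed
  have exp: "complex_of_real (wave p v) = (\<Sum>a\<in>{1..<p}. of_real (w a) * chr p (a * v))" for v
  proof -
    have "(\<Sum>a<p. complex_of_real ((norm (H a))\<^sup>2) * chr p (a * v)) =
        (\<Sum>u<p. \<Sum>a<p. \<Sum>u'<p. \<psi> u * \<psi> u' * (chr p (a * (u + v)) * cnj (chr p (a * u'))))"
      unfolding norm_H by (rule sum.swap)
    also have "\<dots> = (\<Sum>u<p. \<Sum>u'<p. \<Sum>a<p. \<psi> u * \<psi> u' * (chr p (a * (u + v)) * cnj (chr p (a * u'))))"
      by (rule sum.cong[OF refl]) (rule sum.swap)
    also have "\<dots> = (\<Sum>u<p. \<Sum>u'<p. \<psi> u * \<psi> u' * (if u' = (u + v) mod p then of_nat p else 0))"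
      by (intro sum.cong refl) (simp add: orth flip: sum_distrib_left)
    also have "\<dots> = (\<Sum>u<p. \<psi> u * \<psi> ((u + v) mod p) * of_nat p)"
      using p0 by (intro sum.cong refl) (simp add: if_distrib[of "\<lambda>x. _ * x"] sum.delta cong: if_cong)
    also have "\<dots> = of_nat p * complex_of_int (autocorr p v)"
      by (simp add: autocorr_def \<psi>_def sum_distrib_left mult_ac)
    finally have "of_nat p * complex_of_int (autocorr p v) =
        (\<Sum>a<p. complex_of_real ((norm (H a))\<^sup>2) * chr p (a * v))" by simp
    also have "\<dots> = (\<Sum>a\<in>{1..<p}. complex_of_real ((norm (H a))\<^sup>2) * chr p (a * v))"
      by (rule sum.mono_neutral_right) (auto simp: H0 Suc_le_eq)
    finally have "complex_of_int (autocorr p v) =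
        (\<Sum>a\<in>{1..<p}. complex_of_real ((norm (H a))\<^sup>2) * chr p (a * v)) / of_nat p"
      using p0 by (simp add: field_simps)
    then have "complex_of_real (wave p v) =
        (\<Sum>a\<in>{1..<p}. complex_of_real ((norm (H a))\<^sup>2) * chr p (a * v)) / of_nat p / of_nat (2 * h)"
      by (simp add: wave_def h_def[symmetric])
    also have "\<dots> = (\<Sum>a\<in>{1..<p}. of_real (w a) * chr p (a * v))"
      unfolding w_def sum_divide_distrib by (intro sum.cong refl) simp
    finally show ?thesis .
  qed
  have "wave p 0 = 1" using h by (simp add: wave_def autocorr_0[OF p(1)] flip: h_def)
  then have "complex_of_real (\<Sum>a\<in>{1..<p}. w a) = of_real 1" using exp[of 0] by simp
  then have "(\<Sum>a\<in>{1..<p}. w a) = 1" using of_real_eq_iff by blast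
  with w0 exp that show thesis by blast
qed

lemma abs_wave_le_1: 
  assumes p: "odd p" "1 < p"
  shows "\<bar>wave p v\<bar> \<le> 1"
proof -
  obtain w where w: "\<And>a. (0::real) \<le> w a" "(\<Sum>a\<in>{1..<p}. w a) = 1"
    "\<And>v. complex_of_real (wave p v) = (\<Sum>a\<in>{1..<p}. of_real (w a) * chr p (a * v))"
    using wave_expansion[OF p] by blast
  have "norm (complex_of_real (wave p v)) \<le> (\<Sum>a\<in>{1..<p}. w a)"
    unfolding w(3) by (rule sum_norm_le) (use w(1) in \<open>simp add: norm_mult\<close>)
  then show ?thesis using w(2) by simp
qed

text \<open>With \<open>h = p div 2\<close>, \<open>u\<close> and \<open>u + v\<close> lie in the
  same half for \<open>2 * (h - v)\<close> values of \<open>u\<close>; each of the other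
  \<open>2 * v + 1\<close> values contributes at least -1.\<close>

lemma wave_ge:
  assumes p: "odd p" "1 < p" and v: "v \<le> p div 2"
  shows "1 - (4 * real v + 1) / real (2 * (p div 2)) \<le> wave p v"
proof -
  define h where "h = p div 2"
  have ph: "p = 2 * h + 1" using p by (auto simp: h_def elim!: oddE)
  have h: "h > 0" using p ph by auto
  let ?f = "\<lambda>u. halves p u * halves p ((u + v) mod p)"
  have le: "v \<le> h" using v by (simp add: h_def)
  let ?A = "{..<h - v} \<union> {h..<2 * h - v}"
  have cA: "card ?A = 2 * (h - v)" using le by (subst card_Un_disjoint) auto
  have sub: "?A \<subseteq> {..<p}" using ph by auto
  have "?f u = 1" if "u \<in> ?A" for u
    using that le ph by (auto simp: halves_def h_def[symmetric])
  then have "(\<Sum>u\<in>?A. ?f u) = int (card ?A)" by simp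
  moreover have "(\<Sum>u\<in>{..<p} - ?A. - 1) \<le> (\<Sum>u\<in>{..<p} - ?A. ?f u)"
  proof (rule sum_mono)
    fix u show "- 1 \<le> ?f u" using halves_cases[of p u] halves_cases[of p "(u + v) mod p"] by auto
  qed
  moreover have "card ({..<p} - ?A) = p - 2 * (h - v)"
    using cA sub by (simp add: card_Diff_subset)
  moreover have "autocorr p v = (\<Sum>u\<in>{..<p} - ?A. ?f u) + (\<Sum>u\<in>?A. ?f u)"
    unfolding autocorr_def by (rule sum.subset_diff[OF sub]) simp
  ultimately have "int (2 * (h - v)) - int (p - 2 * (h - v)) \<le> autocorr p v"
    using cA by simp
  then have "2 * int h - (4 * int v + 1) \<le> autocorr p v"
    using le ph by linarith
  then have "real_of_int (2 * int h - (4 * int v + 1)) \<le> real_of_int (autocorr p v)"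
    by (simp only: of_int_le_iff)
  then have "(2 * real h - (4 * real v + 1)) / real (2 * h) \<le> wave p v"
    unfolding wave_def h_def[symmetric] by (intro divide_right_mono) auto
  then show ?thesis using h by (simp add: h_def[symmetric] diff_divide_distrib)
qed

text \<open>The shifts up to a quarter of \<open>p div 2\<close> suffice: there
  \<open>wave_ge\<close> gives \<open>wave p v \<ge> 1 / 4\<close>. They make up about an eighth of
  all residues, and a square is at least 1/16.\<close>

lemma sum_wave_square_ge:
  assumes p: "odd p" "64 \<le> p"
  shows "real p / 200 \<le> (\<Sum>v<p. (wave p v)\<^sup>2)"
proof -
  define h where "h = p div 2"
  have ph: "p = 2 * h + 1" using p by (auto simp: h_def elim!: oddE)
  have h: "h \<ge> 32" using p ph by auto
  have "1 / 16 \<le> (wave p v)\<^sup>2" if v: "v \<in> {..h div 4}" for v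
  proof -
    have "4 * real v \<le> real h" using v by auto
    then have "(4 * real v + 1) / real (2 * h) \<le> 3 / 4" using h by (simp add: field_simps)
    moreover have "v \<le> h" using v by (auto intro: order.trans)
    then have "1 - (4 * real v + 1) / real (2 * h) \<le> wave p v"
      using wave_ge[of p v] p unfolding h_def by simp
    ultimately have "1 / 4 \<le> wave p v" by linarith
    from power_mono[OF this, of 2] show ?thesis by (simp add: power2_eq_square)
  qed
  then have "(\<Sum>v\<in>{..h div 4}. 1 / 16) \<le> (\<Sum>v\<in>{..h div 4}. (wave p v)\<^sup>2)" by (rule sum_mono)
  also have "\<dots> \<le> (\<Sum>v<p. (wave p v)\<^sup>2)" by (rule sum_mono2) (use ph in auto)
  finally have "real (Suc (h div 4)) / 16 \<le> (\<Sum>v<p. (wave p v)\<^sup>2)" by simp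
  moreover have "h \<le> 4 * Suc (h div 4)" by presburger
  then have "real h \<le> 4 * real (Suc (h div 4))" by (metis of_nat_le_iff of_nat_mult of_nat_numeral)
  ultimately show ?thesis using ph h by simp
qed

section \<open>Almost independence of the samples\<close>

text \<open>This is y / (z2 - h_i) modulo \<open>p\<close>, and 0 at the pole z2 = h_i.\<close>

definition sample :: "nat \<Rightarrow> nat \<Rightarrow> nat \<Rightarrow> nat \<Rightarrow> nat \<Rightarrow> nat" where
  "sample p z\<^sub>1 z\<^sub>2 y i = y * inv_mod p ((z\<^sub>2 + (p - hash p z\<^sub>1 i)) mod p) mod p"

text \<open>Bad residues of \<open>z\<close> are the poles and the zeros of the linear combination,
  at most \<open>card S\<close> each, hence at most \<open>4 * card S * q / p\<close> bad
  \<open>z < q\<close>. These are charged the trivial bound \<open>q\<close>, all \<open>z\<close>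
  the bound \<open>p\<close> of an incomplete character sum.\<close>

lemma sum_cauchy_chr_le:
  fixes \<eta> a :: "'a \<Rightarrow> nat"
  assumes p: "prime p" and q: "p \<le> q" and S: "finite S" "S \<noteq> {}" and inj: "inj_on \<eta> S"
    and \<eta>: "\<And>i. i \<in> S \<Longrightarrow> \<eta> i < p" and a: "\<And>i. i \<in> S \<Longrightarrow> \<not> p dvd a i"
  shows "(\<Sum>z<q. norm (\<Sum>y<q. chr p ((\<Sum>i\<in>S. a i * inv_mod p ((z + (p - \<eta> i)) mod p)) * y)))
    \<le> 4 * real (card S) * (real q)\<^sup>2 / real p + real q * real p"
proof -
  have p0: "0 < p" using p by (rule prime_gt_0_nat)
  define c where "c z = (\<Sum>i\<in>S. a i * inv_mod p ((z + (p - \<eta> i)) mod p))" for z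
  define R where "R = {z. z < p \<and> z \<notin> \<eta> ` S \<and> p dvd c z}"
  define A where "A = R \<union> \<eta> ` S"
  have cmod: "c (z mod p) = c z" for z unfolding c_def by (simp add: mod_add_left_eq)
  have "A \<subseteq> {..<p}" using \<eta> by (auto simp: A_def R_def)
  have "card A \<le> card R + card (\<eta> ` S)" unfolding A_def by (rule card_Un_le)
  also have "\<dots> \<le> card S + card S"
    unfolding R_def c_def
    by (intro add_mono card_cauchy_roots[OF p S inj \<eta> a] card_image_le S)
  finally have cA: "card A \<le> 2 * card S" by simp
  let ?Z = "{z. z < q \<and> z mod p \<in> A}"
  have "p * card ?Z \<le> 2 * q * card A" by (rule card_mod_mem_le) fact+
  also have "\<dots> \<le> 2 * q * (2 * card S)" using cA by (intro mult_le_mono2)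
  finally have "p * card ?Z \<le> 4 * card S * q" by (simp add: mult_ac)
  then have "real p * real (card ?Z) \<le> 4 * real (card S) * real q"
    by (metis of_nat_le_iff of_nat_mult of_nat_numeral)
  then have cZ: "real (card ?Z) \<le> 4 * real (card S) * real q / real p"
    using p0 by (simp add: field_simps)
  have "norm (\<Sum>y<q. chr p (c z * y)) \<le> of_bool (z \<in> ?Z) * real q + real p" if z: "z < q" for z
  proof (cases "z mod p \<in> A")
    case True
    have "norm (\<Sum>y<q. chr p (c z * y)) \<le> real q"
      using sum_norm_le[of "{..<q}" "\<lambda>y. chr p (c z * y)" "\<lambda>_. 1"] by simp
    with True z show ?thesis by simp
  next
    case False
    have "z mod p < p" using p0 by simp
    with False have "\<not> p dvd c z" by (auto simp: A_def R_def cmod)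
    from norm_sum_chr_le[OF p0 this] show ?thesis using False by simp
  qed
  then have "(\<Sum>z<q. norm (\<Sum>y<q. chr p (c z * y))) \<le> (\<Sum>z<q. of_bool (z \<in> ?Z) * real q + real p)"
    by (intro sum_mono) simp
  also have "\<dots> = (\<Sum>z<q. of_bool (z \<in> ?Z)) * real q + real q * real p"
    by (simp add: sum.distrib sum_distrib_right)
  also have "(\<Sum>z<q. of_bool (z \<in> ?Z)) = real (card ?Z)"
    by (simp add: sum_of_bool_eq) (rule arg_cong[of _ _ card], auto)
  also have "real (card ?Z) * real q \<le> 4 * real (card S) * real q / real p * real q"
    using cZ by (rule mult_right_mono) simp
  finally show ?thesis by (simp add: c_def power2_eq_square)
qed

text \<open>By \<open>wave_expansion\<close> a product of waves is a convex combination of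
  characters, so a bound that is uniform in the frequencies passes to it unchanged. All frequencies
  lie in {1..<p}: none is 0 modulo \<open>p\<close>, as \<open>card_cauchy_roots\<close>
  requires.\<close>

lemma abs_sum_prod_wave_le:
  assumes p: "odd p" "1 < p" and S: "finite S"
    and bound: "\<And>a. a \<in> S \<rightarrow>\<^sub>E {1..<p} \<Longrightarrow>
      (\<Sum>z\<in>Z. norm (\<Sum>y<q. chr p ((\<Sum>i\<in>S. a i * g z i) * y))) \<le> B"
  shows "(\<Sum>z\<in>Z. \<bar>\<Sum>y<q. \<Prod>i\<in>S. wave p (y * g z i mod p)\<bar>) \<le> B"
proof -
  have p0: "0 < p" using p by simp
  obtain w where w: "\<And>a. (0::real) \<le> w a" "(\<Sum>a\<in>{1..<p}. w a) = 1"
    "\<And>v. complex_of_real (wave p v) = (\<Sum>a\<in>{1..<p}. of_real (w a) * chr p (a * v))"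
    using wave_expansion[OF p] by blast
  let ?D = "S \<rightarrow>\<^sub>E {1..<p}"
  have expand: "complex_of_real (\<Sum>y<q. \<Prod>i\<in>S. wave p (y * g z i mod p)) =
      (\<Sum>a\<in>?D. of_real (\<Prod>i\<in>S. w (a i)) * (\<Sum>y<q. chr p ((\<Sum>i\<in>S. a i * g z i) * y)))" for z
  proof -
    have "complex_of_real (\<Prod>i\<in>S. wave p (y * g z i mod p)) =
        (\<Sum>a\<in>?D. of_real (\<Prod>i\<in>S. w (a i)) * chr p ((\<Sum>i\<in>S. a i * g z i) * y))" for y
    proof -
      have "chr p (b * (y * g z i mod p)) = chr p (b * g z i * y)" for b i
        by (metis chr_mod[OF p0] mod_mult_right_eq mult.assoc mult.commute)
      then have "complex_of_real (\<Prod>i\<in>S. wave p (y * g z i mod p)) =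
          (\<Prod>i\<in>S. \<Sum>b\<in>{1..<p}. of_real (w b) * chr p (b * g z i * y))"
        by (simp add: w(3))
      also have "\<dots> = (\<Sum>a\<in>?D. \<Prod>i\<in>S. of_real (w (a i)) * chr p (a i * g z i * y))"
        using S by (intro prod_sum_PiE) auto
      finally show ?thesis by (simp add: prod.distrib chr_sum sum_distrib_right)
    qed
    then have "complex_of_real (\<Sum>y<q. \<Prod>i\<in>S. wave p (y * g z i mod p)) =
        (\<Sum>y<q. \<Sum>a\<in>?D. of_real (\<Prod>i\<in>S. w (a i)) * chr p ((\<Sum>i\<in>S. a i * g z i) * y))"
      unfolding of_real_sum by (intro sum.cong refl)
    also have "\<dots> = (\<Sum>a\<in>?D. \<Sum>y<q. of_real (\<Prod>i\<in>S. w (a i)) * chr p ((\<Sum>i\<in>S. a i * g z i) * y))"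
      by (rule sum.swap)
    finally show ?thesis by (simp only: sum_distrib_left)
  qed
  have W0: "0 \<le> (\<Prod>i\<in>S. w (a i))" for a by (intro prod_nonneg) (simp add: w(1))
  have "(\<Sum>z\<in>Z. \<bar>\<Sum>y<q. \<Prod>i\<in>S. wave p (y * g z i mod p)\<bar>) \<le>
      (\<Sum>z\<in>Z. \<Sum>a\<in>?D. (\<Prod>i\<in>S. w (a i)) * norm (\<Sum>y<q. chr p ((\<Sum>i\<in>S. a i * g z i) * y)))"
  proof (rule sum_mono)
    fix z
    have "\<bar>\<Sum>y<q. \<Prod>i\<in>S. wave p (y * g z i mod p)\<bar> =
        norm (complex_of_real (\<Sum>y<q. \<Prod>i\<in>S. wave p (y * g z i mod p)))"
      by (simp only: norm_of_real)
    also have "\<dots> \<le> (\<Sum>a\<in>?D. (\<Prod>i\<in>S. w (a i)) * norm (\<Sum>y<q. chr p ((\<Sum>i\<in>S. a i * g z i) * y)))"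
      unfolding expand
      by (rule sum_norm_le) (simp only: norm_mult norm_of_real abs_of_nonneg[OF W0] order.refl)
    finally show "\<bar>\<Sum>y<q. \<Prod>i\<in>S. wave p (y * g z i mod p)\<bar> \<le> \<dots>" .
  qed
  also have "\<dots> = (\<Sum>a\<in>?D. (\<Prod>i\<in>S. w (a i)) * (\<Sum>z\<in>Z. norm (\<Sum>y<q. chr p ((\<Sum>i\<in>S. a i * g z i) * y))))"
    unfolding sum_distrib_left by (rule sum.swap)
  also have "\<dots> \<le> (\<Sum>a\<in>?D. (\<Prod>i\<in>S. w (a i)) * B)"
    by (intro sum_mono mult_left_mono bound W0)
  also have "\<dots> = (\<Sum>a\<in>?D. (\<Prod>i\<in>S. w (a i))) * B"
    by (simp add: sum_distrib_right)
  also have "(\<Sum>a\<in>?D. (\<Prod>i\<in>S. w (a i))) = (\<Prod>i\<in>S. \<Sum>b\<in>{1..<p}. w b)"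
    using S by (intro prod_sum_PiE[symmetric]) auto
  finally show ?thesis using w(2) by simp
qed

lemma hash_less: "0 < p \<Longrightarrow> hash p z i < p"
  by (simp add: hash_def)

lemma hash_mod: "hash p (z mod p) i = hash p z i"
proof -
  have "[(\<Sum>l<i. if odd (i div 2 ^ l) then (z mod p) ^ l else 0) =
      (\<Sum>l<i. if odd (i div 2 ^ l) then z ^ l else 0)] (mod p)"
    by (intro cong_sum) (simp add: cong_def power_mod)
  then show ?thesis by (simp add: hash_def cong_def)
qed

lemma abs_prod_wave_le_1:
  assumes "odd p" "1 < p"
  shows "\<bar>\<Prod>i\<in>S. wave p (v i)\<bar> \<le> 1"
  unfolding abs_prod by (rule prod_le_1) (simp add: abs_wave_le_1[OF assms])

text \<open>Union bound over the pairs in \<open>S\<close>, followed by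
  \<open>card_mod_mem_le\<close>.\<close>

lemma card_hash_not_inj_le:
  assumes p: "prime p" and q: "p \<le> q" and S: "finite S" "\<And>i. i \<in> S \<Longrightarrow> i < 2 ^ W"
  shows "p * card {z. z < q \<and> \<not> inj_on (hash p z) S} \<le> 2 * q * ((card S)\<^sup>2 * W)"
proof -
  have p0: "0 < p" using p by (rule prime_gt_0_nat)
  define A where "A = {z. z < p \<and> \<not> inj_on (hash p z) S}"
  let ?P = "{(i, j). i \<in> S \<and> j \<in> S \<and> i \<noteq> j}"
  have finP: "finite ?P" by (rule finite_subset[of _ "S \<times> S"]) (use S in auto)
  have "A \<subseteq> (\<Union>(i, j)\<in>?P. {z. z < p \<and> hash p z i = hash p z j})"
    by (auto simp: A_def inj_on_def)
  then have "card A \<le> card (\<Union>(i, j)\<in>?P. {z. z < p \<and> hash p z i = hash p z j})"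
    by (intro card_mono) (use finP in auto)
  also have "\<dots> \<le> (\<Sum>x\<in>?P. card (case x of (i, j) \<Rightarrow> {z. z < p \<and> hash p z i = hash p z j}))"
    by (rule card_UN_le[OF finP])
  also have "\<dots> \<le> (\<Sum>x\<in>?P. W)"
    by (rule sum_mono) (use S(2) in \<open>auto intro!: card_hash_collisions[OF p]\<close>)
  also have "\<dots> = card ?P * W" by simp
  also have "card ?P \<le> card (S \<times> S)" by (rule card_mono) (use S in auto)
  also have "\<dots> = (card S)\<^sup>2" by (simp add: card_cartesian_product power2_eq_square)
  finally have cA: "card A \<le> (card S)\<^sup>2 * W" by simp
  have "{z. z < q \<and> \<not> inj_on (hash p z) S} = {z. z < q \<and> z mod p \<in> A}"
    using p0 by (auto simp: A_def inj_on_def hash_mod)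
  also have "p * card \<dots> \<le> 2 * q * card A"
    by (rule card_mod_mem_le) (use p0 q in \<open>auto simp: A_def\<close>)
  also have "\<dots> \<le> 2 * q * ((card S)\<^sup>2 * W)" using cA by (rule mult_le_mono2)
  finally show ?thesis .
qed

text \<open>The three error terms come from hash collisions in z1, from zeros and poles in z2, and
  from the incomplete period in y.\<close>

lemma almost_independent:
  assumes p: "prime p" "odd p" and q: "p \<le> q" and S: "finite S" "S \<noteq> {}" "\<And>i. i \<in> S \<Longrightarrow> i < 2 ^ W"
  shows "\<bar>\<Sum>z\<^sub>1<q. \<Sum>z\<^sub>2<q. \<Sum>y<q. \<Prod>i\<in>S. wave p (sample p z\<^sub>1 z\<^sub>2 y i)\<bar> \<le>
    (real q) ^ 3 * (2 * (real (card S))\<^sup>2 * real W / real p + 4 * real (card S) / real p + real p / real q)"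
proof -
  have p0: "0 < p" and p1: "1 < p" using prime_gt_0_nat[OF p(1)] prime_gt_1_nat[OF p(1)] .
  have q0: "0 < q" using p0 q by simp
  let ?B = "{z. z < q \<and> \<not> inj_on (hash p z) S}"
  let ?C = "4 * real (card S) * (real q)\<^sup>2 / real p + real q * real p"
  let ?f = "\<lambda>z\<^sub>1 z\<^sub>2. \<bar>\<Sum>y<q. \<Prod>i\<in>S. wave p (sample p z\<^sub>1 z\<^sub>2 y i)\<bar>"
  have C0: "0 \<le> ?C" by simp
  have one: "(\<Sum>z\<^sub>2<q. ?f z\<^sub>1 z\<^sub>2) \<le> of_bool (z\<^sub>1 \<in> ?B) * (real q)\<^sup>2 + ?C" if "z\<^sub>1 < q" for z\<^sub>1
  proof (cases "z\<^sub>1 \<in> ?B")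
    case True
    have "?f z\<^sub>1 z\<^sub>2 \<le> (\<Sum>y<q. 1)" for z\<^sub>2
      by (rule order.trans[OF sum_abs sum_mono]) (rule abs_prod_wave_le_1[OF p(2) p1])
    then have "(\<Sum>z\<^sub>2<q. ?f z\<^sub>1 z\<^sub>2) \<le> (\<Sum>z\<^sub>2<q. real q)" by (intro sum_mono) simp
    also have "\<dots> = of_bool (z\<^sub>1 \<in> ?B) * (real q)\<^sup>2" using True by (simp add: power2_eq_square)
    finally show ?thesis using C0 by linarith
  next
    case False
    then have inj: "inj_on (hash p z\<^sub>1) S" using that by simp
    have "(\<Sum>z\<^sub>2<q. \<bar>\<Sum>y<q. \<Prod>i\<in>S. wave p (y * inv_mod p ((z\<^sub>2 + (p - hash p z\<^sub>1 i)) mod p) mod p)\<bar>) \<le> ?C"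
    proof (rule abs_sum_prod_wave_le[OF p(2) p1 S(1)])
      fix a assume a: "a \<in> S \<rightarrow>\<^sub>E {1..<p}"
      have nd: "\<not> p dvd a i" if "i \<in> S" for i
      proof -
        have "a i \<in> {1..<p}" using a that by auto
        then show ?thesis by (auto dest: dvd_imp_le)
      qed
      show "(\<Sum>z\<^sub>2<q. norm (\<Sum>y<q. chr p ((\<Sum>i\<in>S. a i * inv_mod p ((z\<^sub>2 + (p - hash p z\<^sub>1 i)) mod p)) * y)))
        \<le> ?C"
        by (rule sum_cauchy_chr_le[OF p(1) q S(1,2) inj hash_less[OF p0] nd])
    qed
    moreover have "of_bool (z\<^sub>1 \<in> ?B) = (0::real)" using inj by simp
    ultimately show ?thesis by (simp only: sample_def mult_zero_left add_0)
  qed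
  have "real (p * card ?B) \<le> real (2 * q * ((card S)\<^sup>2 * W))"
    by (rule of_nat_mono[OF card_hash_not_inj_le[OF p(1) q S(1,3)]])
  then have "real p * real (card ?B) \<le> 2 * real q * ((real (card S))\<^sup>2 * real W)"
    by simp
  then have cB: "real (card ?B) \<le> 2 * real q * ((real (card S))\<^sup>2 * real W) / real p"
    using p0 by (simp add: field_simps)
  have "\<bar>\<Sum>z\<^sub>1<q. \<Sum>z\<^sub>2<q. \<Sum>y<q. \<Prod>i\<in>S. wave p (sample p z\<^sub>1 z\<^sub>2 y i)\<bar> \<le> (\<Sum>z\<^sub>1<q. \<Sum>z\<^sub>2<q. ?f z\<^sub>1 z\<^sub>2)"
    by (rule order.trans[OF sum_abs sum_mono]) (rule sum_abs)
  also have "\<dots> \<le> (\<Sum>z\<^sub>1<q. of_bool (z\<^sub>1 \<in> ?B) * (real q)\<^sup>2 + ?C)"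
    by (rule sum_mono) (use one in simp)
  also have "\<dots> = (\<Sum>z\<^sub>1<q. of_bool (z\<^sub>1 \<in> ?B)) * (real q)\<^sup>2 + real q * ?C"
    by (simp add: sum.distrib sum_distrib_right)
  also have "(\<Sum>z\<^sub>1<q. of_bool (z\<^sub>1 \<in> ?B)) = real (card ?B)"
    by (simp add: sum_of_bool_eq) (rule arg_cong[of _ _ card], auto)
  also have "real (card ?B) * (real q)\<^sup>2 \<le> 2 * real q * ((real (card S))\<^sup>2 * real W) / real p * (real q)\<^sup>2"
    using cB by (rule mult_right_mono) simp
  also have "2 * real q * ((real (card S))\<^sup>2 * real W) / real p * (real q)\<^sup>2 + real q * ?C =
      (real q) ^ 3 * (2 * (real (card S))\<^sup>2 * real W / real p + 4 * real (card S) / real p + real p / real q)"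
    using p0 q0 by (simp add: field_simps power2_eq_square power3_eq_cube)
  finally show ?thesis by simp
qed

text \<open>If \<open>p\<close> divides \<open>g\<close>, every summand is \<open>wave p 0\<close>
  squared, that is 1; otherwise multiplication by \<open>g\<close> permutes the residues. Complete
  periods fill at least half of the range, which turns 1/200 into 1/400. As every \<open>g\<close>
  is allowed, z1 and z2 may be fixed when second moments are bounded.\<close>

lemma sum_wave_square_scaled_ge:
  assumes p: "prime p" "64 \<le> p" and q: "p \<le> q"
  shows "real q / 400 \<le> (\<Sum>y<q. (wave p (y * g mod p))\<^sup>2)"
proof -
  have odd: "odd p" using p prime_odd_nat[of p] by simp
  have p0: "0 < p" using p by simp
  show ?thesis
  proof (cases "p dvd g")
    case True
    have "wave p 0 = 1" using autocorr_0[OF odd] p by (auto simp: wave_def)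
    moreover have "y * g mod p = 0" for y using True by auto
    ultimately show ?thesis by simp
  next
    case False
    have inj: "inj_on (\<lambda>y. y * g mod p) {..<p}"
    proof (rule inj_onI)
      fix x y assume xy: "x \<in> {..<p}" "y \<in> {..<p}" "x * g mod p = y * g mod p"
      have "coprime g p" using p(1) False by (metis coprime_commute prime_imp_coprime)
      then have "[x = y] (mod p)" using xy(3) by (simp add: cong_def[symmetric] cong_mult_rcancel_nat)
      then show "x = y" using xy(1,2)[simplified] by (rule cong_less_modulus_unique_nat)
    qed
    have "(\<lambda>y. y * g mod p) ` {..<p} = {..<p}"
      by (rule endo_inj_surj[OF _ _ inj]) (use p0 in auto)
    then have "(\<Sum>y<p. (wave p (y * g mod p))\<^sup>2) = (\<Sum>v<p. (wave p v)\<^sup>2)"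
      using sum.reindex[OF inj, of "\<lambda>v. (wave p v)\<^sup>2"] by simp
    then have period: "real p / 200 \<le> (\<Sum>y<p. (wave p (y * g mod p))\<^sup>2)"
      using sum_wave_square_ge[OF odd p(2)] by simp
    have "real d * (real p / 200) \<le> (\<Sum>y<d * p. (wave p (y * g mod p))\<^sup>2)" for d
    proof (induction d)
      case (Suc d)
      have "(\<Sum>y<Suc d * p. (wave p (y * g mod p))\<^sup>2) =
          (\<Sum>y<d * p. (wave p (y * g mod p))\<^sup>2) + (\<Sum>y\<in>{d * p..<d * p + p}. (wave p (y * g mod p))\<^sup>2)"
        by (subst sum.union_disjoint[symmetric]) (auto intro!: sum.cong)
      also have "(\<Sum>y\<in>{d * p..<d * p + p}. (wave p (y * g mod p))\<^sup>2) =
          (\<Sum>y<p. (wave p ((y + d * p) * g mod p))\<^sup>2)"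
        using sum.shift_bounds_nat_ivl[of "\<lambda>y. (wave p (y * g mod p))\<^sup>2" 0 "d * p" p]
        by (simp add: atLeast0LessThan add.commute)
      also have "\<dots> = (\<Sum>y<p. (wave p (y * g mod p))\<^sup>2)"
      proof (intro sum.cong refl)
        fix y
        have "(y + d * p) * g = y * g + p * (d * g)" by (simp add: algebra_simps)
        then show "(wave p ((y + d * p) * g mod p))\<^sup>2 = (wave p (y * g mod p))\<^sup>2" by simp
      qed
      finally show ?case using Suc period by (simp add: algebra_simps)
    qed simp
    from this[of "q div p"]
    have "real (q div p) * (real p / 200) \<le> (\<Sum>y<q div p * p. (wave p (y * g mod p))\<^sup>2)" .
    also have "\<dots> \<le> (\<Sum>y<q. (wave p (y * g mod p))\<^sup>2)"
      by (rule sum_mono2) (auto intro: order.strict_trans2)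
    also have "real q / 400 \<le> real (q div p) * (real p / 200)"
    proof -
      have "q div p * p + q mod p = q" by simp
      moreover have "q mod p < p" using p0 by simp
      moreover have "p \<le> q div p * p"
        using q p0 by (metis div_greater_zero_iff mult_le_mono1 mult_1 Suc_leI One_nat_def)
      ultimately have "q \<le> 2 * (q div p * p)" by linarith
      then have "real q \<le> 2 * (real (q div p) * real p)"
        by (metis of_nat_le_iff of_nat_mult of_nat_numeral)
      then show ?thesis by simp
    qed
    finally (xtrans) show ?thesis by simp
  qed
qed

section \<open>Programs\<close>

text \<open>The memory is a parameter, as the programs only read the seed. The time is an upper
  bound, so that bounds can be rounded up when composed.\<close>

definition exec :: "(nat \<Rightarrow> nat) \<Rightarrow> program \<Rightarrow> (nat \<Rightarrow> nat) \<Rightarrow> nat \<Rightarrow> (nat \<Rightarrow> nat) \<Rightarrow> bool" where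
  "exec M P R T R' \<longleftrightarrow> (\<exists>t\<le>T. runs P (R, M) t (R', M))"

abbreviation (input) seq_prog :: "program \<Rightarrow> program \<Rightarrow> program" (infixr ";;" 60) where
  "P ;; Q \<equiv> Seq P Q"

lemma exec_mono: "exec M P R T R' \<Longrightarrow> T \<le> T' \<Longrightarrow> exec M P R T' R'"
  by (auto simp: exec_def intro: order.trans)

lemma exec_Seq: "exec M P R T R' \<Longrightarrow> exec M Q R' T' R'' \<Longrightarrow> exec M (P ;; Q) R (T + T') R''"
  unfolding exec_def by (meson add_mono runs.intros(6))

text \<open>The loop-free fragment that leaves the memory alone. On it \<open>sem\<close> gives the
  final registers and \<open>cost\<close> a time bound, so simplification executes such blocks
  symbolically.\<close>

primrec straight :: "program \<Rightarrow> bool" where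
  "straight (Set_Const r c) = True"
| "straight (Add_Reg r p q) = True"
| "straight (Sub_Reg r p q) = True"
| "straight (Load r p) = True"
| "straight (Store r p) = False"
| "straight (Seq P Q) = (straight P \<and> straight Q)"
| "straight (If_Nonzero r P Q) = (straight P \<and> straight Q)"
| "straight (While_Nonzero r P) = False"

primrec cost :: "program \<Rightarrow> nat" where
  "cost (Set_Const r c) = 1"
| "cost (Add_Reg r p q) = 1"
| "cost (Sub_Reg r p q) = 1"
| "cost (Load r p) = 1"
| "cost (Store r p) = 1"
| "cost (Seq P Q) = cost P + cost Q"
| "cost (If_Nonzero r P Q) = Suc (max (cost P) (cost Q))"
| "cost (While_Nonzero r P) = 0"

primrec sem :: "(nat \<Rightarrow> nat) \<Rightarrow> program \<Rightarrow> (nat \<Rightarrow> nat) \<Rightarrow> nat \<Rightarrow> nat" where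
  "sem M (Set_Const r c) = (\<lambda>R. R(r := c))"
| "sem M (Add_Reg r p q) = (\<lambda>R. R(r := R p + R q))"
| "sem M (Sub_Reg r p q) = (\<lambda>R. R(r := R p - R q))"
| "sem M (Load r p) = (\<lambda>R. R(r := M (R p)))"
| "sem M (Store r p) = (\<lambda>R. R)"
| "sem M (Seq P Q) = (\<lambda>R. sem M Q (sem M P R))"
| "sem M (If_Nonzero r P Q) = (\<lambda>R. if R r \<noteq> 0 then sem M P R else sem M Q R)"
| "sem M (While_Nonzero r P) = (\<lambda>R. R)"

lemma exec_straight:
  assumes "straight P" "cost P \<le> T"
  shows "exec M P R T (sem M P R)"
proof -
  have "exec M P R (cost P) (sem M P R)" using assms(1)
  proof (induction P arbitrary: R)
    case (Seq P Q)
    then show ?case by (auto intro: exec_Seq)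
  next
    case (If_Nonzero r P Q)
    show ?case
    proof (cases "R r = 0")
      case True
      from If_Nonzero obtain t where "t \<le> cost Q" "runs Q (R, M) t (sem M Q R, M)"
        by (auto simp: exec_def)
      with runs.intros(8)[OF True this(2)] True show ?thesis
        by (auto simp: exec_def intro!: exI[of _ "Suc t"])
    next
      case False
      from If_Nonzero obtain t where "t \<le> cost P" "runs P (R, M) t (sem M P R, M)"
        by (auto simp: exec_def)
      with runs.intros(7)[OF False this(2)] False show ?thesis
        by (auto simp: exec_def intro!: exI[of _ "Suc t"])
    qed
  qed (auto simp: exec_def simp del: One_nat_def intro!: exI[of _ 1] runs.intros)
  then show ?thesis using assms(2) by (rule exec_mono)
qed

text \<open>The decrement is read from register \<open>d\<close>; a stride other than 1 serves to
  divide, see \<open>prologue\<close>.\<close>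

definition loop :: "nat \<Rightarrow> nat \<Rightarrow> program \<Rightarrow> program" where
  "loop c d P = While_Nonzero c (P ;; Sub_Reg c c d)"

text \<open>Invariant rule with time: \<open>I j\<close> holds after \<open>j\<close> rounds, the
  decrement included. A round costs \<open>T\<close> for the body and 2 for test and decrement; the
  final 1 is the failing test.\<close>

lemma exec_loop:
  assumes step: "\<And>j R. j < N \<Longrightarrow> I j R \<Longrightarrow> R c = (N - j) * \<delta> \<Longrightarrow> R d = \<delta> \<Longrightarrow>
      \<exists>R'. exec M P R T R' \<and> R' c = R c \<and> R' d = \<delta> \<and> I (Suc j) (R'(c := R c - \<delta>))"
    and init: "I 0 R" "R c = N * \<delta>" "R d = \<delta>" "0 < \<delta>" "c \<noteq> d"
  shows "\<exists>R'. exec M (loop c d P) R (N * (T + 2) + 1) R' \<and> I N R' \<and> R' c = 0 \<and> R' d = \<delta>"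
proof -
  have "\<exists>R'. exec M (loop c d P) R ((N - j) * (T + 2) + 1) R' \<and> I N R' \<and> R' c = 0 \<and> R' d = \<delta>"
    if "j \<le> N" "I j R" "R c = (N - j) * \<delta>" "R d = \<delta>" for j R
    using that
  proof (induction "N - j" arbitrary: j R)
    case 0
    then have "j = N" by simp
    with 0 have "exec M (loop c d P) R 1 R"
      unfolding exec_def loop_def using runs.intros(9)[of R c] by auto
    with 0 \<open>j = N\<close> show ?case by auto
  next
    case (Suc l)
    then have j: "j < N" by simp
    from step[OF j Suc.prems(2-4)] obtain R1 where R1: "exec M P R T R1" "R1 c = R c" "R1 d = \<delta>"
      "I (Suc j) (R1(c := R c - \<delta>))" by blast
    let ?R2 = "R1(c := R c - \<delta>)"
    have c2: "?R2 c = (N - Suc j) * \<delta>"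
      using Suc.prems(3) j by (simp add: diff_mult_distrib)
    have "l = N - Suc j" using Suc.hyps(2) by simp
    moreover have "Suc j \<le> N" "?R2 d = \<delta>" using j R1(3) init(5) by auto
    ultimately obtain R3 where R3: "exec M (loop c d P) ?R2 ((N - Suc j) * (T + 2) + 1) R3" "I N R3" "R3 c = 0" "R3 d = \<delta>"
      using Suc.hyps(1)[OF _ _ R1(4) c2] by blast
    from R1(1) obtain t where t: "t \<le> T" "runs P (R, M) t (R1, M)" by (auto simp: exec_def)
    from R3(1) obtain t' where t': "t' \<le> (N - Suc j) * (T + 2) + 1"
      "runs (loop c d P) (?R2, M) t' (R3, M)" by (auto simp: exec_def)
    have "runs (Sub_Reg c c d) (R1, M) 1 (?R2, M)"
      using runs.intros(3)[of c c d R1 M] R1 by simp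
    with t(2) have "runs (P ;; Sub_Reg c c d) (R, M) (t + 1) (?R2, M)" by (rule runs.intros(6))
    moreover have "R c \<noteq> 0" using Suc.prems(3) j init(4) by simp
    ultimately have "runs (loop c d P) (R, M) (Suc (t + 1 + t')) (R3, M)"
      using t'(2) unfolding loop_def by (intro runs.intros(10))
    moreover have "Suc (t + 1 + t') \<le> (N - j) * (T + 2) + 1"
    proof -
      have "N - j = Suc (N - Suc j)" using j by simp
      then show ?thesis using t(1) t'(1) by simp
    qed
    ultimately have "exec M (loop c d P) R ((N - j) * (T + 2) + 1) R3"
      unfolding exec_def by blast
    with R3 show ?case by blast
  qed
  from this[of 0 R] init show ?thesis by simp
qed

text \<open>Throughout, register \<open>6\<close> holds \<open>1\<close>, register \<open>7\<close> holds \<open>0\<close>, and the registers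
  \<open>20\<close>, \<open>22\<close>, \<open>23\<close> are scratch registers of the modular arithmetic.\<close>

abbreviation (input) copy :: "nat \<Rightarrow> nat \<Rightarrow> program" where "copy r q \<equiv> Add_Reg r q 7"
abbreviation (input) incr :: "nat \<Rightarrow> program" where "incr r \<equiv> Add_Reg r r 6"
abbreviation (input) skip :: program where "skip \<equiv> Set_Const 7 0"

section \<open>Arithmetic by counting\<close>

text \<open>Adds in unit steps and wraps to 0 on reaching the modulus. Hence the summand may be
  arbitrarily large, and adding to 0 serves as reduction modulo \<open>p\<close>.\<close>

definition add_mod :: "nat \<Rightarrow> nat \<Rightarrow> nat \<Rightarrow> program" where
  "add_mod r b p = copy 22 b ;; loop 22 6
     (incr r ;; Sub_Reg 23 p r ;; If_Nonzero 23 skip (Set_Const r 0))"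

lemma exec_add_mod:
  assumes reg: "R 6 = 1" "R 7 = 0" and lt: "R r < R p"
    and dist: "distinct [r, b, p, 22, 23, 6, 7]"
  shows "\<exists>R'. exec M (add_mod r b p) R (6 * R b + 2) R' \<and> R' r = (R r + R b) mod R p \<and>
    (\<forall>x. x \<notin> {r, 22, 23} \<longrightarrow> R' x = R x)"
proof -
  let ?body = "incr r ;; Sub_Reg 23 p r ;; If_Nonzero 23 skip (Set_Const r 0)"
  let ?R1 = "R(22 := R b)"
  let ?I = "\<lambda>j R'. R' r = (R r + j) mod R p \<and> (\<forall>x. x \<notin> {r, 22, 23} \<longrightarrow> R' x = R x)"
  have init: "exec M (copy 22 b) R 1 ?R1"
    using exec_straight[of "copy 22 b" 1 M R] reg by simp
  have "\<exists>R'. exec M (loop 22 6 ?body) ?R1 (R b * (4 + 2) + 1) R' \<and> ?I (R b) R' \<and> R' 22 = 0 \<and> R' 6 = 1"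
  proof (rule exec_loop[where I = ?I])
    fix j R'
    assume j: "j < R b" and I: "?I j R'" and c: "R' 22 = (R b - j) * 1" and one: "R' 6 = 1"
    let ?R2 = "sem M ?body R'"
    have regs: "R' r = (R r + j) mod R p" "R' p = R p" "R' b = R b" "R' 7 = 0"
      using I dist reg by auto
    have lt': "(R r + j) mod R p < R p" using lt by simp
    have ex: "exec M ?body R' 4 ?R2" by (rule exec_straight) simp_all
    have "?R2 r = (R r + Suc j) mod R p"
      using dist regs one lt' by (auto simp: mod_Suc intro: le_antisym Suc_leI)
    moreover have "?R2 x = R x" if "x \<notin> {r, 22, 23}" for x
      using that I regs one reg by auto
    moreover have "?R2 22 = R' 22" "?R2 6 = 1" using dist one by auto
    ultimately show "\<exists>R''. exec M ?body R' 4 R'' \<and> R'' 22 = R' 22 \<and> R'' 6 = 1 \<and>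
        ?I (Suc j) (R''(22 := R' 22 - 1))"
      using ex dist by (intro exI[of _ ?R2]) auto
  qed (use reg lt dist in auto)
  then obtain R' where R': "exec M (loop 22 6 ?body) ?R1 (R b * (4 + 2) + 1) R'" "?I (R b) R'" by blast
  from exec_Seq[OF init R'(1)] have "exec M (add_mod r b p) R (6 * R b + 2) R'"
    unfolding add_mod_def by (rule exec_mono) simp
  with R'(2) show ?thesis by blast
qed

definition mul_mod :: "nat \<Rightarrow> nat \<Rightarrow> nat \<Rightarrow> nat \<Rightarrow> program" where
  "mul_mod r a b p = (Set_Const r 0 ;; copy 20 a) ;; loop 20 6 (add_mod r b p)"

lemma exec_mul_mod:
  assumes reg: "R 6 = 1" "R 7 = 0" and pos: "0 < R p"
    and dist: "distinct [r, b, p, 20, 22, 23, 6, 7]" "distinct [r, a, 20, 22, 23, 6, 7]"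
  shows "\<exists>R'. exec M (mul_mod r a b p) R (R a * (6 * R b + 4) + 3) R' \<and> R' r = R a * R b mod R p \<and>
    (\<forall>x. x \<notin> {r, 20, 22, 23} \<longrightarrow> R' x = R x)"
proof -
  let ?init = "Set_Const r 0 ;; copy 20 a"
  let ?R1 = "sem M ?init R"
  let ?I = "\<lambda>j R'. R' r = j * R b mod R p \<and> (\<forall>x. x \<notin> {r, 20, 22, 23} \<longrightarrow> R' x = R x)"
  have init: "exec M ?init R 2 ?R1" by (rule exec_straight) simp_all
  have "\<exists>R'. exec M (loop 20 6 (add_mod r b p)) ?R1 (R a * (6 * R b + 2 + 2) + 1) R' \<and>
      ?I (R a) R' \<and> R' 20 = 0 \<and> R' 6 = 1"
  proof (rule exec_loop[where I = ?I])
    fix j R'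
    assume j: "j < R a" and I: "?I j R'" and c: "R' 20 = (R a - j) * 1" and one: "R' 6 = 1"
    have regs: "R' r = j * R b mod R p" "R' p = R p" "R' b = R b" "R' 7 = 0"
      using I dist reg by auto
    have "R' r < R' p" using regs pos by simp
    from exec_add_mod[OF one regs(4) this, of b M] dist obtain R2 where
      R2: "exec M (add_mod r b p) R' (6 * R' b + 2) R2" "R2 r = (R' r + R' b) mod R' p"
      "\<And>x. x \<notin> {r, 22, 23} \<Longrightarrow> R2 x = R' x" by auto
    have "R2 r = Suc j * R b mod R p"
      unfolding R2(2) regs by (simp add: mod_add_right_eq add.commute)
    moreover have "R2 x = R x" if "x \<notin> {r, 20, 22, 23}" for x using that R2(3) I by simp
    moreover have "R2 20 = R' 20" "R2 6 = 1" using R2(3) dist one by auto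
    ultimately show "\<exists>R''. exec M (add_mod r b p) R' (6 * R b + 2) R'' \<and> R'' 20 = R' 20 \<and> R'' 6 = 1 \<and>
        ?I (Suc j) (R''(20 := R' 20 - 1))"
      using R2(1) regs dist by (intro exI[of _ R2]) auto
  qed (use reg dist pos in auto)
  then obtain R' where R': "exec M (loop 20 6 (add_mod r b p)) ?R1 (R a * (6 * R b + 2 + 2) + 1) R'"
    "?I (R a) R'" by blast
  from exec_Seq[OF init R'(1)] have "exec M (mul_mod r a b p) R (R a * (6 * R b + 4) + 3) R'"
    unfolding mul_mod_def by (rule exec_mono) (simp add: algebra_simps)
  with R'(2) show ?thesis by blast
qed

text \<open>Counts up to the input with register 28 as alternating parity bit; register 27 counts
  the completed pairs.\<close>

definition halve :: "nat \<Rightarrow> program" where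
  "halve x = (Set_Const 27 0 ;; Set_Const 28 0 ;; copy 29 x) ;; loop 29 6
     (If_Nonzero 28 (Set_Const 28 0 ;; incr 27) (Set_Const 28 1))"

lemma exec_halve:
  assumes reg: "R 6 = 1" "R 7 = 0" and x: "x \<notin> {27, 28, 29}"
  shows "\<exists>R'. exec M (halve x) R (5 * R x + 4) R' \<and> R' 27 = R x div 2 \<and> R' 28 = R x mod 2 \<and>
    (\<forall>x. x \<notin> {27, 28, 29} \<longrightarrow> R' x = R x)"
proof -
  let ?init = "Set_Const 27 0 ;; Set_Const 28 0 ;; copy 29 x"
  let ?body = "If_Nonzero 28 (Set_Const 28 0 ;; incr 27) (Set_Const 28 1)"
  let ?R1 = "sem M ?init R"
  let ?I = "\<lambda>j R'. R' 27 = j div 2 \<and> R' 28 = j mod 2 \<and> (\<forall>x. x \<notin> {27, 28, 29} \<longrightarrow> R' x = R x)"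
  have init: "exec M ?init R 3 ?R1" by (rule exec_straight) simp_all
  have "\<exists>R'. exec M (loop 29 6 ?body) ?R1 (R x * (3 + 2) + 1) R' \<and> ?I (R x) R' \<and> R' 29 = 0 \<and> R' 6 = 1"
  proof (rule exec_loop[where I = ?I])
    fix j R'
    assume j: "j < R x" and I: "?I j R'" and c: "R' 29 = (R x - j) * 1" and one: "R' 6 = 1"
    let ?R2 = "sem M ?body R'"
    have ex: "exec M ?body R' 3 ?R2" by (rule exec_straight) simp_all
    have "?R2 27 = Suc j div 2" "?R2 28 = Suc j mod 2" using I one by (auto; presburger)+
    moreover have "?R2 x = R x" if "x \<notin> {27, 28, 29}" for x using that I by auto
    moreover have "?R2 29 = R' 29" "?R2 6 = 1" using one by auto
    ultimately show "\<exists>R''. exec M ?body R' 3 R'' \<and> R'' 29 = R' 29 \<and> R'' 6 = 1 \<and>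
        ?I (Suc j) (R''(29 := R' 29 - 1))"
      using ex by (intro exI[of _ ?R2]) (auto simp del: sem.simps)
  qed (use reg x in auto)
  then obtain R' where R': "exec M (loop 29 6 ?body) ?R1 (R x * (3 + 2) + 1) R'" "?I (R x) R'" by blast
  from exec_Seq[OF init R'(1)] have "exec M (halve x) R (5 * R x + 4) R'"
    unfolding halve_def by (rule exec_mono) simp
  with R'(2) show ?thesis by blast
qed

text \<open>From here on a single \<open>D\<close> bounds all loop counts, so that the running times
  add up to one polynomial in \<open>D\<close>.\<close>

lemma exec_add_mod_le:
  assumes "R 6 = 1" "R 7 = 0" "R r < R p" "R b \<le> D" "distinct [r, b, p, 22, 23, 6, 7]"
  shows "\<exists>R'. exec M (add_mod r b p) R (6 * D + 2) R' \<and> R' r = (R r + R b) mod R p \<and>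
    (\<forall>x. x \<notin> {r, 22, 23} \<longrightarrow> R' x = R x)"
proof -
  have "6 * R b + 2 \<le> 6 * D + 2" using assms by simp
  with exec_add_mod[where M = M, OF assms(1-3,5)] show ?thesis using exec_mono by blast
qed

lemma exec_mul_mod_le:
  assumes "R 6 = 1" "R 7 = 0" "0 < R p" "R a \<le> D" "R b \<le> D"
    "distinct [r, b, p, 20, 22, 23, 6, 7]" "distinct [r, a, 20, 22, 23, 6, 7]"
  shows "\<exists>R'. exec M (mul_mod r a b p) R (D * (6 * D + 4) + 3) R' \<and> R' r = R a * R b mod R p \<and>
    (\<forall>x. x \<notin> {r, 20, 22, 23} \<longrightarrow> R' x = R x)"
proof -
  have "R a * (6 * R b + 4) + 3 \<le> D * (6 * D + 4) + 3"
    using assms by (intro add_mono mult_le_mono) auto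
  with exec_mul_mod[where M = M, OF assms(1-3,6,7)] show ?thesis using exec_mono by blast
qed

section \<open>Stages of the generator program\<close>

text \<open>Register 5 holds the seed length 6u, so stride 6 makes u rounds: register 8 becomes
  \<open>2 ^ u\<close>, the search range for the prime, and register 9 becomes 2u, the bit length of
  a seed number. Register 13 is the read position in the seed.\<close>

definition prologue :: program where
  "prologue = (Set_Const 6 1 ;; Set_Const 7 0 ;; Set_Const 8 1 ;; Set_Const 9 0 ;; Set_Const 13 0 ;; Set_Const 15 6) ;;
     loop 5 15 (Add_Reg 8 8 8 ;; incr 9 ;; incr 9)"

lemma exec_prologue:
  assumes u: "R 5 = 6 * u" "u \<le> D"
  shows "\<exists>R'. exec M prologue R (D * 5 + 7) R' \<and> R' 6 = 1 \<and> R' 7 = 0 \<and> R' 8 = 2 ^ u \<and> R' 9 = 2 * u \<and>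
    R' 13 = 0 \<and> (\<forall>x. x \<notin> {5, 6, 7, 8, 9, 13, 15} \<longrightarrow> R' x = R x)"
proof -
  let ?init = "Set_Const 6 1 ;; Set_Const 7 0 ;; Set_Const 8 1 ;; Set_Const 9 0 ;; Set_Const 13 0 ;; Set_Const 15 6"
  let ?body = "Add_Reg 8 8 8 ;; incr 9 ;; incr 9"
  let ?R1 = "sem M ?init R"
  let ?I = "\<lambda>j R'. R' 6 = 1 \<and> R' 7 = 0 \<and> R' 8 = 2 ^ j \<and> R' 9 = 2 * j \<and>
    R' 13 = 0 \<and> (\<forall>x. x \<notin> {5, 6, 7, 8, 9, 13, 15} \<longrightarrow> R' x = R x)"
  have init: "exec M ?init R 6 ?R1" by (rule exec_straight) simp_all
  have "\<exists>R'. exec M (loop 5 15 ?body) ?R1 (u * (3 + 2) + 1) R' \<and> ?I u R' \<and> R' 5 = 0 \<and> R' 15 = 6"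
  proof (rule exec_loop[where I = ?I])
    fix j R' assume I: "?I j R'" and "R' 15 = 6"
    have "exec M ?body R' 3 (sem M ?body R')" by (rule exec_straight) simp_all
    with I \<open>R' 15 = 6\<close> show "\<exists>R''. exec M ?body R' 3 R'' \<and> R'' 5 = R' 5 \<and> R'' 15 = 6 \<and>
        ?I (Suc j) (R''(5 := R' 5 - 6))"
      by (intro exI[of _ "sem M ?body R'"]) auto
  qed (use u in auto)
  then obtain R' where R': "exec M (loop 5 15 ?body) ?R1 (u * (3 + 2) + 1) R'" "?I u R'" by blast
  from exec_Seq[OF init R'(1)] have "exec M prologue R (D * 5 + 7) R'"
    unfolding prologue_def by (rule exec_mono) (use u in simp)
  with R'(2) show ?thesis by blast
qed

primrec bits_value :: "(nat \<Rightarrow> nat) \<Rightarrow> nat \<Rightarrow> nat \<Rightarrow> nat" where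
  "bits_value M a 0 = 0"
| "bits_value M a (Suc m) = 2 * bits_value M a m + M (a + m)"

text \<open>Horner's scheme, most significant bit first. The position in register 13 is kept between
  calls, so consecutive calls read consecutive blocks.\<close>

definition read_bits :: "nat \<Rightarrow> program" where
  "read_bits r = (Set_Const r 0 ;; copy 14 9) ;;
     loop 14 6 (Add_Reg r r r ;; Load 15 13 ;; Add_Reg r r 15 ;; incr 13)"

lemma exec_read_bits:
  assumes reg: "R 6 = 1" "R 7 = 0" and r: "r \<notin> {6, 7, 9, 13, 14, 15}" and D: "R 9 \<le> D"
  shows "\<exists>R'. exec M (read_bits r) R (D * 6 + 3) R' \<and> R' r = bits_value M (R 13) (R 9) \<and>
    R' 13 = R 13 + R 9 \<and> (\<forall>x. x \<notin> {r, 13, 14, 15} \<longrightarrow> R' x = R x)"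
proof -
  let ?init = "Set_Const r 0 ;; copy 14 9"
  let ?body = "Add_Reg r r r ;; Load 15 13 ;; Add_Reg r r 15 ;; incr 13"
  let ?R1 = "sem M ?init R"
  let ?I = "\<lambda>j R'. R' r = bits_value M (R 13) j \<and>
    R' 13 = R 13 + j \<and> (\<forall>x. x \<notin> {r, 13, 14, 15} \<longrightarrow> R' x = R x)"
  have init: "exec M ?init R 2 ?R1" by (rule exec_straight) simp_all
  have "\<exists>R'. exec M (loop 14 6 ?body) ?R1 (R 9 * (4 + 2) + 1) R' \<and> ?I (R 9) R' \<and> R' 14 = 0 \<and> R' 6 = 1"
  proof (rule exec_loop[where I = ?I])
    fix j R' assume I: "?I j R'" and one: "R' 6 = 1"
    have "exec M ?body R' 4 (sem M ?body R')" by (rule exec_straight) simp_all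
    with I one r show "\<exists>R''. exec M ?body R' 4 R'' \<and> R'' 14 = R' 14 \<and> R'' 6 = 1 \<and>
        ?I (Suc j) (R''(14 := R' 14 - 1))"
      by (intro exI[of _ "sem M ?body R'"]) auto
  qed (use r reg in auto)
  then obtain R' where R': "exec M (loop 14 6 ?body) ?R1 (R 9 * (4 + 2) + 1) R'" "?I (R 9) R'" by blast
  from exec_Seq[OF init R'(1)] have "exec M (read_bits r) R (D * 6 + 3) R'"
    unfolding read_bits_def by (rule exec_mono) (use D in simp)
  with R'(2) show ?thesis by blast
qed

text \<open>Trial division of register 17 by 2, 3, ... up to its predecessor; the flag in register
  18 stays 0 exactly for primes.\<close>

definition divisor_test :: program where
  "divisor_test = (Set_Const 18 0 ;; Set_Const 19 1 ;; Sub_Reg 20 17 6 ;; Sub_Reg 20 20 6) ;;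
     loop 20 6 ((incr 19 ;; Set_Const 21 0) ;; add_mod 21 17 19 ;; If_Nonzero 21 skip (Set_Const 18 1))"

lemma exec_divisor_test:
  assumes reg: "R 6 = 1" "R 7 = 0" and c: "2 \<le> R 17" "R 17 \<le> D"
  shows "\<exists>R'. exec M divisor_test R (D * (6 * D + 8) + 5) R' \<and> (R' 18 = 0 \<longleftrightarrow> prime (R 17)) \<and>
    (\<forall>x. x \<notin> {18, 19, 20, 21, 22, 23} \<longrightarrow> R' x = R x)"
proof -
  let ?init = "Set_Const 18 0 ;; Set_Const 19 1 ;; Sub_Reg 20 17 6 ;; Sub_Reg 20 20 6"
  let ?a = "incr 19 ;; Set_Const 21 0" and ?b = "If_Nonzero 21 skip (Set_Const 18 1)"
  let ?body = "?a ;; add_mod 21 17 19 ;; ?b"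
  let ?R1 = "sem M ?init R"
  let ?I = "\<lambda>j R'. R' 19 = Suc j \<and> (R' 18 = 0 \<longleftrightarrow> (\<forall>d. 2 \<le> d \<and> d \<le> Suc j \<longrightarrow> \<not> d dvd R 17)) \<and>
    (\<forall>x. x \<notin> {18, 19, 20, 21, 22, 23} \<longrightarrow> R' x = R x)"
  have init: "exec M ?init R 4 ?R1" by (rule exec_straight) simp_all
  have "\<exists>R'. exec M (loop 20 6 ?body) ?R1 ((R 17 - 2) * ((6 * D + 6) + 2) + 1) R' \<and>
      ?I (R 17 - 2) R' \<and> R' 20 = 0 \<and> R' 6 = 1"
  proof (rule exec_loop[where I = ?I])
    fix j R' assume I: "?I j R'" and one: "R' 6 = 1"
    have I': "R' 19 = Suc j" "R' 18 = 0 \<longleftrightarrow> (\<forall>d. 2 \<le> d \<and> d \<le> Suc j \<longrightarrow> \<not> d dvd R 17)"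
      and keep: "\<And>x. x \<notin> {18, 19, 20, 21, 22, 23} \<Longrightarrow> R' x = R x" using I by blast+
    let ?R2 = "sem M ?a R'"
    have ra: "exec M ?a R' 2 ?R2" by (rule exec_straight) simp_all
    have regs: "?R2 6 = 1" "?R2 7 = 0" "?R2 21 < ?R2 19" "?R2 17 \<le> D"
      using I'(1) keep one reg c by simp_all
    have "distinct [21, 17, 19, 22, 23, 6, 7::nat]" by simp
    from exec_add_mod_le[where M = M, OF regs this]
    obtain R3 where R3: "exec M (add_mod 21 17 19) ?R2 (6 * D + 2) R3"
      "R3 21 = (?R2 21 + ?R2 17) mod ?R2 19" "\<And>x. x \<notin> {21, 22, 23} \<Longrightarrow> R3 x = ?R2 x"
      by blast
    let ?R4 = "sem M ?b R3"
    have rb: "exec M ?b R3 2 ?R4" by (rule exec_straight) simp_all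
    have R321: "R3 21 = R 17 mod Suc (Suc j)" using R3(2) I'(1) keep one by simp
    have "exec M ?body R' (6 * D + 6) ?R4"
      using exec_Seq[OF ra exec_Seq[OF R3(1) rb]] by (rule exec_mono) simp
    moreover have "?R4 18 = 0 \<longleftrightarrow> (\<forall>d. 2 \<le> d \<and> d \<le> Suc (Suc j) \<longrightarrow> \<not> d dvd R 17)"
    proof -
      have "?R4 18 = 0 \<longleftrightarrow> \<not> Suc (Suc j) dvd R 17 \<and> R' 18 = 0"
        using R3(3) R321 by (auto simp: dvd_eq_mod_eq_0)
      moreover have "(\<forall>d. 2 \<le> d \<and> d \<le> Suc (Suc j) \<longrightarrow> \<not> d dvd R 17) \<longleftrightarrow>
          \<not> Suc (Suc j) dvd R 17 \<and> (\<forall>d. 2 \<le> d \<and> d \<le> Suc j \<longrightarrow> \<not> d dvd R 17)"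
        using le_Suc_eq[of _ "Suc j"] Suc_le_mono[of 1 "Suc j"] numeral_2_eq_2 by (metis Suc_le_mono le0 One_nat_def)
      ultimately show ?thesis using I'(2) by blast
    qed
    moreover have "?R4 19 = Suc (Suc j)" "?R4 20 = R' 20" "?R4 6 = 1"
      using R3(3) I'(1) one by simp_all
    moreover have "?R4 x = R x" if "x \<notin> {18, 19, 20, 21, 22, 23}" for x
      using R3(3) keep that reg by simp
    ultimately show "\<exists>R''. exec M ?body R' (6 * D + 6) R'' \<and> R'' 20 = R' 20 \<and> R'' 6 = 1 \<and>
        ?I (Suc j) (R''(20 := R' 20 - 1))"
      by (intro exI[of _ ?R4]) (auto simp del: sem.simps)
  qed (use reg in auto)
  then obtain R' where R0: "exec M (loop 20 6 ?body) ?R1 ((R 17 - 2) * ((6 * D + 6) + 2) + 1) R' \<and>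
    ?I (R 17 - 2) R' \<and> R' 20 = 0 \<and> R' 6 = 1" ..
  note R' = R0[THEN conjunct1] R0[THEN conjunct2, THEN conjunct1]
  have "(R 17 - 2) * ((6 * D + 6) + 2) \<le> D * (6 * D + 8)"
    using c by (intro mult_le_mono) auto
  then have "exec M divisor_test R (D * (6 * D + 8) + 5) R'"
    unfolding divisor_test_def by (intro exec_mono[OF exec_Seq[OF init R'(1)]]) simp
  moreover have prime: "prime (R 17) \<longleftrightarrow> (\<forall>d. 2 \<le> d \<and> d \<le> Suc (R 17 - 2) \<longrightarrow> \<not> d dvd R 17)"
  proof
    assume "prime (R 17)"
    then show "\<forall>d. 2 \<le> d \<and> d \<le> Suc (R 17 - 2) \<longrightarrow> \<not> d dvd R 17"
      using c by (auto simp: prime_nat_iff)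
  next
    assume *: "\<forall>d. 2 \<le> d \<and> d \<le> Suc (R 17 - 2) \<longrightarrow> \<not> d dvd R 17"
    show "prime (R 17)" unfolding prime_nat_iff
    proof (intro conjI allI impI)
      fix m assume m: "m dvd R 17"
      have "0 < R 17" using c by simp
      with m have "0 < m" "m \<le> R 17" by (auto intro: dvd_imp_le dvd_pos_nat)
      moreover have "\<not> (2 \<le> m \<and> m \<le> Suc (R 17 - 2))" using * m by blast
      ultimately show "m = 1 \<or> m = R 17" by linarith
    qed (use c in simp)
  qed
  moreover have "R' 18 = 0 \<longleftrightarrow> prime (R 17)"
    by (rule trans[OF R'(2)[THEN conjunct2, THEN conjunct1] prime[symmetric]])
  moreover note R'(2)[THEN conjunct2, THEN conjunct2]
  ultimately show ?thesis by (intro exI[of _ R'] conjI)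
qed

text \<open>The result of an upward search that remembers the last prime seen, starting from
  0.\<close>

primrec largest_prime :: "nat \<Rightarrow> nat" where
  "largest_prime 0 = 0"
| "largest_prime (Suc n) = (if prime (Suc n) then Suc n else largest_prime n)"

lemma largest_prime_le: "largest_prime n \<le> n"
  by (induction n) auto

lemma largest_prime_ge: "prime p \<Longrightarrow> p \<le> n \<Longrightarrow> prime (largest_prime n) \<and> p \<le> largest_prime n"
  by (induction n) (auto simp: le_Suc_eq)

definition find_prime :: program where
  "find_prime = (Set_Const 16 0 ;; Set_Const 17 1 ;; Sub_Reg 14 8 6) ;;
     loop 14 6 (incr 17 ;; divisor_test ;; If_Nonzero 18 skip (copy 16 17))"

lemma exec_find_prime:
  assumes reg: "R 6 = 1" "R 7 = 0" and U: "1 \<le> R 8" "R 8 \<le> D"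
  shows "\<exists>R'. exec M find_prime R (D * (D * (6 * D + 8) + 10) + 4) R' \<and> R' 16 = largest_prime (R 8) \<and>
    (\<forall>x. x \<notin> {14, 16, 17, 18, 19, 20, 21, 22, 23} \<longrightarrow> R' x = R x)"
proof -
  let ?init = "Set_Const 16 0 ;; Set_Const 17 1 ;; Sub_Reg 14 8 6"
  let ?b = "If_Nonzero 18 skip (copy 16 17)"
  let ?body = "incr 17 ;; divisor_test ;; ?b"
  let ?R1 = "sem M ?init R"
  let ?T = "D * (6 * D + 8) + 5"
  let ?I = "\<lambda>j R'. R' 17 = Suc j \<and> R' 16 = largest_prime (Suc j) \<and>
    (\<forall>x. x \<notin> {14, 16, 17, 18, 19, 20, 21, 22, 23} \<longrightarrow> R' x = R x)"
  have init: "exec M ?init R 3 ?R1" by (rule exec_straight) simp_all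
  have "\<exists>R'. exec M (loop 14 6 ?body) ?R1 ((R 8 - 1) * ((?T + 3) + 2) + 1) R' \<and>
      ?I (R 8 - 1) R' \<and> R' 14 = 0 \<and> R' 6 = 1"
  proof (rule exec_loop[where I = ?I])
    fix j R' assume j: "j < R 8 - 1" and I: "?I j R'" and one: "R' 6 = 1"
    let ?R2 = "sem M (incr 17) R'"
    have ra: "exec M (incr 17) R' 1 ?R2" by (rule exec_straight) simp_all
    have regs: "?R2 6 = 1" "?R2 7 = 0" "2 \<le> ?R2 17" "?R2 17 \<le> D"
      using I one reg j U by auto
    obtain R3 where R3': "exec M divisor_test ?R2 ?T R3 \<and> (R3 18 = 0 \<longleftrightarrow> prime (?R2 17)) \<and>
      (\<forall>x. x \<notin> {18, 19, 20, 21, 22, 23} \<longrightarrow> R3 x = ?R2 x)"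
      using exec_divisor_test[where M = M, OF regs] ..
    note R3 = R3'[THEN conjunct1] R3'[THEN conjunct2, THEN conjunct1]
      R3'[THEN conjunct2, THEN conjunct2, rule_format]
    let ?R4 = "sem M ?b R3"
    have rb: "exec M ?b R3 2 ?R4" by (rule exec_straight) simp_all
    have "exec M ?body R' (?T + 3) ?R4"
      using exec_Seq[OF ra exec_Seq[OF R3(1) rb]] by (rule exec_mono) simp
    moreover have "?R4 16 = largest_prime (Suc (Suc j))"
      using R3(2,3) I one reg by auto
    moreover have "?R4 17 = Suc (Suc j)" "?R4 14 = R' 14" "?R4 6 = 1"
      using R3(3) I one by auto
    moreover have "?R4 x = R x" if "x \<notin> {14, 16, 17, 18, 19, 20, 21, 22, 23}" for x
      using R3(3) I that reg by auto
    ultimately show "\<exists>R''. exec M ?body R' (?T + 3) R'' \<and> R'' 14 = R' 14 \<and> R'' 6 = 1 \<and>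
        ?I (Suc j) (R''(14 := R' 14 - 1))"
      by (intro exI[of _ ?R4]) (auto simp del: sem.simps)
  qed (use reg in auto)
  then obtain R' where R': "exec M (loop 14 6 ?body) ?R1 ((R 8 - 1) * ((?T + 3) + 2) + 1) R'"
    "?I (R 8 - 1) R'" by blast
  have "(R 8 - 1) * ((?T + 3) + 2) \<le> D * (?T + 3 + 2)"
    using U by (intro mult_le_mono) auto
  then have "exec M find_prime R (D * (D * (6 * D + 8) + 10) + 4) R'"
    unfolding find_prime_def by (intro exec_mono[OF exec_Seq[OF init R'(1)]]) (simp add: algebra_simps)
  moreover have "Suc (R 8 - 1) = R 8" using U by simp
  ultimately show ?thesis using R'(2) by auto
qed

text \<open>Registers 24, 25, 26 hold the partial hash, the current power of z1 modulo
  \<open>p\<close> and the remaining digits of \<open>i\<close>. The loop runs \<open>i\<close>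
  times, as does the sum in \<open>hash\<close>.\<close>

definition hash_index :: program where
  "hash_index = (Set_Const 24 0 ;; Set_Const 25 1 ;; copy 26 4 ;; copy 14 4) ;;
     loop 14 6 (halve 26 ;; If_Nonzero 28 (copy 30 25) (Set_Const 30 0) ;; add_mod 24 30 16 ;;
       mul_mod 30 25 10 16 ;; copy 25 30 ;; copy 26 27)"

lemma exec_hash_index:
  assumes reg: "R 6 = 1" "R 7 = 0" and p: "1 < R 16" and D: "R 16 \<le> D" "R 4 \<le> D" "R 10 \<le> D"
  shows "\<exists>R'. exec M hash_index R (D * (D * (6 * D + 4) + 11 * D + 15) + 5) R' \<and>
    R' 24 = hash (R 16) (R 10) (R 4) \<and>
    (\<forall>x. x \<notin> {14, 20, 22, 23, 24, 25, 26, 27, 28, 29, 30} \<longrightarrow> R' x = R x)"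
proof -
  let ?init = "Set_Const 24 0 ;; Set_Const 25 1 ;; copy 26 4 ;; copy 14 4"
  let ?a = "If_Nonzero 28 (copy 30 25) (Set_Const 30 0)" and ?b = "copy 25 30 ;; copy 26 27"
  let ?body = "halve 26 ;; ?a ;; add_mod 24 30 16 ;; mul_mod 30 25 10 16 ;; ?b"
  let ?R1 = "sem M ?init R"
  let ?T = "D * (6 * D + 4) + 11 * D + 13"
  let ?W = "{14, 20, 22, 23, 24, 25, 26, 27, 28, 29, 30}"
  let ?z = "R 10" and ?p = "R 16" and ?i = "R 4"
  let ?s = "\<lambda>j. \<Sum>l<j. if odd (?i div 2 ^ l) then ?z ^ l else 0"
  let ?I = "\<lambda>j R'. R' 24 = ?s j mod ?p \<and> R' 25 = ?z ^ j mod ?p \<and> R' 26 = ?i div 2 ^ j \<and>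
    (\<forall>x. x \<notin> ?W \<longrightarrow> R' x = R x)"
  have init: "exec M ?init R 4 ?R1" by (rule exec_straight) simp_all
  have "\<exists>R'. exec M (loop 14 6 ?body) ?R1 (?i * (?T + 2) + 1) R' \<and> ?I ?i R' \<and> R' 14 = 0 \<and> R' 6 = 1"
  proof (rule exec_loop[where I = ?I])
    fix j R' assume I: "?I j R'" and one: "R' 6 = 1"
    have I': "R' 24 = ?s j mod ?p" "R' 25 = ?z ^ j mod ?p" "R' 26 = ?i div 2 ^ j"
      and keep: "\<And>x. x \<notin> ?W \<Longrightarrow> R' x = R x" using I by blast+
    have z7: "R' 7 = 0" using keep reg by simp
    have "R' 26 \<le> ?i" unfolding I' by (rule div_le_dividend)
    then have T2: "5 * R' 26 + 4 \<le> 5 * D + 4" using D by linarith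
    have "26 \<notin> {27, 28, 29::nat}" by simp
    from exec_halve[where M = M, OF one z7 this]
    obtain R2 where R2: "exec M (halve 26) R' (5 * D + 4) R2" "R2 27 = R' 26 div 2" "R2 28 = R' 26 mod 2"
      "\<And>x. x \<notin> {27, 28, 29} \<Longrightarrow> R2 x = R' x"
      using exec_mono[OF _ T2] by blast
    let ?R3 = "sem M ?a R2"
    have ra: "exec M ?a R2 2 ?R3" by (rule exec_straight) simp_all
    have w: "?z ^ j mod ?p \<le> D" "?s j mod ?p < ?p" using p D by (auto intro: order.trans[OF mod_less_divisor[THEN less_imp_le]])
    have regs3: "?R3 6 = 1" "?R3 7 = 0" "?R3 24 < ?R3 16" "?R3 30 \<le> D"
      using R2(4) one z7 I' keep w by (simp_all add: I')
    have R330: "?R3 30 = (if odd (?i div 2 ^ j) then ?z ^ j mod ?p else 0)"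
      using R2(3,4) I' z7 by (simp add: odd_iff_mod_2_eq_one)
    have "distinct [24, 30, 16, 22, 23, 6, 7::nat]" by simp
    from exec_add_mod_le[where M = M, OF regs3 this]
    obtain R4 where R4: "exec M (add_mod 24 30 16) ?R3 (6 * D + 2) R4"
      "R4 24 = (?R3 24 + ?R3 30) mod ?R3 16" "\<And>x. x \<notin> {24, 22, 23} \<Longrightarrow> R4 x = ?R3 x"
      by blast
    have R34: "?R3 x = R' x" if "x \<notin> {27, 28, 29, 30}" for x using R2(4) that by auto
    have R424: "R4 24 = ?s (Suc j) mod ?p"
      using R4(2) unfolding R330 by (simp add: R34 I' keep mod_simps del: sem.simps)
    have keep4: "R4 x = R' x" if "x \<notin> {22, 23, 24, 27, 28, 29, 30}" for x
      using R4(3) R34 that by (simp del: sem.simps)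
    have R427: "R4 27 = ?i div 2 ^ Suc j"
    proof -
      have "R4 27 = R2 27" using R4(3)[of 27] by simp
      also have "\<dots> = ?i div 2 ^ j div 2" unfolding R2(2) I'(3) ..
      also have "\<dots> = ?i div 2 ^ Suc j" by (simp only: power_Suc2 div_mult2_eq)
      finally show ?thesis .
    qed
    have regs4: "R4 6 = 1" "R4 7 = 0" "0 < R4 16" "R4 25 \<le> D" "R4 10 \<le> D"
      using keep4 one z7 I' keep w p D by simp_all
    have "distinct [30, 10, 16, 20, 22, 23, 6, 7::nat]" "distinct [30, 25, 20, 22, 23, 6, 7::nat]"
      by simp_all
    from exec_mul_mod_le[where M = M, OF regs4 this]
    obtain R5 where R5: "exec M (mul_mod 30 25 10 16) R4 (D * (6 * D + 4) + 3) R5"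
      "R5 30 = R4 25 * R4 10 mod R4 16" "\<And>x. x \<notin> {30, 20, 22, 23} \<Longrightarrow> R5 x = R4 x"
      by blast
    have R530: "R5 30 = ?z ^ Suc j mod ?p"
      unfolding R5(2) using keep4 I' keep by (simp add: mod_mult_right_eq mult.commute)
    let ?R6 = "sem M ?b R5"
    have rb: "exec M ?b R5 2 ?R6" by (rule exec_straight) simp_all
    have "exec M ?body R' ?T ?R6"
      using exec_Seq[OF R2(1) exec_Seq[OF ra exec_Seq[OF R4(1) exec_Seq[OF R5(1) rb]]]]
      by (rule exec_mono) simp
    moreover have "?R6 24 = ?s (Suc j) mod ?p" "?R6 25 = ?z ^ Suc j mod ?p" "?R6 26 = ?i div 2 ^ Suc j"
      using R5(3) R424 R427 R530 regs4(2) by (simp_all del: sum.lessThan_Suc power_Suc)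
    moreover have "?R6 14 = R' 14" "?R6 6 = 1" using R5(3) keep4 one by simp_all
    moreover have "?R6 x = R x" if "x \<notin> ?W" for x using R5(3) keep4 keep that by simp
    ultimately show "\<exists>R''. exec M ?body R' ?T R'' \<and> R'' 14 = R' 14 \<and> R'' 6 = 1 \<and>
        ?I (Suc j) (R''(14 := R' 14 - 1))"
      by (intro exI[of _ ?R6]) (auto simp del: sem.simps sum.lessThan_Suc power_Suc)
  qed (use reg p in auto)
  then obtain R' where R': "exec M (loop 14 6 ?body) ?R1 (?i * (?T + 2) + 1) R'" "?I ?i R'" by blast
  have "?i * (?T + 2) \<le> D * (?T + 2)" using D by (intro mult_le_mono) auto
  then have "exec M hash_index R (D * (D * (6 * D + 4) + 11 * D + 15) + 5) R'"
    unfolding hash_index_def by (intro exec_mono[OF exec_Seq[OF init R'(1)]]) (simp add: algebra_simps)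
  then show ?thesis using R'(2) by (auto simp: hash_def)
qed

text \<open>Register 31 is z2 - h_i modulo \<open>p\<close> and register 33 runs through the
  candidates for its inverse. Registers 34 and 35 hold the two truncated differences of the product
  and 1, whose sum is zero only if the product is 1.\<close>

definition find_sample :: program where
  "find_sample = (Set_Const 31 0) ;; add_mod 31 11 16 ;; Sub_Reg 30 16 24 ;; add_mod 31 30 16 ;;
     (Set_Const 32 0 ;; Set_Const 33 0 ;; copy 14 16) ;;
     loop 14 6 (mul_mod 30 33 31 16 ;; Sub_Reg 34 30 6 ;; Sub_Reg 35 6 30 ;; Add_Reg 34 34 35 ;;
       If_Nonzero 34 skip (Add_Reg 32 32 33) ;; incr 33) ;;
     mul_mod 36 12 32 16"

lemma exec_find_sample:
  assumes reg: "R 6 = 1" "R 7 = 0" and p: "prime (R 16)" and h: "R 24 = hash (R 16) (R 10) i"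
    and D: "R 16 \<le> D" "R 11 \<le> D" "R 12 \<le> D"
  shows "\<exists>R'. exec M find_sample R (D * (D * (6 * D + 4) + 11) + D * (6 * D + 4) + 12 * D + 13) R' \<and>
    R' 36 = sample (R 16) (R 10) (R 11) (R 12) i \<and>
    (\<forall>x. x \<notin> {14, 20, 22, 23, 30, 31, 32, 33, 34, 35, 36} \<longrightarrow> R' x = R x)"
proof -
  let ?p = "R 16"
  have p0: "0 < ?p" and p1: "1 < ?p" using prime_gt_0_nat[OF p] prime_gt_1_nat[OF p] .
  let ?d = "(R 11 + (?p - R 24)) mod ?p"
  let ?W = "{14, 20, 22, 23, 30, 31, 32, 33, 34, 35, 36}"

  let ?R1 = "sem M (Set_Const 31 0) R"
  have r1: "exec M (Set_Const 31 0) R 1 ?R1" by (rule exec_straight) simp_all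
  have regs1: "?R1 6 = 1" "?R1 7 = 0" "?R1 31 < ?R1 16" "?R1 11 \<le> D"
    using reg p0 D by simp_all
  have "distinct [31, 11, 16, 22, 23, 6, 7::nat]" by simp
  from exec_add_mod_le[where M = M, OF regs1 this] obtain R2 where
    R2: "exec M (add_mod 31 11 16) ?R1 (6 * D + 2) R2"
    "R2 31 = (?R1 31 + ?R1 11) mod ?R1 16" "\<And>x. x \<notin> {31, 22, 23} \<Longrightarrow> R2 x = ?R1 x" by blast
  let ?R3 = "sem M (Sub_Reg 30 16 24) R2"
  have r3: "exec M (Sub_Reg 30 16 24) R2 1 ?R3" by (rule exec_straight) simp_all
  have regs3: "?R3 6 = 1" "?R3 7 = 0" "?R3 31 < ?R3 16" "?R3 30 \<le> D"
    using reg p0 D R2(2,3) by simp_all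
  have "distinct [31, 30, 16, 22, 23, 6, 7::nat]" by simp
  from exec_add_mod_le[where M = M, OF regs3 this] obtain R4 where
    R4: "exec M (add_mod 31 30 16) ?R3 (6 * D + 2) R4"
    "R4 31 = (?R3 31 + ?R3 30) mod ?R3 16" "\<And>x. x \<notin> {31, 22, 23} \<Longrightarrow> R4 x = ?R3 x" by blast
  have d: "R4 31 = ?d" using R4(2) R2(2,3) by (simp add: mod_add_left_eq)
  have keep4: "R4 x = R x" if "x \<notin> {22, 23, 30, 31}" for x using R4(3) R2(3) that by simp

  let ?init = "Set_Const 32 0 ;; Set_Const 33 0 ;; copy 14 16"
  let ?b = "Sub_Reg 34 30 6 ;; Sub_Reg 35 6 30 ;; Add_Reg 34 34 35 ;;
       If_Nonzero 34 skip (Add_Reg 32 32 33) ;; incr 33"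
  let ?body = "mul_mod 30 33 31 16 ;; ?b"
  let ?T = "D * (6 * D + 4) + 9"
  let ?R5 = "sem M ?init R4"
  let ?I = "\<lambda>j R'. R' 33 = j \<and> R' 32 = (\<Sum>w<j. if w * ?d mod ?p = 1 then w else 0) \<and> R' 31 = ?d \<and>
    (\<forall>x. x \<notin> ?W \<longrightarrow> R' x = R x)"
  have r5: "exec M ?init R4 3 ?R5" by (rule exec_straight) simp_all
  have "\<exists>R'. exec M (loop 14 6 ?body) ?R5 (?p * (?T + 2) + 1) R' \<and> ?I ?p R' \<and> R' 14 = 0 \<and> R' 6 = 1"
  proof (rule exec_loop[where I = ?I])
    fix j R' assume j: "j < ?p" and I: "?I j R'" and one: "R' 6 = 1"
    have I': "R' 33 = j" "R' 32 = (\<Sum>w<j. if w * ?d mod ?p = 1 then w else 0)" "R' 31 = ?d"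
      and keep: "\<And>x. x \<notin> ?W \<Longrightarrow> R' x = R x" using I by blast+
    have "?d < ?p" using p0 by simp
    then have "?d \<le> D" using D(1) by linarith
    then have regs: "R' 6 = 1" "R' 7 = 0" "0 < R' 16" "R' 33 \<le> D" "R' 31 \<le> D"
      using I' keep one reg p0 j D by simp_all
    have "distinct [30, 31, 16, 20, 22, 23, 6, 7::nat]" "distinct [30, 33, 20, 22, 23, 6, 7::nat]"
      by simp_all
    from exec_mul_mod_le[where M = M, OF regs this] obtain R2 where
      R2: "exec M (mul_mod 30 33 31 16) R' (D * (6 * D + 4) + 3) R2"
      "R2 30 = R' 33 * R' 31 mod R' 16" "\<And>x. x \<notin> {30, 20, 22, 23} \<Longrightarrow> R2 x = R' x" by blast
    let ?R3 = "sem M ?b R2"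
    have rb: "exec M ?b R2 6 ?R3" by (rule exec_straight) simp_all
    have "exec M ?body R' ?T ?R3" using exec_Seq[OF R2(1) rb] by (rule exec_mono) simp
    moreover have "?R3 33 = Suc j" "?R3 31 = ?d" "?R3 14 = R' 14" "?R3 6 = 1"
      using R2(3) I'(1,3) one by simp_all
    moreover have "?R3 32 = (\<Sum>w<Suc j. if w * ?d mod ?p = 1 then w else 0)"
    proof -
      have "R2 30 = j * ?d mod ?p" using R2(2) I' keep by simp
      then have "?R3 32 = R' 32 + (if j * ?d mod ?p = 1 then j else 0)"
        using R2(3) I'(1) one by auto
      then show ?thesis using I'(2) by simp
    qed
    moreover have "?R3 x = R x" if "x \<notin> ?W" for x using R2(3) keep that reg by auto
    ultimately show "\<exists>R''. exec M ?body R' ?T R'' \<and> R'' 14 = R' 14 \<and> R'' 6 = 1 \<and>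
        ?I (Suc j) (R''(14 := R' 14 - 1))"
      by (intro exI[of _ ?R3]) (simp del: sem.simps sum.lessThan_Suc)
  next
    show "?I 0 ?R5" using keep4 d reg by simp
  qed (use keep4 reg in simp_all)
  then obtain R6 where R6: "exec M (loop 14 6 ?body) ?R5 (?p * (?T + 2) + 1) R6" "?I ?p R6" "R6 6 = 1"
    by blast
  have R632: "R6 32 = inv_mod ?p ?d" and keep6: "\<And>x. x \<notin> ?W \<Longrightarrow> R6 x = R x"
    using R6(2) unfolding inv_mod_def by blast+
  have regs6: "R6 6 = 1" "R6 7 = 0" "0 < R6 16" "R6 12 \<le> D" "R6 32 \<le> D"
    using R6(3) keep6 R632 inv_mod_less[OF p, of ?d] D reg p0 by simp_all
  have "distinct [36, 32, 16, 20, 22, 23, 6, 7::nat]" "distinct [36, 12, 20, 22, 23, 6, 7::nat]"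
    by simp_all
  from exec_mul_mod_le[where M = M, OF regs6 this] obtain R7 where
    R7: "exec M (mul_mod 36 12 32 16) R6 (D * (6 * D + 4) + 3) R7"
    "R7 36 = R6 12 * R6 32 mod R6 16" "\<And>x. x \<notin> {36, 20, 22, 23} \<Longrightarrow> R7 x = R6 x" by blast
  have le: "?p * (?T + 2) \<le> D * (?T + 2)" using D by (intro mult_le_mono) auto
  have "exec M find_sample R (D * (D * (6 * D + 4) + 11) + D * (6 * D + 4) + 12 * D + 13) R7"
    unfolding find_sample_def
    by (rule exec_mono[OF exec_Seq[OF r1 exec_Seq[OF R2(1) exec_Seq[OF r3 exec_Seq[OF R4(1)
          exec_Seq[OF r5 exec_Seq[OF R6(1) R7(1)]]]]]]]) (use le in \<open>simp add: algebra_simps\<close>)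
  moreover have "R7 36 = sample ?p (R 10) (R 11) (R 12) i"
    using R7(2) keep6 R632 by (simp add: sample_def h)
  moreover have "\<forall>x. x \<notin> ?W \<longrightarrow> R7 x = R x" using R7(3) keep6 by simp
  ultimately show ?thesis by (intro exI[of _ R7] conjI)
qed

text \<open>Naturals have no sign, so register 38 counts the products 1 and register 39 the products
  -1. Registers 42 to 45 are nonzero iff \<open>u\<close>, or its shift, lies below
  \<open>p div 2\<close> (42, 43) or below \<open>2 * (p div 2)\<close> (44, 45).\<close>

definition correlate :: program where
  "correlate = halve 16 ;;
     (Add_Reg 37 27 27 ;; Set_Const 38 0 ;; Set_Const 39 0 ;; Set_Const 40 0 ;; copy 41 36 ;; copy 14 16) ;;
     loop 14 6 ((Sub_Reg 42 27 40 ;; Sub_Reg 43 27 41 ;; Sub_Reg 44 37 40 ;; Sub_Reg 45 37 41) ;;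
       If_Nonzero 42
         (If_Nonzero 43 (incr 38) (If_Nonzero 45 (incr 39) skip))
         (If_Nonzero 44 (If_Nonzero 43 (incr 39) (If_Nonzero 45 (incr 38) skip)) skip) ;;
       incr 40 ;; incr 41 ;; Sub_Reg 42 16 41 ;; If_Nonzero 42 skip (Set_Const 41 0))"

lemma exec_correlate:
  assumes reg: "R 6 = 1" "R 7 = 0" and v: "R 36 < R 16" and D: "R 16 \<le> D"
  shows "\<exists>R'. exec M correlate R (D * 21 + 11) R' \<and>
    int (R' 38) - int (R' 39) = autocorr (R 16) (R 36) \<and> R' 37 = 2 * (R 16 div 2) \<and>
    (\<forall>x. x \<notin> {14, 27, 28, 29, 37, 38, 39, 40, 41, 42, 43, 44, 45} \<longrightarrow> R' x = R x)"
proof -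
  let ?p = "R 16" and ?v = "R 36"
  let ?W = "{14, 27, 28, 29, 37, 38, 39, 40, 41, 42, 43, 44, 45}"
  have "16 \<notin> {27, 28, 29::nat}" by simp
  from exec_halve[where M = M, OF reg this] obtain R2 where
    R2: "exec M (halve 16) R (5 * ?p + 4) R2" "R2 27 = ?p div 2"
    "\<And>x. x \<notin> {27, 28, 29} \<Longrightarrow> R2 x = R x" by blast
  let ?init = "Add_Reg 37 27 27 ;; Set_Const 38 0 ;; Set_Const 39 0 ;; Set_Const 40 0 ;; copy 41 36 ;; copy 14 16"
  let ?a = "Sub_Reg 42 27 40 ;; Sub_Reg 43 27 41 ;; Sub_Reg 44 37 40 ;; Sub_Reg 45 37 41"
  let ?b = "If_Nonzero 42
         (If_Nonzero 43 (incr 38) (If_Nonzero 45 (incr 39) skip))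
         (If_Nonzero 44 (If_Nonzero 43 (incr 39) (If_Nonzero 45 (incr 38) skip)) skip)"
  let ?c = "incr 40 ;; incr 41 ;; Sub_Reg 42 16 41 ;; If_Nonzero 42 skip (Set_Const 41 0)"
  let ?body = "?a ;; ?b ;; ?c"
  let ?R3 = "sem M ?init R2"
  let ?f = "\<lambda>u. halves ?p u * halves ?p ((u + ?v) mod ?p)"
  let ?I = "\<lambda>j R'. R' 40 = j \<and> R' 41 = (j + ?v) mod ?p \<and> int (R' 38) - int (R' 39) = (\<Sum>u<j. ?f u) \<and>
    R' 27 = ?p div 2 \<and> R' 37 = 2 * (?p div 2) \<and> (\<forall>x. x \<notin> ?W \<longrightarrow> R' x = R x)"
  have r3: "exec M ?init R2 6 ?R3" by (rule exec_straight) simp_all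
  have "\<exists>R'. exec M (loop 14 6 ?body) ?R3 (?p * (14 + 2) + 1) R' \<and> ?I ?p R' \<and> R' 14 = 0 \<and> R' 6 = 1"
  proof (rule exec_loop[where I = ?I])
    fix j R' assume j: "j < ?p" and I: "?I j R'" and one: "R' 6 = 1"
    have I': "R' 40 = j" "R' 41 = (j + ?v) mod ?p" "int (R' 38) - int (R' 39) = (\<Sum>u<j. ?f u)"
      "R' 27 = ?p div 2" "R' 37 = 2 * (?p div 2)"
      and keep: "\<And>x. x \<notin> ?W \<Longrightarrow> R' x = R x" using I by blast+
    define R4 where "R4 = sem M ?a R'"
    have ea: "exec M ?a R' 4 R4" unfolding R4_def by (rule exec_straight) simp_all
    have R4: "R4 42 = ?p div 2 - j" "R4 43 = ?p div 2 - (j + ?v) mod ?p" "R4 44 = 2 * (?p div 2) - j"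
      "R4 45 = 2 * (?p div 2) - (j + ?v) mod ?p" "R4 6 = 1" "R4 7 = 0"
      using I' one keep reg by (simp_all add: R4_def)
    have keep4: "R4 x = R' x" if "x \<notin> {42, 43, 44, 45}" for x using that by (simp add: R4_def)
    define R5 where "R5 = sem M ?b R4"
    have eb: "exec M ?b R4 5 R5" unfolding R5_def by (rule exec_straight) simp_all
    have keep5: "R5 x = R' x" if "x \<notin> {38, 39, 42, 43, 44, 45}" for x
      using that keep4 R4(6) keep4[of 7] by (simp add: R5_def)
    have "int (R5 38) - int (R5 39) = int (R4 38) - int (R4 39) + ?f j"
      using R4 by (simp add: R5_def halves_def)
    then have s: "int (R5 38) - int (R5 39) = (\<Sum>u<Suc j. ?f u)"
      using I'(3) keep4 by simp
    define R6 where "R6 = sem M ?c R5"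
    have ec: "exec M ?c R5 5 R6" unfolding R6_def by (rule exec_straight) simp_all
    have R5: "R5 40 = j" "R5 41 = (j + ?v) mod ?p" "R5 16 = ?p" "R5 6 = 1" "R5 7 = 0"
      using keep5 I' keep one reg by simp_all
    have "(j + ?v) mod ?p < ?p" using v by simp
    then have "R6 41 = (Suc j + ?v) mod ?p"
      using R5 by (auto simp: R6_def mod_Suc)
    moreover have "R6 40 = Suc j" "R6 27 = ?p div 2" "R6 37 = 2 * (?p div 2)" "R6 14 = R' 14" "R6 6 = 1"
      "R6 38 = R5 38" "R6 39 = R5 39"
      using R5 I' keep5 by (simp_all add: R6_def)
    moreover have "R6 x = R x" if "x \<notin> ?W" for x
      using keep5 keep reg R5(5) that by (simp add: R6_def)
    moreover have "exec M ?body R' 14 R6"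
      using exec_Seq[OF ea exec_Seq[OF eb ec]] by (rule exec_mono) simp
    ultimately show "\<exists>R''. exec M ?body R' 14 R'' \<and> R'' 14 = R' 14 \<and> R'' 6 = 1 \<and>
        ?I (Suc j) (R''(14 := R' 14 - 1))"
      using s by (intro exI[of _ R6]) (simp del: sum.lessThan_Suc)
  next
    show "?I 0 ?R3" using R2 reg v by auto
  qed (use R2 reg in auto)
  then obtain R6 where R6: "exec M (loop 14 6 ?body) ?R3 (?p * (14 + 2) + 1) R6" "?I ?p R6"
    by blast
  have "exec M correlate R (D * 21 + 11) R6"
    unfolding correlate_def
    by (rule exec_mono[OF exec_Seq[OF R2(1) exec_Seq[OF r3 R6(1)]]]) (use D in simp)
  moreover have "int (R6 38) - int (R6 39) = autocorr ?p ?v" "R6 37 = 2 * (?p div 2)"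
    "\<forall>x. x \<notin> ?W \<longrightarrow> R6 x = R x"
    using R6(2) unfolding autocorr_def by blast+
  ultimately show ?thesis by (intro exI[of _ R6] conjI)
qed

text \<open>After \<open>E\<close> rounds this is the least \<open>e\<close> with \<open>E \<le> 2 ^ (k * e)\<close>, so that \<open>2 ^ e\<close> is the
  \<open>k\<close>-th root of \<open>E\<close> up to a factor \<open>2\<close>.\<close>

primrec root_exp :: "nat \<Rightarrow> nat \<Rightarrow> nat \<Rightarrow> nat" where
  "root_exp E k 0 = 0"
| "root_exp E k (Suc j) = (if 2 ^ (k * root_exp E k j) < E then Suc (root_exp E k j) else root_exp E k j)"

definition find_root :: program where
  "find_root = (Set_Const 46 1 ;; Set_Const 47 1 ;; copy 14 3) ;;
     loop 14 6 ((Sub_Reg 42 3 47 ;; If_Nonzero 42 (Add_Reg 46 46 46 ;; copy 48 1) (Set_Const 48 0)) ;;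
       loop 48 6 (Add_Reg 47 47 47))"

lemma exec_find_root:
  assumes reg: "R 6 = 1" "R 7 = 0" and D: "R 1 \<le> D" "R 3 \<le> D"
  shows "\<exists>R'. exec M find_root R (D * (D * 3 + 7) + 4) R' \<and> R' 46 = 2 ^ root_exp (R 3) (R 1) (R 3) \<and>
    (\<forall>x. x \<notin> {14, 42, 46, 47, 48} \<longrightarrow> R' x = R x)"
proof -
  let ?k = "R 1" and ?E = "R 3" and ?W = "{14, 42, 46, 47, 48}"
  let ?init = "Set_Const 46 1 ;; Set_Const 47 1 ;; copy 14 3"
  let ?a = "Sub_Reg 42 3 47 ;; If_Nonzero 42 (Add_Reg 46 46 46 ;; copy 48 1) (Set_Const 48 0)"
  let ?body = "?a ;; loop 48 6 (Add_Reg 47 47 47)"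
  let ?R1 = "sem M ?init R"
  let ?I = "\<lambda>j R'. R' 46 = 2 ^ root_exp ?E ?k j \<and> R' 47 = 2 ^ (?k * root_exp ?E ?k j) \<and>
    (\<forall>x. x \<notin> ?W \<longrightarrow> R' x = R x)"
  have init: "exec M ?init R 3 ?R1" by (rule exec_straight) simp_all
  have "\<exists>R'. exec M (loop 14 6 ?body) ?R1 (?E * ((D * 3 + 5) + 2) + 1) R' \<and> ?I ?E R' \<and> R' 14 = 0 \<and> R' 6 = 1"
  proof (rule exec_loop[where I = ?I])
    fix j R' assume I: "?I j R'" and one: "R' 6 = 1"
    have I': "R' 46 = 2 ^ root_exp ?E ?k j" "R' 47 = 2 ^ (?k * root_exp ?E ?k j)"
      and keep: "\<And>x. x \<notin> ?W \<Longrightarrow> R' x = R x" using I by blast+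
    define N where "N = (if R' 47 < ?E then ?k else 0)"
    have ND: "N \<le> D" using D by (simp add: N_def)
    let ?R2 = "sem M ?a R'"
    have ra: "exec M ?a R' 4 ?R2" by (rule exec_straight) simp_all
    have R2: "?R2 48 = N" "?R2 46 = 2 ^ root_exp ?E ?k (Suc j)" "?R2 47 = R' 47"
      using keep reg I' by (auto simp: N_def)
    have keep2: "?R2 x = R' x" if "x \<notin> {42, 46, 48}" for x using that by auto
    let ?J = "\<lambda>l R'. R' 47 = ?R2 47 * 2 ^ l \<and> (\<forall>x. x \<notin> {47, 48} \<longrightarrow> R' x = ?R2 x)"
    have "\<exists>R'. exec M (loop 48 6 (Add_Reg 47 47 47)) ?R2 (N * (1 + 2) + 1) R' \<and> ?J N R' \<and> R' 48 = 0 \<and> R' 6 = 1"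
    proof (rule exec_loop[where I = ?J])
      fix l R'' assume J: "?J l R''" and one': "R'' 6 = 1"
      have ex: "exec M (Add_Reg 47 47 47) R'' 1 (sem M (Add_Reg 47 47 47) R'')"
        by (rule exec_straight) simp_all
      have "?J (Suc l) ((sem M (Add_Reg 47 47 47) R'')(48 := R'' 48 - 1))"
        using J by simp
      with ex one' show "\<exists>R3. exec M (Add_Reg 47 47 47) R'' 1 R3 \<and> R3 48 = R'' 48 \<and> R3 6 = 1 \<and>
        ?J (Suc l) (R3(48 := R'' 48 - 1))"
        by (intro exI[of _ "sem M (Add_Reg 47 47 47) R''"] conjI) simp_all
    qed (use R2 one keep2 in \<open>simp_all del: sem.simps\<close>)
    then obtain R3 where R3: "exec M (loop 48 6 (Add_Reg 47 47 47)) ?R2 (N * (1 + 2) + 1) R3" "?J N R3" "R3 6 = 1"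
      by blast
    have R347: "R3 47 = ?R2 47 * 2 ^ N" and keep3: "\<And>x. x \<notin> {47, 48} \<Longrightarrow> R3 x = ?R2 x"
      using R3(2) by blast+
    have "exec M ?body R' (D * 3 + 5) R3"
      using exec_Seq[OF ra R3(1)] by (rule exec_mono) (use ND in simp)
    moreover have "R3 47 = 2 ^ (?k * root_exp ?E ?k (Suc j))"
      unfolding R347 R2(3) using I'(2) by (simp add: N_def power_add)
    moreover have "R3 46 = 2 ^ root_exp ?E ?k (Suc j)" "R3 14 = R' 14"
      using keep3[of 46] keep3[of 14] R2(2) keep2[of 14] by (simp_all del: sem.simps)
    moreover have "R3 x = R x" if "x \<notin> ?W" for x
      using keep3[of x] keep2[of x] keep[of x] that by (simp del: sem.simps)
    ultimately show "\<exists>R''. exec M ?body R' (D * 3 + 5) R'' \<and> R'' 14 = R' 14 \<and> R'' 6 = 1 \<and>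
        ?I (Suc j) (R''(14 := R' 14 - 1))"
      using R3(3) by (intro exI[of _ R3]) (simp del: root_exp.simps)
  qed (use reg in auto)
  then obtain R4 where R4: "exec M (loop 14 6 ?body) ?R1 (?E * ((D * 3 + 5) + 2) + 1) R4" "?I ?E R4" by blast
  have le: "?E * ((D * 3 + 5) + 2) \<le> D * ((D * 3 + 5) + 2)" using D by (intro mult_le_mono) auto
  have "exec M find_root R (D * (D * 3 + 7) + 4) R4"
    unfolding find_root_def
    by (rule exec_mono[OF exec_Seq[OF init R4(1)]]) (use le in \<open>simp add: algebra_simps\<close>)
  with R4(2) show ?thesis by blast
qed

definition multiply :: "nat \<Rightarrow> nat \<Rightarrow> nat \<Rightarrow> program" where
  "multiply r a b = (Set_Const r 0 ;; copy 14 a) ;; loop 14 6 (Add_Reg r r b)"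

lemma exec_multiply:
  assumes reg: "R 6 = 1" "R 7 = 0" and D: "R a \<le> D" and dist: "distinct [r, b, 14, 6, 7]" "distinct [r, a, 14, 6, 7]"
  shows "\<exists>R'. exec M (multiply r a b) R (D * 3 + 3) R' \<and> R' r = R a * R b \<and>
    (\<forall>x. x \<notin> {r, 14} \<longrightarrow> R' x = R x)"
proof -
  let ?init = "Set_Const r 0 ;; copy 14 a" and ?body = "Add_Reg r r b"
  let ?R1 = "sem M ?init R"
  let ?I = "\<lambda>j R'. R' r = j * R b \<and> (\<forall>x. x \<notin> {r, 14} \<longrightarrow> R' x = R x)"
  have init: "exec M ?init R 2 ?R1" by (rule exec_straight) simp_all
  have "\<exists>R'. exec M (loop 14 6 ?body) ?R1 (R a * (1 + 2) + 1) R' \<and> ?I (R a) R' \<and> R' 14 = 0 \<and> R' 6 = 1"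
  proof (rule exec_loop[where I = ?I])
    fix j R' assume I: "?I j R'" and one: "R' 6 = 1"
    have "exec M ?body R' 1 (sem M ?body R')" by (rule exec_straight) simp_all
    with I one dist show "\<exists>R''. exec M ?body R' 1 R'' \<and> R'' 14 = R' 14 \<and> R'' 6 = 1 \<and>
        ?I (Suc j) (R''(14 := R' 14 - 1))"
      by (intro exI[of _ "sem M ?body R'"]) auto
  qed (use dist reg in auto)
  then obtain R' where R': "exec M (loop 14 6 ?body) ?R1 (R a * (1 + 2) + 1) R'" "?I (R a) R'" by blast
  have "exec M (multiply r a b) R (D * 3 + 3) R'"
    unfolding multiply_def by (rule exec_mono[OF exec_Seq[OF init R'(1)]]) (use D in simp)
  with R'(2) show ?thesis by blast
qed

section \<open>The generator\<close>

lemma bits_value_less: "(\<And>j. M j \<le> 1) \<Longrightarrow> bits_value M a m < 2 ^ m"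
proof (induction m)
  case (Suc m)
  then have "bits_value M a m < 2 ^ m" "M (a + m) \<le> 1" by auto
  then show ?case by simp
qed simp

lemma bits_value_inj:
  assumes "\<And>j. M j \<le> 1" "\<And>j. M' j \<le> 1" "bits_value M a m = bits_value M' a m" "j < m"
  shows "M (a + j) = M' (a + j)"
  using assms(3,4)
proof (induction m)
  case (Suc m)
  have "M (a + m) \<le> 1" "M' (a + m) \<le> 1" using assms by auto
  with Suc.prems(1) have "bits_value M a m = bits_value M' a m \<and> M (a + m) = M' (a + m)"
    by (simp; presburger)
  with Suc show ?case by (cases "j = m") auto
qed simp

text \<open>As long as \<open>E\<close> is not reached the exponent grows in every round, so after
  \<open>E\<close> rounds it is reached or the exponent is at least \<open>E\<close>, which is more
  than enough. An increment happens only below \<open>E\<close> and multiplies by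
  \<open>2 ^ k\<close>.\<close>

lemma root_exp_props:
  assumes k: "0 < k" and E: "0 < E"
  shows "E \<le> 2 ^ (k * root_exp E k E)"
    and "2 ^ (k * root_exp E k j) < 2 ^ k * E"
proof -
  have "root_exp E k j \<ge> j \<or> E \<le> 2 ^ (k * root_exp E k j)" for j
  proof (induction j)
    case (Suc j)
    then show ?case by auto
  qed simp
  from this[of E] show "E \<le> 2 ^ (k * root_exp E k E)"
  proof
    assume "E \<le> root_exp E k E"
    also have "\<dots> \<le> k * root_exp E k E" using k by simp
    also have "\<dots> < 2 ^ (k * root_exp E k E)" by (rule less_exp)
    finally show ?thesis by simp
  qed
  show "2 ^ (k * root_exp E k j) < 2 ^ k * E"
  proof (induction j)
    case 0
    have "1 < (2::nat) ^ k" using k by (intro one_less_power) auto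
    also have "\<dots> \<le> 2 ^ k * E" using E by simp
    finally show ?case by simp
  next
    case (Suc j)
    then show ?case by (simp add: power_add)
  qed
qed

text \<open>Register 51 collects the denominator: the scale, built from \<open>2 ^ e\<close> and
  \<lceil>b\<rceil>, times the denominator of \<open>wave\<close>.\<close>

definition generator_program :: program where
  "generator_program = prologue ;; read_bits 10 ;; read_bits 11 ;; read_bits 12 ;; find_prime ;;
     hash_index ;; find_sample ;; correlate ;; find_root ;;
     (Add_Reg 49 46 46 ;; Add_Reg 49 49 49) ;; multiply 50 49 2 ;; multiply 51 50 37 ;;
     (copy 0 38 ;; copy 1 39 ;; copy 2 51)"

definition generator_time :: "nat \<Rightarrow> nat" where
  "generator_time D = (D * 5 + 7) + ((D * 6 + 3) + ((D * 6 + 3) + ((D * 6 + 3) +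
     ((D * (D * (6 * D + 8) + 10) + 4) + ((D * (D * (6 * D + 4) + 11 * D + 15) + 5) +
     ((D * (D * (6 * D + 4) + 11) + D * (6 * D + 4) + 12 * D + 13) + ((D * 21 + 11) +
     ((D * (D * 3 + 7) + 4) + (2 + ((D * 3 + 3) + ((D * 3 + 3) + 3)))))))))))"

text \<open>Every monomial is at most \<open>D ^ 3\<close>, and the coefficients add up to less than
  500.\<close>

lemma generator_time_le: "1 \<le> D \<Longrightarrow> generator_time D \<le> 500 * D ^ 3"
proof -
  assume "1 \<le> D"
  then obtain e where "D = Suc e" by (cases D) auto
  then show ?thesis
    by (simp add: generator_time_def power3_eq_cube algebra_simps)
qed

text \<open>The assumptions on \<open>D\<close> cover everything that controls a loop: seed numbers,
  search range, \<open>k\<close>, \<open>E\<close>, \<open>i\<close> and the left factors of the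
  final multiplications. The resulting denominator itself may exceed \<open>D\<close>.\<close>

lemma exec_generator_program:
  assumes R: "R 5 = 6 * u" "R 7 = 0" and M: "\<And>j. M j \<le> 1"
    and p: "p = largest_prime (2 ^ u)" "prime p"
    and D: "2 ^ (2 * u) \<le> D" "R 1 \<le> D" "R 3 \<le> D" "R 4 \<le> D"
      "4 * 2 ^ root_exp (R 3) (R 1) (R 3) \<le> D" "4 * 2 ^ root_exp (R 3) (R 1) (R 3) * R 2 \<le> D"
  defines "v \<equiv> sample p (bits_value M 0 (2 * u)) (bits_value M (2 * u) (2 * u))
      (bits_value M (4 * u) (2 * u)) (R 4)"
  shows "\<exists>R'. exec M generator_program R (generator_time D) R' \<and>
    int (R' 0) - int (R' 1) = autocorr p v \<and>
    R' 2 = 4 * 2 ^ root_exp (R 3) (R 1) (R 3) * R 2 * (2 * (p div 2))"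
proof -
  have uD: "2 * u \<le> D" "u \<le> D" "2 ^ u \<le> D"
  proof -
    have "2 * u < 2 ^ (2 * u)" by (rule less_exp)
    then show "2 * u \<le> D" "u \<le> D" using D(1) by linarith+
    have "(2::nat) ^ u \<le> 2 ^ (2 * u)" by (rule power_increasing) auto
    then show "2 ^ u \<le> D" using D(1) by linarith
  qed
  have bD: "bits_value M a (2 * u) \<le> D" for a
    using bits_value_less[of M a "2 * u"] M D(1) by (meson less_imp_le order.trans)
  obtain R1 where R1: "exec M prologue R (D * 5 + 7) R1" "R1 6 = 1" "R1 7 = 0" "R1 8 = 2 ^ u"
    "R1 9 = 2 * u" "R1 13 = 0" "\<And>x. x \<notin> {5, 6, 7, 8, 9, 13, 15} \<Longrightarrow> R1 x = R x"
    using exec_prologue[where M = M and R = R and u = u and D = D, OF R(1) uD(2)] by blast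
  have "10 \<notin> {6, 7, 9, 13, 14, 15::nat}" and "R1 9 \<le> D" using R1 uD by simp_all
  from exec_read_bits[where M = M, OF R1(2,3) this] obtain R2 where
    R2: "exec M (read_bits 10) R1 (D * 6 + 3) R2" "R2 10 = bits_value M (R1 13) (R1 9)"
    "R2 13 = R1 13 + R1 9" "\<And>x. x \<notin> {10, 13, 14, 15} \<Longrightarrow> R2 x = R1 x" by blast
  have "R2 6 = 1" "R2 7 = 0" "11 \<notin> {6, 7, 9, 13, 14, 15::nat}" and "R2 9 \<le> D"
    using R1 R2(4) uD by simp_all
  from exec_read_bits[where M = M, OF this] obtain R3 where
    R3: "exec M (read_bits 11) R2 (D * 6 + 3) R3" "R3 11 = bits_value M (R2 13) (R2 9)"
    "R3 13 = R2 13 + R2 9" "\<And>x. x \<notin> {11, 13, 14, 15} \<Longrightarrow> R3 x = R2 x" by blast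
  have "R3 6 = 1" "R3 7 = 0" "12 \<notin> {6, 7, 9, 13, 14, 15::nat}" and "R3 9 \<le> D"
    using R1 R2(4) R3(4) uD by simp_all
  from exec_read_bits[where M = M, OF this] obtain R4 where
    R4: "exec M (read_bits 12) R3 (D * 6 + 3) R4" "R4 12 = bits_value M (R3 13) (R3 9)"
    "\<And>x. x \<notin> {12, 13, 14, 15} \<Longrightarrow> R4 x = R3 x" by blast
  have z: "R4 10 = bits_value M 0 (2 * u)" "R4 11 = bits_value M (2 * u) (2 * u)"
      "R4 12 = bits_value M (4 * u) (2 * u)"
    using R1 R2(2-4) R3(2-4) R4(2,3) by simp_all
  have keep4: "R4 x = R1 x" if "x \<notin> {10, 11, 12, 13, 14, 15}" for x
    using R2(4) R3(4) R4(3) that by simp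
  have "R4 6 = 1" "R4 7 = 0" "1 \<le> R4 8" "R4 8 \<le> D" using keep4 R1 uD by simp_all
  from exec_find_prime[where M = M, OF this] obtain R5 where
    R5: "exec M find_prime R4 (D * (D * (6 * D + 8) + 10) + 4) R5" "R5 16 = largest_prime (R4 8)"
    "\<And>x. x \<notin> {14, 16, 17, 18, 19, 20, 21, 22, 23} \<Longrightarrow> R5 x = R4 x" by blast
  have R5p: "R5 16 = p" using R5(2) keep4[of 8] R1(4) p(1) by simp
  have pD: "p \<le> D" using largest_prime_le[of "2 ^ u"] uD(3) p(1) by linarith
  have p1: "1 < p" using prime_gt_1_nat[OF p(2)] .
  have keep5: "R5 x = R x" if "x \<in> {1, 2, 3, 4}" for x
    using R5(3) keep4 R1(7) that by auto
  have "R5 6 = 1" "R5 7 = 0" "1 < R5 16" "R5 16 \<le> D" "R5 4 \<le> D" "R5 10 \<le> D"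
    using R5(3) keep4 R1 R5p p1 pD keep5 D z bD by simp_all
  from exec_hash_index[where M = M, OF this] obtain R6 where
    R6: "exec M hash_index R5 (D * (D * (6 * D + 4) + 11 * D + 15) + 5) R6"
    "R6 24 = hash (R5 16) (R5 10) (R5 4)"
    "\<And>x. x \<notin> {14, 20, 22, 23, 24, 25, 26, 27, 28, 29, 30} \<Longrightarrow> R6 x = R5 x" by blast
  have keep6: "R6 x = R x" if "x \<in> {1, 2, 3, 4}" for x
    using R6(3) keep5 that by auto
  have z6: "R6 10 = R4 10" "R6 11 = R4 11" "R6 12 = R4 12" "R6 16 = p"
    using R6(3) R5(3) R5p by simp_all
  have "R6 6 = 1" "R6 7 = 0" "prime (R6 16)" "R6 24 = hash (R6 16) (R6 10) (R 4)" "R6 16 \<le> D" "R6 11 \<le> D" "R6 12 \<le> D"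
    using R6(2,3) R5(3) keep4 R1 z6 p pD keep5 z bD R5p by simp_all
  from exec_find_sample[where M = M, OF this] obtain R7 where
    R7: "exec M find_sample R6 (D * (D * (6 * D + 4) + 11) + D * (6 * D + 4) + 12 * D + 13) R7"
    "R7 36 = sample (R6 16) (R6 10) (R6 11) (R6 12) (R 4)"
    "\<And>x. x \<notin> {14, 20, 22, 23, 30, 31, 32, 33, 34, 35, 36} \<Longrightarrow> R7 x = R6 x" by blast
  have v: "R7 36 = v" using R7(2) z6 z by (simp add: v_def)
  have "v < p" using p1 by (simp add: v_def sample_def)
  then have "R7 6 = 1" "R7 7 = 0" "R7 36 < R7 16" "R7 16 \<le> D"
    using R7(3) R6(3) R5(3) keep4 R1 z6 pD v by simp_all
  from exec_correlate[where M = M, OF this] obtain R8 where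
    R8: "exec M correlate R7 (D * 21 + 11) R8"
    "int (R8 38) - int (R8 39) = autocorr (R7 16) (R7 36)" "R8 37 = 2 * (R7 16 div 2)"
    "\<And>x. x \<notin> {14, 27, 28, 29, 37, 38, 39, 40, 41, 42, 43, 44, 45} \<Longrightarrow> R8 x = R7 x" by blast
  have corr: "int (R8 38) - int (R8 39) = autocorr p v" "R8 37 = 2 * (p div 2)"
    using R8(2,3) v R7(3)[of 16] z6 by simp_all
  have keep8: "R8 x = R x" if "x \<in> {1, 2, 3, 4}" for x
    using R8(4) R7(3) keep6 that by auto
  have "R8 6 = 1" "R8 7 = 0" "R8 1 \<le> D" "R8 3 \<le> D"
    using R8(4) R7(3) R6(3) R5(3) keep4 R1 keep8 D by simp_all
  from exec_find_root[where M = M, OF this] obtain R9 where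
    R9: "exec M find_root R8 (D * (D * 3 + 7) + 4) R9" "R9 46 = 2 ^ root_exp (R8 3) (R8 1) (R8 3)"
    "\<And>x. x \<notin> {14, 42, 46, 47, 48} \<Longrightarrow> R9 x = R8 x" by blast
  let ?a = "Add_Reg 49 46 46 ;; Add_Reg 49 49 49"
  let ?b = "copy 0 38 ;; copy 1 39 ;; copy 2 51"
  let ?e = "4 * 2 ^ root_exp (R 3) (R 1) (R 3)"
  let ?R10 = "sem M ?a R9"
  have R10: "exec M ?a R9 2 ?R10" by (rule exec_straight) simp_all
  have R10': "?R10 49 = ?e" "?R10 6 = 1" "?R10 7 = 0" "?R10 2 = R 2" "?R10 37 = 2 * (p div 2)"
    "?R10 38 = R8 38" "?R10 39 = R8 39"
    using R9(2,3) R8(4) R7(3) R6(3) R5(3) keep4 R1 keep8 corr by simp_all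
  have "?R10 49 \<le> D" "distinct [50, 2, 14, 6, 7::nat]" "distinct [50, 49, 14, 6, 7::nat]"
    unfolding R10'(1) using D(5) by simp_all
  from exec_multiply[where M = M, OF R10'(2,3) this] obtain R11 where
    R11: "exec M (multiply 50 49 2) ?R10 (D * 3 + 3) R11" "R11 50 = ?R10 49 * ?R10 2"
    "\<And>x. x \<notin> {50, 14} \<Longrightarrow> R11 x = ?R10 x" by blast
  have R11': "R11 50 = ?e * R 2" unfolding R11(2) R10' ..
  have "R11 6 = 1" "R11 7 = 0" "R11 50 \<le> D" "distinct [51, 37, 14, 6, 7::nat]" "distinct [51, 50, 14, 6, 7::nat]"
    using R11(3)[of 6] R11(3)[of 7] R10' R11' D(6) by (simp_all del: sem.simps)
  from exec_multiply[where M = M, OF this] obtain R12 where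
    R12: "exec M (multiply 51 50 37) R11 (D * 3 + 3) R12" "R12 51 = R11 50 * R11 37"
    "\<And>x. x \<notin> {51, 14} \<Longrightarrow> R12 x = R11 x" by blast
  let ?R13 = "sem M ?b R12"
  have R13: "exec M ?b R12 3 ?R13" by (rule exec_straight) simp_all
  have R12': "R12 51 = ?e * R 2 * (2 * (p div 2))" "R12 38 = R8 38" "R12 39 = R8 39" "R12 7 = 0"
    using R12(2,3) R11(3) R11' R10' by (simp_all del: sem.simps)
  have "exec M generator_program R (generator_time D) ?R13"
    unfolding generator_program_def generator_time_def
    by (rule exec_Seq[OF R1(1) exec_Seq[OF R2(1) exec_Seq[OF R3(1) exec_Seq[OF R4(1)
        exec_Seq[OF R5(1) exec_Seq[OF R6(1) exec_Seq[OF R7(1) exec_Seq[OF R8(1)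
        exec_Seq[OF R9(1) exec_Seq[OF R10 exec_Seq[OF R11(1) exec_Seq[OF R12(1) R13]]]]]]]]]]]])
  moreover have "?R13 0 = R8 38" "?R13 1 = R8 39" "?R13 2 = ?e * R 2 * (2 * (p div 2))"
    using R12' by simp_all
  ultimately show ?thesis using corr by (intro exI[of _ ?R13]) (simp del: sem.simps)
qed

section \<open>Choice of the parameters\<close>

text \<open>Number of binary digits of the indices below \<open>n\<close>, kept positive for
  \<open>n \<le> 1\<close> by \<open>max 2 n\<close>.\<close>

definition width :: "nat \<Rightarrow> nat" where
  "width n = nat \<lceil>log 2 (real (max 2 n))\<rceil>"

definition inv_error :: "real \<Rightarrow> nat" where
  "inv_error \<epsilon> = nat \<lceil>1 / \<epsilon>\<rceil>"

text \<open>The errors in \<open>almost_independent\<close> add up to at most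
  \<open>7 * k\<^sup>2 * width n / p\<close>. The factor 12 covers 7 and also gives
  \<open>p \<ge> 12 * 9 > 64\<close> for \<open>k > 2\<close>, as the second moment needs.\<close>

definition prime_exp :: "nat \<Rightarrow> nat \<Rightarrow> real \<Rightarrow> nat" where
  "prime_exp n k \<epsilon> = nat \<lceil>log 2 (real (12 * k\<^sup>2 * width n * inv_error \<epsilon>))\<rceil>"

text \<open>There is a prime between \<open>2 ^ l\<close> and \<open>2 ^ (2 * l + 4)\<close>. The seed is cut into three numbers of
  \<open>2 * block\<close> bits: with at least twice as many bits as the modulus, their residues are nearly
  uniform.\<close>

definition block :: "nat \<Rightarrow> nat \<Rightarrow> real \<Rightarrow> nat" where
  "block n k \<epsilon> = 2 * prime_exp n k \<epsilon> + 4"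

definition seed_length :: "nat \<Rightarrow> nat \<Rightarrow> real \<Rightarrow> real \<Rightarrow> nat" where
  "seed_length n k b \<epsilon> = 6 * block n k \<epsilon>"

definition modulus :: "nat \<Rightarrow> nat \<Rightarrow> real \<Rightarrow> nat" where
  "modulus n k \<epsilon> = largest_prime (2 ^ block n k \<epsilon>)"

text \<open>A computable substitute for 4b / \<epsilon>^(1/k): the \<open>k\<close>-th root is
  rounded up to a power of 2 and \<open>b\<close> to an integer.\<close>

definition scale :: "nat \<Rightarrow> real \<Rightarrow> real \<Rightarrow> nat" where
  "scale k b \<epsilon> = 4 * 2 ^ root_exp (inv_error \<epsilon>) k (inv_error \<epsilon>) * nat \<lceil>b\<rceil>"

text \<open>The memory contents in \<open>initial_state\<close>.\<close>

definition seed_bits :: "nat \<Rightarrow> (nat \<Rightarrow> real) \<Rightarrow> nat \<Rightarrow> nat" where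
  "seed_bits s x = (\<lambda>j. if j < s \<and> x j = 1 then 1 else 0)"

definition seed_triple :: "nat \<Rightarrow> (nat \<Rightarrow> real) \<Rightarrow> nat \<times> nat \<times> nat" where
  "seed_triple u x = (let M = seed_bits (6 * u) x in
     (bits_value M 0 (2 * u), bits_value M (2 * u) (2 * u), bits_value M (4 * u) (2 * u)))"

definition generator :: "nat \<Rightarrow> nat \<Rightarrow> real \<Rightarrow> real \<Rightarrow> (nat \<Rightarrow> real) \<Rightarrow> nat \<Rightarrow> real" where
  "generator n k b \<epsilon> x i = 1 / real (scale k b \<epsilon>) *
     wave (modulus n k \<epsilon>) (case seed_triple (block n k \<epsilon>) x of (z\<^sub>1, z\<^sub>2, y) \<Rightarrow>
       sample (modulus n k \<epsilon>) z\<^sub>1 z\<^sub>2 y i)"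

lemma le_power_ceiling_log:
  assumes "0 < m"
  shows "m \<le> 2 ^ nat \<lceil>log 2 (real m)\<rceil>" "2 ^ nat \<lceil>log 2 (real m)\<rceil> \<le> 2 * m"
proof -
  define l where "l = nat \<lceil>log 2 (real m)\<rceil>"
  have pos: "0 \<le> log 2 (real m)" using assms by simp
  have "log 2 (real m) \<le> real l" unfolding l_def by linarith
  then have "2 powr log 2 (real m) \<le> 2 powr real l" by (intro powr_mono) auto
  then have "real m \<le> real (2 ^ l)" using assms by (simp add: powr_realpow)
  then show "m \<le> 2 ^ nat \<lceil>log 2 (real m)\<rceil>" by (simp only: of_nat_le_iff l_def)
  have "real l \<le> log 2 (real m) + 1" unfolding l_def using pos by linarith
  then have "2 powr real l \<le> 2 powr (log 2 (real m) + 1)" by (intro powr_mono) auto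
  then have "real (2 ^ l) \<le> real (2 * m)" using assms by (simp add: powr_realpow powr_add)
  then show "2 ^ nat \<lceil>log 2 (real m)\<rceil> \<le> 2 * m" by (simp only: of_nat_le_iff l_def)
qed

lemma width: "0 < width n" "n \<le> 2 ^ width n" "width n \<le> max 2 n"
proof -
  have "log 2 2 \<le> log 2 (real (max 2 n))" by (subst log_le_cancel_iff) auto
  then show "0 < width n" by (simp add: width_def)
  show "n \<le> 2 ^ width n" using le_power_ceiling_log(1)[of "max 2 n"] by (simp add: width_def)
  have "max 2 n < 2 ^ max 2 n" by (rule less_exp)
  then have "real (max 2 n) \<le> 2 powr real (max 2 n)"
    by (metis less_imp_le numeral_power_eq_of_nat_cancel_iff of_nat_le_iff of_nat_numeral of_nat_power powr_realpow zero_less_numeral)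
  then have "log 2 (real (max 2 n)) \<le> real (max 2 n)" by (subst log_le_iff) auto
  then show "width n \<le> max 2 n" unfolding width_def by linarith
qed

text \<open>Rounding up 1/\<epsilon> gives at least 1, so it automatically approximates the inverse
  of the capped error \<open>min 1 \<epsilon>\<close>.\<close>

lemma inv_error:
  assumes "0 < \<epsilon>"
  shows "1 / min 1 \<epsilon> \<le> real (inv_error \<epsilon>)" "real (inv_error \<epsilon>) \<le> 2 / min 1 \<epsilon>" "0 < inv_error \<epsilon>"
proof -
  have pos: "0 < 1 / \<epsilon>" using assms by simp
  then show E0: "0 < inv_error \<epsilon>" by (simp add: inv_error_def)
  have ge: "1 / \<epsilon> \<le> real (inv_error \<epsilon>)" unfolding inv_error_def by linarith
  have "1 / min 1 \<epsilon> = max 1 (1 / \<epsilon>)" using assms by (simp add: min_def max_def field_simps)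
  then show "1 / min 1 \<epsilon> \<le> real (inv_error \<epsilon>)" using ge E0 by simp
  show "real (inv_error \<epsilon>) \<le> 2 / min 1 \<epsilon>"
  proof (cases "\<epsilon> < 1")
    case True
    have "real (inv_error \<epsilon>) \<le> 1 / \<epsilon> + 1" unfolding inv_error_def using pos by linarith
    also have "\<dots> \<le> 2 / min 1 \<epsilon>" using True assms by (simp add: field_simps)
    finally show ?thesis .
  next
    case False
    then have "1 / \<epsilon> \<le> 1" by (simp add: field_simps)
    then have "inv_error \<epsilon> \<le> 1" unfolding inv_error_def by linarith
    with False show ?thesis by simp
  qed
qed

text \<open>\<open>prime_in_interval\<close> guarantees a prime of the required size up to
  \<open>2 ^ block n k \<epsilon>\<close>, and the largest prime in that range can only be
  bigger.\<close>

lemma modulus: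
  assumes "0 < k" "0 < \<epsilon>"
  shows "prime (modulus n k \<epsilon>)" "12 * k\<^sup>2 * width n * inv_error \<epsilon> \<le> modulus n k \<epsilon>"
    "modulus n k \<epsilon> \<le> 2 ^ block n k \<epsilon>"
proof -
  let ?m = "12 * k\<^sup>2 * width n * inv_error \<epsilon>"
  have "0 < ?m" using assms width(1) inv_error(3) by simp
  from le_power_ceiling_log(1)[OF this] have m: "?m \<le> 2 ^ prime_exp n k \<epsilon>" by (simp add: prime_exp_def)
  obtain p :: nat where p: "prime p" "2 ^ prime_exp n k \<epsilon> \<le> p" "p \<le> 2 ^ block n k \<epsilon>"
    using prime_in_interval unfolding block_def by blast
  from largest_prime_ge[OF p(1,3)] m p(2)
  show "prime (modulus n k \<epsilon>)" "?m \<le> modulus n k \<epsilon>" unfolding modulus_def by linarith+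
  show "modulus n k \<epsilon> \<le> 2 ^ block n k \<epsilon>" unfolding modulus_def by (rule largest_prime_le)
qed

text \<open>The last increment started below \<open>E\<close>, so already
  \<open>2 ^ (e - 1) < E\<close>. This keeps the loop counts in \<open>multiply\<close>
  polynomial.\<close>

lemma power_root_exp_less:
  assumes "0 < k" "0 < E"
  shows "2 ^ root_exp E k E \<le> 2 * E"
proof (cases "root_exp E k E")
  case 0
  then show ?thesis using assms by simp
next
  case (Suc e)
  have "(2::nat) ^ (k * Suc e) < 2 ^ k * E" using root_exp_props(2)[OF assms, of E] Suc by simp
  then have "2 ^ (k * e) < E" by (simp add: power_add)
  moreover have "(2::nat) ^ e \<le> 2 ^ (k * e)" using assms by (intro power_increasing) auto
  ultimately have "(2::nat) ^ e \<le> E" by linarith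
  then show ?thesis using Suc by simp
qed

lemma explicit_generator: "explicit_generator seed_length generator"
proof -
  \<comment> \<open>Here \<open>2 ^ prime_exp n k \<epsilon> \<le> 2 * 12 * X ^ 4\<close>, and
    \<open>2 * block n k \<epsilon>\<close> is four times that exponent plus 8, whence
    \<open>256 * 24 ^ 4 * X ^ 16\<close>. The rest of \<open>D\<close> is at most
    \<open>11 * X ^ 16\<close>. Cubing \<open>X ^ 16\<close> for the running time gives the exponent
    48.\<close>
  define c :: nat where "c = 256 * 24 ^ 4 + 18"
  show ?thesis
    unfolding explicit_generator_def
  proof (rule exI[of _ generator_program], rule exI[of _ "500 * c ^ 3"], rule exI[of _ 48], intro allI impI ballI)
    fix n k :: nat and b \<epsilon> :: real and x i
    assume k: "2 < k" and b: "1 \<le> b" and \<epsilon>: "0 < \<epsilon>" and i: "i < n"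
    let ?s = "seed_length n k b \<epsilon>" and ?u = "block n k \<epsilon>" and ?E = "inv_error \<epsilon>" and ?p = "modulus n k \<epsilon>"
    let ?B = "nat \<lceil>b\<rceil>"
    define X where "X = n + k + ?B + ?E"
    define D where "D = 2 ^ (2 * ?u) + n + k + ?E + 8 * ?E * ?B"
    let ?R = "\<lambda>r. if r < 6 then [n, k, ?B, nat \<lceil>1 / \<epsilon>\<rceil>, i, ?s] ! r else 0"
    let ?M = "seed_bits ?s x"
    have E0: "0 < ?E" using inv_error(3)[OF \<epsilon>] .
    have B0: "0 < ?B" using b by linarith
    have R: "?R 1 = k" "?R 2 = ?B" "?R 3 = ?E" "?R 4 = i" "?R 5 = 6 * ?u" "?R 7 = 0"
      by (simp_all add: inv_error_def seed_length_def eval_nat_numeral)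
    have e: "2 ^ root_exp ?E k ?E \<le> 2 * ?E" using power_root_exp_less k E0 by simp
    then have e1: "4 * 2 ^ root_exp ?E k ?E \<le> 8 * ?E" by simp
    then have e2: "4 * 2 ^ root_exp ?E k ?E * ?B \<le> 8 * ?E * ?B" by (rule mult_le_mono1)
    have e3: "8 * ?E * 1 \<le> 8 * ?E * ?B" by (rule mult_le_mono2) (use B0 in linarith)
    have D': "2 ^ (2 * ?u) \<le> D" "k \<le> D" "?E \<le> D" "i \<le> D" "4 * 2 ^ root_exp ?E k ?E \<le> D"
      "4 * 2 ^ root_exp ?E k ?E * ?B \<le> D"
      using e1 e2 e3 i unfolding D_def by linarith+
    have M: "?M j \<le> 1" for j by (simp add: seed_bits_def)
    have p: "?p = largest_prime (2 ^ ?u)" "prime ?p" using modulus(1) k \<epsilon> by (simp_all add: modulus_def)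
    let ?v = "sample ?p (bits_value ?M 0 (2 * ?u)) (bits_value ?M (2 * ?u) (2 * ?u))
      (bits_value ?M (4 * ?u) (2 * ?u)) i"
    from exec_generator_program[where M = "?M" and D = D, OF R(5,6) M p, unfolded R(1-4), OF D']
    obtain R' where R': "exec ?M generator_program ?R (generator_time D) R'"
      "int (R' 0) - int (R' 1) = autocorr ?p ?v"
      "R' 2 = 4 * 2 ^ root_exp ?E k ?E * ?B * (2 * (?p div 2))" by blast
    from R'(1) obtain t where t: "t \<le> generator_time D" "runs generator_program (?R, ?M) t (R', ?M)"
      by (auto simp: exec_def)
    have "initial_state n k b \<epsilon> i ?s x = (?R, ?M)"
      by (simp add: initial_state_def seed_bits_def)
    with t(2) have runs: "runs generator_program (initial_state n k b \<epsilon> i ?s x) t (R', ?M)" by simp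
    have den: "R' 2 = scale k b \<epsilon> * (2 * (?p div 2))" using R'(3) by (simp add: scale_def)
    have p2: "2 \<le> ?p" using p(2) by (rule prime_ge_2_nat)
    then have "0 < ?p div 2" by simp
    then have pos: "0 < R' 2" unfolding R'(3) using B0 by simp
    have "real (R' 0) - real (R' 1) = real_of_int (autocorr ?p ?v)"
      using R'(2) by (metis of_int_diff of_int_of_nat_eq)
    then have val: "generator n k b \<epsilon> x i = (real (R' 0) - real (R' 1)) / real (R' 2)"
      unfolding den by (simp add: generator_def wave_def seed_triple_def seed_length_def Let_def)
    have X: "n \<le> X" "k \<le> X" "?B \<le> X" "?E \<le> X" "1 \<le> X" using k unfolding X_def by linarith+
    have "width n \<le> X" using width(3)[of n] k by (simp add: X_def)
    have "12 * k\<^sup>2 * width n * ?E \<le> 12 * X\<^sup>2 * X * X"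
      by (intro mult_le_mono power_mono X \<open>width n \<le> X\<close>) auto
    moreover have "0 < 12 * k\<^sup>2 * width n * ?E" using k width(1) E0 by simp
    ultimately have "2 ^ prime_exp n k \<epsilon> \<le> 24 * X ^ 4"
      using le_power_ceiling_log(2)[of "12 * k\<^sup>2 * width n * ?E"]
      by (simp add: prime_exp_def power2_eq_square power4_eq_xxxx)
    then have "(2 ^ prime_exp n k \<epsilon>) ^ 4 \<le> (24 * X ^ 4) ^ 4" by (intro power_mono) auto
    moreover have "(2::nat) ^ (2 * ?u) = 256 * (2 ^ prime_exp n k \<epsilon>) ^ 4"
    proof -
      have "2 * ?u = prime_exp n k \<epsilon> * 4 + 8" by (simp add: block_def)
      then show ?thesis by (simp only: power_add power_mult) simp
    qed
    ultimately have "2 ^ (2 * ?u) \<le> 256 * (24 * X ^ 4) ^ 4" by linarith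
    also have "\<dots> = 256 * 24 ^ 4 * X ^ 16" by (simp add: power_mult_distrib flip: power_mult)
    finally have q: "2 ^ (2 * ?u) \<le> 256 * 24 ^ 4 * X ^ 16" .
    have X16: "X \<le> X ^ 16" "X\<^sup>2 \<le> X ^ 16"
      using power_increasing[of 1 16 X] power_increasing[of 2 16 X] X(5) by simp_all
    have "?E * ?B \<le> X * X" using X by (intro mult_le_mono)
    then have "8 * ?E * ?B \<le> 8 * X\<^sup>2" by (simp add: power2_eq_square)
    then have "D \<le> c * X ^ 16"
      using q X X16 unfolding D_def c_def distrib_right by linarith
    have "1 \<le> D" using k by (simp add: D_def)
    have "t \<le> 500 * D ^ 3" using t(1) generator_time_le[OF \<open>1 \<le> D\<close>] by linarith
    also have "\<dots> \<le> 500 * (c * X ^ 16) ^ 3" using \<open>D \<le> c * X ^ 16\<close> by (intro mult_le_mono2 power_mono) auto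
    also have "\<dots> = 500 * c ^ 3 * X ^ 48" by (simp add: power_mult_distrib flip: power_mult)
    finally have "t \<le> 500 * c ^ 3 * (n + k + ?B + nat \<lceil>1 / \<epsilon>\<rceil>) ^ 48"
      by (simp add: X_def inv_error_def)
    with runs pos val show "\<exists>t R M. runs generator_program (initial_state n k b \<epsilon> i ?s x) t (R, M) \<and>
        t \<le> 500 * c ^ 3 * (n + k + ?B + nat \<lceil>1 / \<epsilon>\<rceil>) ^ 48 \<and> 0 < R 2 \<and>
        generator n k b \<epsilon> x i = (real (R 0) - real (R 1)) / real (R 2)"
      by blast
  qed
qed

text \<open>A uniform seed thus yields three independent uniform numbers. Reading bits is injective,
  and both sides have \<open>2 ^ (6 * u)\<close> elements.\<close>

lemma seed_triple_bij:
  "bij_betw (seed_triple u) (cube (6 * u)) ({..<2 ^ (2 * u)} \<times> {..<2 ^ (2 * u)} \<times> {..<2 ^ (2 * u)})"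
    (is "bij_betw _ _ ?Q")
proof -
  have M: "seed_bits s x j \<le> 1" for s x j by (simp add: seed_bits_def)
  have sub: "seed_triple u ` cube (6 * u) \<subseteq> ?Q"
    by (auto simp: seed_triple_def Let_def intro!: bits_value_less M)
  have inj: "inj_on (seed_triple u) (cube (6 * u))"
  proof (rule inj_onI)
    fix x x' assume x: "x \<in> cube (6 * u)" "x' \<in> cube (6 * u)" and eq: "seed_triple u x = seed_triple u x'"
    let ?M = "seed_bits (6 * u) x" and ?M' = "seed_bits (6 * u) x'"
    have "bits_value ?M 0 (2 * u) = bits_value ?M' 0 (2 * u)"
      "bits_value ?M (2 * u) (2 * u) = bits_value ?M' (2 * u) (2 * u)"
      "bits_value ?M (4 * u) (2 * u) = bits_value ?M' (4 * u) (2 * u)"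
      using eq by (simp_all add: seed_triple_def Let_def)
    note inj = this[THEN bits_value_inj[where M = ?M and M' = ?M', OF M M]]
    have "x j = x' j" if "j < 6 * u" for j
    proof -
      have "?M j = ?M' j"
      proof -
        consider "j < 2 * u" | "2 * u \<le> j" "j < 4 * u" | "4 * u \<le> j"
          by (metis not_le)
        then show ?thesis using inj(1)[of j] inj(2)[of "j - 2 * u"] inj(3)[of "j - 4 * u"] that
          by cases auto
      qed
      moreover have "x j \<in> {-1, 1}" "x' j \<in> {-1, 1}" using x that by (auto simp: cube_def PiE_iff)
      ultimately show ?thesis using that by (auto simp: seed_bits_def split: if_splits)
    qed
    then show "x = x'" using x unfolding cube_def by (intro PiE_ext) auto
  qed
  have "card (seed_triple u ` cube (6 * u)) = card ?Q"
    by (simp add: card_image[OF inj] card_cube card_cartesian_product flip: power_add)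
  then have "seed_triple u ` cube (6 * u) = ?Q" by (intro card_subset_eq[OF _ sub]) auto
  with inj show ?thesis by (simp add: bij_betw_def)
qed

lemma sum_cube_seed_triple:
  "(\<Sum>x\<in>cube (6 * u). f (seed_triple u x)) =
    (\<Sum>z\<^sub>1<2 ^ (2 * u). \<Sum>z\<^sub>2<2 ^ (2 * u). \<Sum>y<2 ^ (2 * u). f (z\<^sub>1, z\<^sub>2, y))"
  using sum.reindex_bij_betw[OF seed_triple_bij, of f u]
  by (simp add: sum.cartesian_product case_prod_beta)

section \<open>Analysis for fixed parameters\<close>

locale parameters =
  fixes n k :: nat and b \<epsilon> :: real
  assumes k: "2 < k" and b: "1 \<le> b" and \<epsilon>: "0 < \<epsilon>"
begin

abbreviation "u \<equiv> block n k \<epsilon>"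
abbreviation "p \<equiv> modulus n k \<epsilon>"
abbreviation "q \<equiv> 2 ^ (2 * u) :: nat"
abbreviation "E \<equiv> inv_error \<epsilon>"
abbreviation "e \<equiv> min 1 \<epsilon>"
abbreviation "m \<equiv> 2 ^ root_exp E k E :: nat"
abbreviation "t \<equiv> 1 / real (scale k b \<epsilon>)"

definition Y :: "(nat \<Rightarrow> real) \<Rightarrow> nat \<Rightarrow> real" where
  "Y x i = wave p (case seed_triple u x of (z\<^sub>1, z\<^sub>2, y) \<Rightarrow> sample p z\<^sub>1 z\<^sub>2 y i)"

lemma error_bounds: "0 < e" "e \<le> 1" "e \<le> \<epsilon>" "1 \<le> real E * e" "real E * e \<le> 2" "0 < E"
  using \<epsilon> inv_error[OF \<epsilon>] by (auto simp: field_simps)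

lemma modulus_bounds: "prime p" "12 * (k\<^sup>2 * width n * E) \<le> p" "64 \<le> p" "p \<le> 2 ^ u" "p \<le> q" "odd p" "1 < p"
proof -
  show "prime p" "p \<le> 2 ^ u" and ge: "12 * (k\<^sup>2 * width n * E) \<le> p"
    using modulus[of k \<epsilon> n] k \<epsilon> by (simp_all add: mult.assoc)
  have "3 * 3 \<le> k * k" using k by (intro mult_le_mono) auto
  moreover have "k * k * 1 * 1 \<le> k\<^sup>2 * width n * E"
    using width(1)[of n] error_bounds(6) by (intro mult_le_mono) (auto simp: power2_eq_square)
  ultimately show "64 \<le> p" using ge by linarith
  have "(2::nat) ^ u \<le> q" by (rule power_increasing) auto
  with \<open>p \<le> 2 ^ u\<close> show "p \<le> q" by linarith
  show "odd p" "1 < p" using \<open>64 \<le> p\<close> \<open>prime p\<close> prime_odd_nat[of p] by auto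
qed

lemma card_cube_seed: "real (card (cube (6 * u))) = real q ^ 3"
  by (simp add: card_cube mult.commute flip: power_mult)

text \<open>With \<open>K = k\<^sup>2 * width n\<close> the three errors are at most
  \<open>2 * K / p\<close>, \<open>4 * K / p\<close> and \<open>1 / p\<close>, together
  \<open>7 * K / p\<close>; the claim follows from \<open>12 * K * E \<le> p\<close> and
  \<open>1 \<le> E * e\<close>.\<close>

lemma moment_bound:
  assumes S: "S \<subseteq> {..<n}" "S \<noteq> {}" "card S < k"
  shows "\<bar>\<Sum>x\<in>cube (6 * u). \<Prod>i\<in>S. Y x i\<bar> \<le> e * real (card (cube (6 * u)))"
proof -
  have finS: "finite S" using S finite_subset by blast
  have W: "i < 2 ^ width n" if "i \<in> S" for i using that S(1) width(2)[of n] by auto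
  let ?c = "real (card S)" and ?K = "real k ^ 2 * real (width n)"
  have W1: "1 \<le> real (width n)" using width(1)[of n] by simp
  have k1: "?c \<le> real k" "1 \<le> real k" using S(3) k by auto
  have c2: "?c\<^sup>2 * real (width n) \<le> ?K" using k1 by (intro mult_right_mono power_mono) auto
  have c1: "?c \<le> ?K"
  proof -
    have "?c * 1 * 1 \<le> real k * real k * real (width n)" using k1 W1 by (intro mult_mono) auto
    then show ?thesis by (simp add: power2_eq_square)
  qed
  have p0: "0 < real p" using modulus_bounds(7) by simp
  have "real (12 * (k\<^sup>2 * width n * E)) \<le> real p" using modulus_bounds(2) by (rule of_nat_mono)
  then have pK: "12 * (?K * real E) \<le> real p" by simp
  have E1: "1 \<le> real E" using error_bounds(6) by simp
  have K1: "1 \<le> ?K" using W1 k1 mult_mono[of 1 "real k ^ 2" 1 "real (width n)"] by simp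
  \<comment> \<open>This is why a seed number has 2u bits: \<open>q = (2 ^ u)\<^sup>2\<close> and
    \<open>p \<le> 2 ^ u\<close> make \<open>p / q\<close> at most \<open>1 / p\<close>.\<close>
  have "real p / real q \<le> real (2 ^ u) / real q" using modulus_bounds(4) by (intro divide_right_mono) auto
  also have "\<dots> = 1 / real (2 ^ u)" by (simp add: mult_2 power_add)
  also have "\<dots> \<le> 1 / real p" using modulus_bounds(4) p0 by (intro divide_left_mono) auto
  finally have "2 * ?c\<^sup>2 * real (width n) / real p + 4 * ?c / real p + real p / real q \<le>
      2 * ?K / real p + 4 * ?K / real p + ?K / real p"
    using c1 c2 p0 K1 by (intro add_mono divide_right_mono) (auto simp: mult.assoc intro: order.trans[OF _ divide_right_mono])
  also have "\<dots> = 7 * ?K / real p" by (simp add: add_divide_distrib[symmetric])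
  also have "\<dots> \<le> e"
  proof -
    have "7 * ?K \<le> 12 * ?K * (real E * e)"
      using K1 error_bounds(4) mult_left_mono[OF error_bounds(4), of "12 * ?K"] by simp
    also have "\<dots> = 12 * (?K * real E) * e" by simp
    also have "\<dots> \<le> real p * e" using pK error_bounds(1) by (intro mult_right_mono) auto
    finally show ?thesis by (simp only: pos_divide_le_eq[OF p0] mult.commute[of e])
  qed
  finally have le: "2 * ?c\<^sup>2 * real (width n) / real p + 4 * ?c / real p + real p / real q \<le> e" .
  have "(\<Sum>x\<in>cube (6 * u). \<Prod>i\<in>S. Y x i) =
      (\<Sum>z\<^sub>1<q. \<Sum>z\<^sub>2<q. \<Sum>y<q. \<Prod>i\<in>S. wave p (sample p z\<^sub>1 z\<^sub>2 y i))"
    unfolding Y_def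
    using sum_cube_seed_triple[of "\<lambda>z. \<Prod>i\<in>S. wave p (case z of (z\<^sub>1, z\<^sub>2, y) \<Rightarrow> sample p z\<^sub>1 z\<^sub>2 y i)" u]
    by simp
  also have "\<bar>\<dots>\<bar> \<le> real q ^ 3 *
      (2 * ?c\<^sup>2 * real (width n) / real p + 4 * ?c / real p + real p / real q)"
    by (rule almost_independent[OF modulus_bounds(1,6,5) finS S(2) W])
  also have "\<dots> \<le> real q ^ 3 * e" using le by (rule mult_left_mono) simp
  finally show ?thesis by (simp only: card_cube_seed mult.commute)
qed

lemma abs_Y_le: "\<bar>Y x i\<bar> \<le> 1"
  unfolding Y_def by (rule abs_wave_le_1[OF modulus_bounds(6,7)])

lemma second_moment: "real q ^ 3 / 400 \<le> (\<Sum>x\<in>cube (6 * u). (Y x i)\<^sup>2)"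
proof -
  have "(\<Sum>z\<^sub>1<q. \<Sum>z\<^sub>2<q. real q / 400) \<le>
      (\<Sum>z\<^sub>1<q. \<Sum>z\<^sub>2<q. \<Sum>y<q. (wave p (sample p z\<^sub>1 z\<^sub>2 y i))\<^sup>2)"
    unfolding sample_def by (intro sum_mono sum_wave_square_scaled_ge[OF modulus_bounds(1,3,5)])
  also have "\<dots> = (\<Sum>x\<in>cube (6 * u). (Y x i)\<^sup>2)"
    unfolding Y_def
    using sum_cube_seed_triple[of "\<lambda>z. (wave p (case z of (z\<^sub>1, z\<^sub>2, y) \<Rightarrow> sample p z\<^sub>1 z\<^sub>2 y i))\<^sup>2" u]
    by simp
  finally show ?thesis by (simp add: power3_eq_cube)
qed

lemma ceil_b: "b \<le> real (nat \<lceil>b\<rceil>)" "real (nat \<lceil>b\<rceil>) \<le> 2 * b"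
  using b by linarith+

lemma root_bounds: "0 < m" "E \<le> m ^ k" "m ^ k < 2 ^ k * E"
proof -
  have "0 < k" using k by simp
  with root_exp_props[OF this error_bounds(6)] show "0 < m" "E \<le> m ^ k" "m ^ k < 2 ^ k * E"
    by (simp_all add: mult.commute flip: power_mult)
qed

text \<open>Since \<lceil>b\<rceil> is at least \<open>b\<close>,
  \<open>4 * (t * b) \<le> 1 / m\<close>, and \<open>m ^ k \<ge> E \<ge> 1 / e\<close>.\<close>

lemma scale_bounds: "0 < t" "4 * (t * b) \<le> 1" "(4 * (t * b)) ^ k \<le> e"
proof -
  define B where "B = real (nat \<lceil>b\<rceil>)"
  note ceil_b = ceil_b[folded B_def]
  have t_eq: "t = 1 / (4 * real m * B)" by (simp add: scale_def B_def)
  have B0: "0 < B" using ceil_b(1) b by linarith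
  show "0 < t" unfolding t_eq using B0 root_bounds(1) by simp
  have "4 * (t * b) = b / (real m * B)" unfolding t_eq by (simp add: field_simps)
  also have "\<dots> \<le> B / (real m * B)" using ceil_b(1) B0 root_bounds(1) by (intro divide_right_mono) auto
  also have "\<dots> = 1 / real m" using B0 by simp
  finally have le: "4 * (t * b) \<le> 1 / real m" .
  have "1 \<le> real m" using root_bounds(1) by simp
  then have "1 / real m \<le> 1" by simp
  with le show "4 * (t * b) \<le> 1" by linarith
  have "0 \<le> 4 * (t * b)" using \<open>0 < t\<close> b by simp
  with le have "(4 * (t * b)) ^ k \<le> (1 / real m) ^ k" by (rule power_mono)
  also have "\<dots> = 1 / real (m ^ k)" by (simp add: power_one_over)
  also have "\<dots> \<le> 1 / real E" using root_bounds(2) error_bounds(6) by (intro divide_left_mono) (auto simp del: of_nat_power)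
  also have "\<dots> \<le> e"
  proof -
    have "0 < real E" using error_bounds(6) by simp
    then show ?thesis using error_bounds(4) by (simp only: pos_divide_le_eq mult.commute[of e])
  qed
  finally show "(4 * (t * b)) ^ k \<le> e" .
qed

text \<open>The roundings lose constants only. For \<open>r = e powr (1 / k)\<close>,
  \<open>m ^ k < 2 ^ k * E\<close> and \<open>E * e \<le> 2\<close> give
  \<open>m * r \<le> 4\<close>; with \<lceil>b\<rceil> \<le> 2b the inverse of \<open>t\<close> is
  at most \<open>4 * 4 * 2 * b / r\<close>, and 1024 is the square of 32.\<close>

lemma t_square_ge: "e powr (2 / real k) / (1024 * b\<^sup>2) \<le> t\<^sup>2"
proof -
  define B where "B = real (nat \<lceil>b\<rceil>)"
  note ceil_b = ceil_b[folded B_def]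
  have t_eq: "t = 1 / (4 * real m * B)" by (simp add: scale_def B_def)
  define r where "r = e powr (1 / real k)"
  have r0: "0 < r" using error_bounds(1) by (simp add: r_def)
  have "r ^ k = e" using error_bounds(1) k by (simp add: r_def powr_powr flip: powr_realpow)
  then have "(real m * r) ^ k = real (m ^ k) * e" by (simp add: power_mult_distrib)
  also have "\<dots> \<le> real (2 ^ k * E) * e"
    using root_bounds(3) error_bounds(1) by (intro mult_right_mono of_nat_mono) auto
  also have "\<dots> = 2 ^ k * (real E * e)" by simp
  also have "\<dots> \<le> 2 ^ k * 2 ^ k"
  proof (rule mult_left_mono)
    have "(2::real) ^ 1 \<le> 2 ^ k" using k by (intro power_increasing) auto
    then show "real E * e \<le> 2 ^ k" using error_bounds(5) by simp
  qed simp
  also have "\<dots> = (4::real) ^ k" by (simp flip: power_mult_distrib)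
  finally have "(real m * r) ^ k \<le> 4 ^ k" .
  then have mr: "real m * r \<le> 4" using k by (subst (asm) power_mono_iff) (use r0 in auto)
  have B0: "0 < B" using ceil_b(1) b by linarith
  have "real m * r * B \<le> 4 * (2 * b)" using mr ceil_b(2) B0 by (intro mult_mono) auto
  then have "r * (4 * real m * B) \<le> 32 * b" by (simp add: mult_ac)
  then have "r / (32 * b) \<le> t"
    using b B0 root_bounds(1) unfolding t_eq by (simp add: field_simps)
  then have "(r / (32 * b))\<^sup>2 \<le> t\<^sup>2" using r0 b by (intro power_mono) auto
  moreover have "r\<^sup>2 = e powr (2 / real k)"
    using error_bounds(1) by (simp add: r_def power2_eq_square flip: powr_add)
  ultimately show ?thesis by (simp add: power_divide power_mult_distrib)
qed

lemma generator_eq: "generator n k b \<epsilon> = (\<lambda>x i. t * Y x i)"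
  by (simp add: generator_def[abs_def] Y_def[abs_def])

lemma uniform_bits_eq: "uniform_bits (seed_length n k b \<epsilon>) = pmf_of_set (cube (6 * u))"
  by (simp add: uniform_bits_def seed_length_def)

lemma cube_nonempty: "cube (6 * u) \<noteq> {}"
  using card_cube[of "6 * u"] by (metis card.empty power_not_zero zero_neq_numeral)

text \<open>Product of \<open>t_square_ge\<close> and \<open>second_moment\<close>: 409600 = 1024 *
  400.\<close>

lemma noticeable_generator:
  "noticeable n (1 / 409600 * e powr (2 / real k) / b\<^sup>2)
    (map_pmf (generator n k b \<epsilon>) (uniform_bits (seed_length n k b \<epsilon>)))"
  unfolding noticeable_def
proof (intro allI impI)
  fix i
  have "measure_pmf.expectation (map_pmf (generator n k b \<epsilon>) (uniform_bits (seed_length n k b \<epsilon>))) (\<lambda>x. (x i)\<^sup>2)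
      = (\<Sum>x\<in>cube (6 * u). (t * Y x i)\<^sup>2) / real (card (cube (6 * u)))"
    unfolding generator_eq uniform_bits_eq
    by (simp add: integral_pmf_of_set[OF cube_nonempty finite_cube])
  also have "\<dots> = t\<^sup>2 * ((\<Sum>x\<in>cube (6 * u). (Y x i)\<^sup>2) / real q ^ 3)"
    by (simp only: card_cube_seed power_mult_distrib sum_distrib_left[symmetric] times_divide_eq_right)
  finally have eq: "measure_pmf.expectation (map_pmf (generator n k b \<epsilon>) (uniform_bits (seed_length n k b \<epsilon>)))
      (\<lambda>x. (x i)\<^sup>2) = t\<^sup>2 * ((\<Sum>x\<in>cube (6 * u). (Y x i)\<^sup>2) / real q ^ 3)" .
  have "1 / 400 \<le> (\<Sum>x\<in>cube (6 * u). (Y x i)\<^sup>2) / real q ^ 3"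
    using second_moment[of i] by (simp add: pos_le_divide_eq)
  then have "e powr (2 / real k) / (1024 * b\<^sup>2) * (1 / 400) \<le> t\<^sup>2 * ((\<Sum>x\<in>cube (6 * u). (Y x i)\<^sup>2) / real q ^ 3)"
    by (intro mult_mono t_square_ge) auto
  then show "1 / 409600 * e powr (2 / real k) / b\<^sup>2 \<le> measure_pmf.expectation
      (map_pmf (generator n k b \<epsilon>) (uniform_bits (seed_length n k b \<epsilon>))) (\<lambda>x. (x i)\<^sup>2)"
    unfolding eq by simp
qed

lemma fractional_prg_generator:
  assumes "F \<subseteq> boolean_functions n" "closed_under_restrictions n F"
    "M_class n k F \<le> b ^ k" "\<forall>i. 1 \<le> i \<and> i < k \<longrightarrow> L1_class n i F \<le> b ^ i"
  shows "fractional_prg n F \<epsilon> (map_pmf (generator n k b \<epsilon>) (uniform_bits (seed_length n k b \<epsilon>)))"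
proof -
  have "fractional_prg n F e (map_pmf (\<lambda>x i. t * Y x i) (pmf_of_set (cube (6 * u))))"
    by (rule fractional_prg_scaled[OF assms(1-3) _ finite_cube cube_nonempty abs_Y_le moment_bound scale_bounds b])
       (use assms(4) k in auto)
  then show ?thesis
    unfolding generator_eq uniform_bits_eq fractional_prg_def using error_bounds(3) by force
qed

text \<open>The seed has \<open>12 * prime_exp n k \<epsilon> + 24\<close> bits, and
  \<open>prime_exp\<close> is at most 7 + log log n + 2 log k + log (1/e). The constant 12 * 7 + 24
  = 108 is absorbed by log k \<ge> 1, whose coefficient becomes 108 + 24 = 132.\<close>

lemma seed_length_le:
  "real (seed_length n k b \<epsilon>) \<le> 132 * (log 2 (log 2 (real n)) + log 2 (real k) + log 2 (1 / e))"
proof -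
  have W0: "0 < real (width n)" using width(1) by simp
  have E0: "0 < real E" using error_bounds(6) by simp
  have logW: "log 2 (real (width n)) \<le> 1 + log 2 (log 2 (real n))" and nn: "0 \<le> log 2 (log 2 (real n))"
  proof -
    consider "n \<le> 1" | "2 \<le> n" by linarith
    then have "log 2 (real (width n)) \<le> 1 + log 2 (log 2 (real n)) \<and> 0 \<le> log 2 (log 2 (real n))"
    proof cases
      case 1
      then have "n = 0 \<or> n = 1" by auto
      \<comment> \<open>As \<open>ln 0 = 0\<close>, the iterated logarithm is 0 here, and
        \<open>width n = 1\<close>.\<close>
      then show ?thesis by (auto simp: width_def log_def)
    next
      case 2
      have l1: "1 \<le> log 2 (real n)" using 2 by (subst le_log_iff) auto
      have "real (width n) \<le> 2 * log 2 (real n)"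
      proof -
        have "max 2 n = n" using 2 by simp
        then show ?thesis using l1 unfolding width_def by linarith
      qed
      then have "log 2 (real (width n)) \<le> log 2 (2 * log 2 (real n))"
        using W0 l1 by (subst log_le_cancel_iff) auto
      also have "\<dots> = 1 + log 2 (log 2 (real n))" using l1 by (subst log_mult) auto
      finally show ?thesis using l1 by simp
    qed
    then show "log 2 (real (width n)) \<le> 1 + log 2 (log 2 (real n))" "0 \<le> log 2 (log 2 (real n))" by auto
  qed
  have "real E \<le> 2 * (1 / e)" using error_bounds(1,5) by (simp add: pos_le_divide_eq)
  then have "log 2 (real E) \<le> log 2 (2 * (1 / e))" using E0 error_bounds(1) by (subst log_le_cancel_iff) auto
  also have "\<dots> = 1 + log 2 (1 / e)" using error_bounds(1) by (subst log_mult) auto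
  finally have logE: "log 2 (real E) \<le> 1 + log 2 (1 / e)" .
  have loge: "0 \<le> log 2 (1 / e)" using error_bounds(1,2) by simp
  have logk: "1 \<le> log 2 (real k)" using k by (subst le_log_iff) auto
  have log12: "log 2 12 \<le> 4" by (subst log_le_iff) auto
  let ?N = "12 * k\<^sup>2 * width n * E"
  have "log 2 (real ?N) = log 2 12 + 2 * log 2 (real k) + log 2 (real (width n)) + log 2 (real E)"
    using k W0 E0 by (simp add: log_mult log_nat_power)
  then have N: "log 2 (real ?N) \<le> 6 + log 2 (log 2 (real n)) + 2 * log 2 (real k) + log 2 (1 / e)"
    using logW logE log12 by linarith
  have "0 < ?N" using k width(1)[of n] error_bounds(6) by simp
  then have "0 \<le> log 2 (real ?N)" by (subst zero_le_log_cancel_iff) linarith+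
  then have "real (prime_exp n k \<epsilon>) \<le> log 2 (real ?N) + 1" unfolding prime_exp_def by linarith
  then show ?thesis
    using N nn logk loge unfolding seed_length_def block_def by simp
qed

end

text \<open>Second moments in [-1, 1] never exceed 1, so for large \<epsilon> the noticeability can
  only grow with the capped error \<open>min 1 \<epsilon>\<close>; the cap also keeps the last
  logarithm nonnegative. The constants, \<open>s\<close> and \<open>G\<close> are chosen before the
  parameters, and \<open>G\<close> does not depend on \<open>F\<close>.\<close>

theorem theorem4p2:
  shows "\<exists>(c::real) (C::real) s G. 0 < c \<and> 0 < C \<and> explicit_generator s G \<and>
    (\<forall>(n::nat) (k::nat) (b::real) (\<epsilon>::real) F.
       F \<subseteq> boolean_functions n \<longrightarrow> F \<noteq> {} \<longrightarrow> closed_under_restrictions n F \<longrightarrow>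
       1 \<le> b \<longrightarrow> 2 < k \<longrightarrow>
       M_class n k F \<le> b ^ k \<longrightarrow> (\<forall>i. 1 \<le> i \<and> i < k \<longrightarrow> L1_class n i F \<le> b ^ i) \<longrightarrow>
       0 < \<epsilon> \<longrightarrow>
       (let X = map_pmf (G n k b \<epsilon>) (uniform_bits (s n k b \<epsilon>)) in
          fractional_prg n F \<epsilon> X \<and>
          noticeable n (c * min 1 \<epsilon> powr (2 / real k) / b\<^sup>2) X \<and>
          real (s n k b \<epsilon>)
            \<le> C * (log 2 (log 2 (real n)) + log 2 (real k) + log 2 (1 / min 1 \<epsilon>))))"
proof (rule exI[of _ "1 / 409600"], rule exI[of _ 132], rule exI[of _ seed_length],
    rule exI[of _ generator], intro conjI allI impI)
  fix n k :: nat and b \<epsilon> :: real and F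
  assume F: "F \<subseteq> boolean_functions n" "closed_under_restrictions n F"
    and b: "1 \<le> b" and k: "2 < k" and M: "M_class n k F \<le> b ^ k"
    and L: "\<forall>i. 1 \<le> i \<and> i < k \<longrightarrow> L1_class n i F \<le> b ^ i" and \<epsilon>: "0 < \<epsilon>"
  interpret parameters n k b \<epsilon> by unfold_locales fact+
  show "let X = map_pmf (generator n k b \<epsilon>) (uniform_bits (seed_length n k b \<epsilon>)) in
      fractional_prg n F \<epsilon> X \<and>
      noticeable n (1 / 409600 * min 1 \<epsilon> powr (2 / real k) / b\<^sup>2) X \<and>
      real (seed_length n k b \<epsilon>)
        \<le> 132 * (log 2 (log 2 (real n)) + log 2 (real k) + log 2 (1 / min 1 \<epsilon>))"
    unfolding Let_def
    using fractional_prg_generator[OF F M L] noticeable_generator seed_length_le by blast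
qed (simp_all add: explicit_generator)

end
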